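(* The variety $\mathcal{NJS}^{(3,2)}$ of nilpotent Jordan superalgebras of type $(3,2)$ over $\mathbb{C}$ has six irreducible components, given by $$\mathcal{C}_1=\overline{O((3,2)_{18})},\quad \mathcal{C}_2=\overline{O((3,2)_{19})},\quad \mathcal{C}_3=\overline{O((3,2)_{23})},$$ $$\mathcal{C}_4=\overline{O((3,2)_{25})},\quad \mathcal{C}_5=\overline{O((3,2)_{27})},\quad \mathcal{C}_6=\overline{O((3,2)_{29})},$$ where, on a homogeneous basis $\{e_1,e_2,e_3\}\cup\{f_1,f_2\}$ ($e_i$ even, $f_j$ odd), \begin{itemize} \item $(3,2)_{18}$: $e_1e_2=e_3,\ f_1f_2=e_1+e_2$; \item $(3,2)_{19}$: $e_1e_2=e_3,\ e_3f_2=f_1$; \item $(3,2)_{23}$: $e_1e_2=e_3,\ e_1f_2=e_2f_2=f_1,\ f_1f_2=e_3$; \item $(3,2)_{25}$: $e_1^2=e_2,\ e_1e_2=e_3,\ f_1f_2=e_2$; \item $(3,2)_{27}$: $e_1^2=e_2,\ e_1e_2=e_3,\ e_2f_2=f_1$; \item $(3,2)_{29}$: $e_1^2=e_2,\ e_1e_2=e_3,\ e_1f_2=f_1,\ f_1f_2=e_3$. \end{itemize} In particular, up to isomorphism, the rigid superalgebras in $\mathcal{NJS}^{(3,2)}$ are exactly $(3,2)_i$ with $i\in\{18,19,23,25,27,29\}$.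
   Context: All vector spaces are over $\mathbb{C}$. A superalgebra $J=J_0\oplus J_1$ is a $\mathbb{Z}_2$-graded (not necessarily associative) algebra: $J_iJ_j\subseteq J_{i+j \bmod 2}$; $|x|=i$ denotes the parity of a nonzero $x\in J_i$. A Jordan superalgebra is a superalgebra satisfying, for all nonzero homogeneous $x,y,z,w$, supercommutativity $xy=(-1)^{|x||y|}yx$ and the Jordan superidentity $$(wx)(yz)+(-1)^{|x||y|}(wy)(xz)+(-1)^{(|x|+|y|)|z|}(wz)(xy)-(-1)^{|w||x|}x(w(yz))-(-1)^{|y|(|w|+|x|)}y(w(xz))-(-1)^{|z|(|w|+|x|+|y|)}z(w(xy))=0.$$ $J$ is of type $(m,n)$ if $\dim J_0=m$ and $\dim J_1=n$. Put $J^1=J$ and $J^{k+1}=J^kJ+J^{k-1}J^2+\cdots+JJ^k$ for $k\ge 1$; $J$ is nilpotent if $J^k=0$ for some $k\geq 1$. Fix a $\mathbb{Z}_2$-graded vector space $V=V_0\oplus V_1$ with homogeneous basis $\{e_1,\dots,e_m\}\cup\{f_1,\dots,f_n\}$. A Jordan superalgebra structure on $V$ is encoded by its structure constants $(c_{ij}^k,\rho_{ij}^k,\Gamma_{ij}^k)\in\mathbb{C}^{m^3+2mn^2}$, where $e_ie_j=\sum_{k=1}^m c_{ij}^ke_k$, $e_if_j=\sum_{k=1}^n\rho_{ij}^kf_k$, $f_if_j=\sum_{k=1}^m\Gamma_{ij}^ke_k$. $\mathcal{NJS}^{(m,n)}\subseteq\mathbb{C}^{m^3+2mn^2}$ is the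 affine variety (Zariski closed set) of all structure constants of nilpotent Jordan superalgebras of type $(m,n)$. The group $G=\mathrm{GL}_m(\mathbb{C})\times\mathrm{GL}_n(\mathbb{C})$ acts on it by change of basis; its orbits are the isomorphism classes (isomorphisms are grading-preserving). $O(J)$ denotes the $G$-orbit of $J$ and the bar denotes Zariski closure. $J\in\mathcal{NJS}^{(m,n)}$ is rigid if $O(J)$ is Zariski open in $\mathcal{NJS}^{(m,n)}$. In multiplication tables, products of basis elements that are neither listed nor obtained from listed ones by supercommutativity ($e_if_j=f_je_i$, $f_if_j=-f_jf_i$, $e_ie_j=e_je_i$) are zero. *)

theory Defs
  imports "HOL-Analysis.Analysis"
begin

section \<open>Superalgebras on a coordinate space with even and odd coordinates\<close>

text \<open>
  The graded space \<open>V\<close> with \<open>dim V\<^sub>0 = CARD('m)\<close> and \<open>dim V\<^sub>1 = CARD('n)\<close> is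
  \<open>complex ^ ('m + 'n)\<close>: the even coordinates are indexed by \<open>Inl\<close>, the odd ones by \<open>Inr\<close>.
\<close>

definition even_part :: "(complex ^ ('m::finite + 'n::finite)) set" where
  "even_part = {x. \<forall>j. x $ Inr j = 0}"

definition odd_part :: "(complex ^ ('m::finite + 'n::finite)) set" where
  "odd_part = {x. \<forall>i. x $ Inl i = 0}"

definition homogeneous :: "complex ^ ('m::finite + 'n::finite) \<Rightarrow> bool" where
  "homogeneous x \<longleftrightarrow> x \<noteq> 0 \<and> (x \<in> even_part \<or> x \<in> odd_part)"

definition parity :: "complex ^ ('m::finite + 'n::finite) \<Rightarrow> nat" where
  "parity x = (if x \<in> even_part then 0 else 1)"

definition superalgebra ::
  "(complex ^ ('m::finite + 'n::finite) \<Rightarrow> complex ^ ('m + 'n) \<Rightarrow> complex ^ ('m + 'n)) \<Rightarrow> bool"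
where
  "superalgebra mul \<longleftrightarrow>
     (\<forall>x. Vector_Spaces.linear (*s) (*s) (\<lambda>y. mul x y)) \<and>
     (\<forall>y. Vector_Spaces.linear (*s) (*s) (\<lambda>x. mul x y)) \<and>
     (\<forall>x\<in>even_part. \<forall>y\<in>even_part. mul x y \<in> even_part) \<and>
     (\<forall>x\<in>even_part. \<forall>y\<in>odd_part. mul x y \<in> odd_part) \<and>
     (\<forall>x\<in>odd_part. \<forall>y\<in>even_part. mul x y \<in> odd_part) \<and>
     (\<forall>x\<in>odd_part. \<forall>y\<in>odd_part. mul x y \<in> even_part)"

definition jordan_superalgebra ::
  "(complex ^ ('m::finite + 'n::finite) \<Rightarrow> complex ^ ('m + 'n) \<Rightarrow> complex ^ ('m + 'n)) \<Rightarrow> bool"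
where
  "jordan_superalgebra mul \<longleftrightarrow>
     superalgebra mul \<and>
     (\<forall>x y. homogeneous x \<and> homogeneous y \<longrightarrow>
        mul x y = (- 1) ^ (parity x * parity y) *s mul y x) \<and>
     (\<forall>x y z w. homogeneous x \<and> homogeneous y \<and> homogeneous z \<and> homogeneous w \<longrightarrow>
        mul (mul w x) (mul y z)
        + (- 1) ^ (parity x * parity y) *s mul (mul w y) (mul x z)
        + (- 1) ^ ((parity x + parity y) * parity z) *s mul (mul w z) (mul x y)
        - (- 1) ^ (parity w * parity x) *s mul x (mul w (mul y z))
        - (- 1) ^ (parity y * (parity w + parity x)) *s mul y (mul w (mul x z))
        - (- 1) ^ (parity z * (parity w + parity x + parity y)) *s mul z (mul w (mul x y))
        = 0)"

text \<open>
  \<open>J\<^sup>1 = J\<close> and \<open>J\<^sup>k = J\<^sup>k\<^sup>-\<^sup>1 J + \<dots> + J J\<^sup>k\<^sup>-\<^sup>1\<close> for \<open>k \<ge> 2\<close>. A product of subspaces is the span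
  of the elementwise products, so the sum is the span of all of them together.
  The value at \<open>k = 0\<close> carries no meaning and is never used.
\<close>

function alg_power ::
  "('a::field ^ 'd::finite \<Rightarrow> 'a ^ 'd \<Rightarrow> 'a ^ 'd) \<Rightarrow> nat \<Rightarrow> ('a ^ 'd) set"
where
  "alg_power mul k =
     (if k \<le> 1 then UNIV
      else vec.span (\<Union>i\<in>{1..<k}.
             {mul x y | x y. x \<in> alg_power mul i \<and> y \<in> alg_power mul (k - i)}))"
  by pat_completeness auto
termination
  by (relation "Wellfounded.measure snd") auto

declare alg_power.simps [simp del]

definition nilpotent_algebra ::
  "('a::field ^ 'd::finite \<Rightarrow> 'a ^ 'd \<Rightarrow> 'a ^ 'd) \<Rightarrow> bool"
where
  "nilpotent_algebra mul \<longleftrightarrow> (\<exists>k\<ge>1. alg_power mul k = {0})"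


section \<open>Structure constants\<close>

text \<open>
  A point \<open>s\<close> of \<open>\<complex>\<^bsup>m\<^sup>3 + 2mn\<^sup>2\<^esup>\<close> has the coordinates \<open>c\<close> (\<open>e\<^sub>i e\<^sub>j\<close> along \<open>e\<^sub>k\<close>),
  \<open>rho\<close> (\<open>e\<^sub>i f\<^sub>j\<close> along \<open>f\<^sub>k\<close>) and \<open>Gamma\<close> (\<open>f\<^sub>i f\<^sub>j\<close> along \<open>e\<^sub>k\<close>).
\<close>

type_synonym ('m, 'n) sc_index = "('m \<times> 'm \<times> 'm) + ('m \<times> 'n \<times> 'n) + ('n \<times> 'n \<times> 'm)"

type_synonym ('m, 'n) sconsts = "(complex, ('m, 'n) sc_index) vec"

definition sc_c :: "('m::finite, 'n::finite) sconsts \<Rightarrow> 'm \<Rightarrow> 'm \<Rightarrow> 'm \<Rightarrow> complex" where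
  "sc_c s i j k = s $ Inl (i, j, k)"

definition sc_rho :: "('m::finite, 'n::finite) sconsts \<Rightarrow> 'm \<Rightarrow> 'n \<Rightarrow> 'n \<Rightarrow> complex" where
  "sc_rho s i j k = s $ Inr (Inl (i, j, k))"

definition sc_Gamma :: "('m::finite, 'n::finite) sconsts \<Rightarrow> 'n \<Rightarrow> 'n \<Rightarrow> 'm \<Rightarrow> complex" where
  "sc_Gamma s i j k = s $ Inr (Inr (i, j, k))"

definition mk_sconsts ::
  "('m::finite \<Rightarrow> 'm \<Rightarrow> 'm \<Rightarrow> complex) \<Rightarrow> ('m \<Rightarrow> 'n::finite \<Rightarrow> 'n \<Rightarrow> complex) \<Rightarrow>
   ('n \<Rightarrow> 'n \<Rightarrow> 'm \<Rightarrow> complex) \<Rightarrow> ('m, 'n) sconsts"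
where
  "mk_sconsts c r g = (\<chi> t. case t of
       Inl (i, j, k) \<Rightarrow> c i j k
     | Inr (Inl (i, j, k)) \<Rightarrow> r i j k
     | Inr (Inr (i, j, k)) \<Rightarrow> g i j k)"

text \<open>
  The bilinear product encoded by \<open>s\<close>. The products \<open>f\<^sub>j e\<^sub>i\<close> are not recorded in \<open>s\<close>; they are
  \<open>e\<^sub>i f\<^sub>j\<close>, as supercommutativity forces. Supercommutativity of the \<open>e\<^sub>i e\<^sub>j\<close> and of the
  \<open>f\<^sub>i f\<^sub>j\<close> is not built in, but is a condition on \<open>s\<close>.
\<close>

definition sc_mult ::
  "('m::finite, 'n::finite) sconsts \<Rightarrow>
   complex ^ ('m + 'n) \<Rightarrow> complex ^ ('m + 'n) \<Rightarrow> complex ^ ('m + 'n)"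
where
  "sc_mult s x y = (\<chi> t. case t of
       Inl k \<Rightarrow> (\<Sum>i\<in>UNIV. \<Sum>j\<in>UNIV. sc_c s i j k * x $ Inl i * y $ Inl j)
              + (\<Sum>i\<in>UNIV. \<Sum>j\<in>UNIV. sc_Gamma s i j k * x $ Inr i * y $ Inr j)
     | Inr k \<Rightarrow> (\<Sum>i\<in>UNIV. \<Sum>j\<in>UNIV. sc_rho s i j k * x $ Inl i * y $ Inr j)
              + (\<Sum>i\<in>UNIV. \<Sum>j\<in>UNIV. sc_rho s i j k * x $ Inr j * y $ Inl i))"

definition NJS :: "('m::finite, 'n::finite) sconsts set" where
  "NJS = {s. jordan_superalgebra (sc_mult s) \<and> nilpotent_algebra (sc_mult s)}"

text \<open>
  \<open>(P, Q) \<in> GL\<^sub>m \<times> GL\<^sub>n\<close> acts by transport of structure along \<open>T = P \<oplus> Q\<close>: the new product is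
  \<open>T (T\<^sup>-\<^sup>1 x \<cdot> T\<^sup>-\<^sup>1 y)\<close>. The old product thus has the new structure constants with respect
  to the basis \<open>T\<^sup>-\<^sup>1 e\<^sub>i\<close>, \<open>T\<^sup>-\<^sup>1 f\<^sub>j\<close>.
\<close>

definition sc_act ::
  "complex ^ 'm ^ 'm \<Rightarrow> complex ^ 'n ^ 'n \<Rightarrow> ('m::finite, 'n::finite) sconsts \<Rightarrow> ('m, 'n) sconsts"
where
  "sc_act P Q s = mk_sconsts
     (\<lambda>i j k. \<Sum>a\<in>UNIV. \<Sum>b\<in>UNIV. \<Sum>l\<in>UNIV.
        matrix_inv P $ a $ i * matrix_inv P $ b $ j * sc_c s a b l * P $ k $ l)
     (\<lambda>i j k. \<Sum>a\<in>UNIV. \<Sum>b\<in>UNIV. \<Sum>l\<in>UNIV.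
        matrix_inv P $ a $ i * matrix_inv Q $ b $ j * sc_rho s a b l * Q $ k $ l)
     (\<lambda>i j k. \<Sum>a\<in>UNIV. \<Sum>b\<in>UNIV. \<Sum>l\<in>UNIV.
        matrix_inv Q $ a $ i * matrix_inv Q $ b $ j * sc_Gamma s a b l * P $ k $ l)"

definition orbit :: "('m::finite, 'n::finite) sconsts \<Rightarrow> ('m, 'n) sconsts set" where
  "orbit s = {sc_act P Q s | P Q. invertible P \<and> invertible Q}"

definition isomorphic :: "('m::finite, 'n::finite) sconsts \<Rightarrow> ('m, 'n) sconsts \<Rightarrow> bool" where
  "isomorphic s t \<longleftrightarrow>
     (\<exists>T :: complex ^ ('m + 'n) \<Rightarrow> complex ^ ('m + 'n).
        Vector_Spaces.linear (*s) (*s) T \<and> bij T \<and>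
        T ` even_part \<subseteq> even_part \<and> T ` odd_part \<subseteq> odd_part \<and>
        (\<forall>x y. T (sc_mult s x y) = sc_mult t (T x) (T y)))"


section \<open>Zariski topology\<close>

inductive poly_fun :: "(complex ^ 'd::finite \<Rightarrow> complex) \<Rightarrow> bool" where
  const: "poly_fun (\<lambda>x. a)"
| coord: "poly_fun (\<lambda>x. x $ i)"
| add: "poly_fun p \<Longrightarrow> poly_fun q \<Longrightarrow> poly_fun (\<lambda>x. p x + q x)"
| mult: "poly_fun p \<Longrightarrow> poly_fun q \<Longrightarrow> poly_fun (\<lambda>x. p x * q x)"

definition zero_locus :: "(complex ^ 'd::finite \<Rightarrow> complex) set \<Rightarrow> (complex ^ 'd) set" where
  "zero_locus F = {x. \<forall>p\<in>F. p x = 0}"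

definition zariski_closed :: "(complex ^ 'd::finite) set \<Rightarrow> bool" where
  "zariski_closed S \<longleftrightarrow> (\<exists>F. (\<forall>p\<in>F. poly_fun p) \<and> S = zero_locus F)"

definition zariski :: "(complex ^ 'd::finite) topology" where
  "zariski = topology (\<lambda>U. zariski_closed (- U))"

lemma zariski_closed_Un:
  assumes "zariski_closed S" "zariski_closed T"
  shows "zariski_closed (S \<union> T)"
proof -
  obtain F G where F: "\<forall>p\<in>F. poly_fun p" "S = zero_locus F"
    and G: "\<forall>q\<in>G. poly_fun q" "T = zero_locus G"
    using assms by (auto simp: zariski_closed_def)
  let ?H = "{\<lambda>x. p x * q x | p q. p \<in> F \<and> q \<in> G}"
  have "\<forall>h\<in>?H. poly_fun h"
    using F(1) G(1) by (auto intro: poly_fun.mult)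
  moreover have "S \<union> T = zero_locus ?H"
  proof (intro equalityI subsetI)
    fix x assume "x \<in> zero_locus ?H"
    have *: "p x * q x = 0" if "p \<in> F" "q \<in> G" for p q
    proof -
      have "(\<lambda>x. p x * q x) \<in> ?H" using that by blast
      moreover have "\<forall>h\<in>?H. h x = 0"
        using \<open>x \<in> zero_locus ?H\<close> by (simp only: zero_locus_def mem_Collect_eq)
      ultimately show ?thesis by fast
    qed
    show "x \<in> S \<union> T"
    proof (cases "x \<in> S")
      case False
      then obtain p where "p \<in> F" "p x \<noteq> 0" using F(2) by (auto simp: zero_locus_def)
      then have "x \<in> T" using * G(2) by (auto simp: zero_locus_def)
      then show ?thesis by simp
    qed simp
  qed (auto simp: F(2) G(2) zero_locus_def)
  ultimately show ?thesis unfolding zariski_closed_def by blast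
qed

lemma zariski_closed_Inter:
  assumes "\<And>S. S \<in> \<S> \<Longrightarrow> zariski_closed S"
  shows "zariski_closed (\<Inter>\<S>)"
proof -
  have "\<forall>S\<in>\<S>. \<exists>F. (\<forall>p\<in>F. poly_fun p) \<and> S = zero_locus F"
    using assms by (auto simp: zariski_closed_def)
  then obtain F where F: "\<And>S. S \<in> \<S> \<Longrightarrow> (\<forall>p\<in>F S. poly_fun p) \<and> S = zero_locus (F S)"
    by metis
  have "\<forall>p\<in>\<Union>(F ` \<S>). poly_fun p" using F by blast
  moreover have "\<Inter>\<S> = zero_locus (\<Union>(F ` \<S>))"
  proof (intro set_eqI)
    fix x
    have "x \<in> S \<longleftrightarrow> (\<forall>p\<in>F S. p x = 0)" if "S \<in> \<S>" for S
      using F[OF that] unfolding zero_locus_def by blast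
    then show "x \<in> \<Inter>\<S> \<longleftrightarrow> x \<in> zero_locus (\<Union>(F ` \<S>))"
      by (auto simp: zero_locus_def)
  qed
  ultimately show ?thesis unfolding zariski_closed_def by blast
qed

lemma istopology_zariski: "istopology (\<lambda>U. zariski_closed (- U))"
  unfolding istopology_def
  by (auto simp: Compl_Int uminus_Sup intro!: zariski_closed_Un zariski_closed_Inter)

lemma openin_zariski: "openin zariski U \<longleftrightarrow> zariski_closed (- U)"
  by (simp add: zariski_def topology_inverse' istopology_zariski)

lemma topspace_zariski [simp]: "topspace zariski = UNIV"
proof -
  have "zariski_closed ({} :: (complex ^ 'd::finite) set)"
    unfolding zariski_closed_def zero_locus_def
    by (rule exI[of _ "{\<lambda>x. 1}"]) (auto intro: poly_fun.const)
  then have "openin zariski (UNIV :: (complex ^ 'd) set)"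
    by (simp add: openin_zariski)
  then show ?thesis
    using openin_subset by blast
qed

lemma closedin_zariski: "closedin zariski S \<longleftrightarrow> zariski_closed S"
  by (simp add: closedin_def openin_zariski Compl_eq_Diff_UNIV[symmetric])

definition irreducible_space :: "'a topology \<Rightarrow> bool" where
  "irreducible_space X \<longleftrightarrow> topspace X \<noteq> {} \<and>
     (\<forall>A B. closedin X A \<and> closedin X B \<and> topspace X = A \<union> B \<longrightarrow>
        A = topspace X \<or> B = topspace X)"

definition irreducible_components :: "'a topology \<Rightarrow> 'a set set" where
  "irreducible_components X =
     {C. C \<subseteq> topspace X \<and> irreducible_space (subtopology X C) \<and>
         (\<forall>D. C \<subseteq> D \<and> D \<subseteq> topspace X \<and> irreducible_space (subtopology X D) \<longrightarrow> D = C)}"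

definition rigid :: "('m::finite, 'n::finite) sconsts \<Rightarrow> bool" where
  "rigid s \<longleftrightarrow> s \<in> NJS \<and> openin (subtopology zariski NJS) (orbit s)"


section \<open>Multiplication tables of the six superalgebras\<close>

text \<open>
  A triple \<open>(i, j, k)\<close> in \<open>A\<close>, \<open>B\<close> or \<open>D\<close> is a summand \<open>e\<^sub>k\<close> of \<open>e\<^sub>i e\<^sub>j\<close>, a summand
  \<open>f\<^sub>k\<close> of \<open>e\<^sub>i f\<^sub>j\<close> or a summand \<open>e\<^sub>k\<close> of \<open>f\<^sub>i f\<^sub>j\<close>, with coefficient 1. In the numeral types
  \<open>3\<close> and \<open>2\<close> the indices are \<open>1, 2, 3\<close> and \<open>1, 2\<close> (the largest one also equals 0).
\<close>

definition table ::
  "('m::finite \<times> 'm \<times> 'm) set \<Rightarrow> ('m \<times> 'n::finite \<times> 'n) set \<Rightarrow> ('n \<times> 'n \<times> 'm) set \<Rightarrow>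
   ('m, 'n) sconsts"
where
  "table A B D = mk_sconsts
     (\<lambda>i j k. if (i, j, k) \<in> A \<or> (j, i, k) \<in> A then 1 else 0)
     (\<lambda>i j k. if (i, j, k) \<in> B then 1 else 0)
     (\<lambda>i j k. if (i, j, k) \<in> D then 1 else if (j, i, k) \<in> D then - 1 else 0)"

definition J18 :: "(3, 2) sconsts" where
  "J18 = table {(1, 2, 3)} {} {(1, 2, 1), (1, 2, 2)}"

definition J19 :: "(3, 2) sconsts" where
  "J19 = table {(1, 2, 3)} {(3, 2, 1)} {}"

definition J23 :: "(3, 2) sconsts" where
  "J23 = table {(1, 2, 3)} {(1, 2, 1), (2, 2, 1)} {(1, 2, 3)}"

definition J25 :: "(3, 2) sconsts" where
  "J25 = table {(1, 1, 2), (1, 2, 3)} {} {(1, 2, 2)}"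

definition J27 :: "(3, 2) sconsts" where
  "J27 = table {(1, 1, 2), (1, 2, 3)} {(2, 2, 1)} {}"

definition J29 :: "(3, 2) sconsts" where
  "J29 = table {(1, 1, 2), (1, 2, 3)} {(1, 2, 1)} {(1, 2, 3)}"

end

theory Submission
  imports Defs
begin

text \<open>
  Let \<open>A\<close> be the even part and \<open>M\<close> the odd part of a nilpotent Jordan superalgebra of type \<open>(3, 2)\<close>.
  Nilpotency gives a flag of \<open>A\<close> and a flag of \<open>M\<close> that multiplication by \<open>A\<close> lowers, and in a basis
  adapted to these flags the multiplication is a triangular table
  with ten free coefficients: four for the products of \<open>A\<close>, three for the linear form \<open>\<rho>\<close> with
  \<open>e\<^sub>i f\<^sub>2 = \<rho>(e\<^sub>i) f\<^sub>1\<close>, and three for the vector \<open>\<gamma> = f\<^sub>1 f\<^sub>2\<close> (\<open>exists_triangular_table\<close>). Evaluated on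
  basis vectors, the Jordan identity becomes a short list of equations in these coefficients
  (\<open>triang_Jordan_equations\<close>); nilpotency adds \<open>\<rho>(\<gamma>) = 0\<close>. A case analysis leaves six families
  (\<open>normal_form\<close>). If \<open>A\<^sup>3 \<noteq> 0\<close>, then \<open>A\<close> is spanned by \<open>x, x\<^sup>2, x\<^sup>3\<close>, and either \<open>\<rho>(x\<^sup>2) \<noteq> 0\<close> and \<open>\<gamma> = 0\<close>,
  or \<open>\<rho> = 0\<close> and \<open>\<gamma> x \<noteq> 0\<close>, or \<open>\<rho>\<close> vanishes on \<open>A\<^sup>2\<close> and \<open>\<gamma>\<close> is a multiple of \<open>x\<^sup>3\<close>. If \<open>A\<^sup>3 = 0\<close>, then
  the product of \<open>A\<close> is a quadratic form \<open>\<beta>\<close> with values in a line \<open>L\<close> that \<open>A\<close> annihilates, and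
  either \<open>\<gamma> = 0\<close>, or \<open>\<rho> = 0\<close>, or \<open>\<rho>\<close> vanishes on \<open>L\<close> and \<open>\<gamma> \<in> L\<close>, up to a few degenerate tables that
  belong to one of these families after a change of basis.

  In each family the general member is isomorphic to one of the six algebras; when \<open>\<beta>\<close> occurs this is
  because a nondegenerate quadratic form over \<open>\<complex>\<close> has a basis of isotropic vectors. A line in the
  space of coefficients joins every member to general ones, so the variety is the union of
  the six orbit closures (\<open>NJS_eq_Union_closures\<close>). These closures stay inside the variety,
  since the Jordan identity and the vanishing of the fifth power are closed conditions that hold for
  the six algebras, and they are irreducible, since orbits of \<open>GL\<^sub>m \<times> GL\<^sub>n\<close> are
  (\<open>orbit_irreducible\<close>).

  Conversely, each of the six orbits is the set of points of the variety at which certain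
  isomorphism invariants given by polynomials do not vanish: on the six families these conditions can
  be read off from the coefficients. So the six orbits are open in the variety (\<open>rigid_six\<close>). An
  orbit that is open meets every orbit in whose closure it lies (\<open>isomorphic_of_rigid_in_closure\<close>).
  As the six algebras are pairwise nonisomorphic, no closure is contained in another one, so the
  closures are the irreducible components; and a rigid algebra, lying in one of the closures, is
  isomorphic to one of the six.
\<close>

section \<open>Polynomial functions and the Zariski topology\<close>

lemma poly_fun_sum:
  assumes "\<And>i. i \<in> I \<Longrightarrow> poly_fun (f i)"
  shows "poly_fun (\<lambda>x. \<Sum>i\<in>I. f i x)"
  using assms
  by (induction I rule: infinite_finite_induct) (auto intro: poly_fun.intros)

lemma poly_fun_diff:
  assumes "poly_fun p" "poly_fun q"
  shows "poly_fun (\<lambda>x. p x - q x)"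
proof -
  have "poly_fun (\<lambda>x. p x + (- 1) * q x)"
    by (intro poly_fun.intros assms)
  then show ?thesis by simp
qed

lemma poly_fun_compose:
  assumes "poly_fun p" and "\<And>i. poly_fun (\<lambda>x. F x $ i)"
  shows "poly_fun (\<lambda>x. p (F x))"
  using assms(1) by induction (auto intro: poly_fun.intros assms(2))

lemma poly_fun_along_curve:
  assumes "poly_fun p" and "\<And>i. \<exists>q. \<forall>t. F t $ i = poly q t"
  shows "\<exists>q. \<forall>t. p (F t) = poly q t"
  using assms(1)
proof induction
  case (const a)
  show ?case by (rule exI[of _ "[:a:]"]) simp
next
  case (coord i)
  show ?case by (rule assms(2))
next
  case (add p q)
  then show ?case by (metis poly_add)
next
  case (mult p q)
  then show ?case by (metis poly_mult)
qed

lemma zariski_closed_Collect_eq_0: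
  assumes "poly_fun p"
  shows "zariski_closed {x. p x = 0}"
  unfolding zariski_closed_def zero_locus_def
  by (rule exI[of _ "{p}"]) (use assms in auto)

lemma zariski_closed_Collect_all:
  assumes "\<And>a. zariski_closed {x. P a x}"
  shows "zariski_closed {x. \<forall>a. P a x}"
proof -
  have "{x. \<forall>a. P a x} = \<Inter>(range (\<lambda>a. {x. P a x}))" by auto
  moreover have "zariski_closed (\<Inter>(range (\<lambda>a. {x. P a x})))"
    by (rule zariski_closed_Inter) (use assms in auto)
  ultimately show ?thesis by metis
qed

lemma zariski_closed_UNIV: "zariski_closed UNIV"
  by (metis closedin_zariski closedin_topspace topspace_zariski)

lemma zariski_closed_Collect_imp:
  assumes "R \<Longrightarrow> zariski_closed {x. P x}"
  shows "zariski_closed {x. R \<longrightarrow> P x}"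
  using assms by (cases R) (simp_all add: zariski_closed_UNIV)

lemma zariski_closed_Collect_conj:
  assumes "zariski_closed {x. P x}" "zariski_closed {x. Q x}"
  shows "zariski_closed {x. P x \<and> Q x}"
  using zariski_closed_Inter[of "{{x. P x}, {x. Q x}}"] assms by (auto simp: Int_def)

lemma zariski_closed_vec_eq_0:
  assumes "\<And>i. poly_fun (\<lambda>x. F x $ i)"
  shows "zariski_closed {x. F x = 0}"
  unfolding vec_eq_iff zero_index
  by (intro zariski_closed_Collect_all zariski_closed_Collect_eq_0 assms)

text \<open>The closure is the zero locus of polynomials, and those polynomials vanish on \<open>S\<close>.\<close>

lemma in_zariski_closureI:
  assumes "\<And>p. poly_fun p \<Longrightarrow> (\<And>y. y \<in> S \<Longrightarrow> p y = 0) \<Longrightarrow> p x = 0"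
  shows "x \<in> zariski closure_of S"
proof -
  have "zariski_closed (zariski closure_of S)"
    using closedin_closure_of closedin_zariski by blast
  then obtain F where F: "\<forall>p\<in>F. poly_fun p" "zariski closure_of S = zero_locus F"
    unfolding zariski_closed_def by blast
  have "S \<subseteq> zariski closure_of S" by (simp add: closure_of_subset)
  then show ?thesis using F assms by (auto simp: zero_locus_def subset_iff)
qed

lemma zariski_closure_minimal:
  "S \<subseteq> T \<Longrightarrow> zariski_closed T \<Longrightarrow> zariski closure_of S \<subseteq> T"
  by (simp add: closedin_zariski closure_of_minimal)

lemma zariski_closure_image:
  assumes F: "\<And>i. poly_fun (\<lambda>x. F x $ i)" and S: "F ` S \<subseteq> T" and x: "x \<in> zariski closure_of S"
  shows "F x \<in> zariski closure_of T"
proof (rule in_zariski_closureI)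
  fix p assume p: "poly_fun p" "\<And>y. y \<in> T \<Longrightarrow> p y = 0"
  have "zariski closure_of S \<subseteq> {x. p (F x) = 0}"
  proof (rule zariski_closure_minimal)
    show "S \<subseteq> {x. p (F x) = 0}" using p(2) S by blast
    show "zariski_closed {x. p (F x) = 0}"
      by (rule zariski_closed_Collect_eq_0[OF poly_fun_compose[OF p(1) F]])
  qed
  then show "p (F x) = 0" using x by auto
qed

text \<open>A polynomial in one variable with infinitely many zeros is zero, so a polynomial curve that
  meets a set for all but finitely many parameters stays in its closure. All degenerations below
  come from this.\<close>

lemma curve_in_zariski_closure:
  fixes F :: "complex \<Rightarrow> complex ^ 'd::finite"
  assumes F: "\<And>i. \<exists>q. \<forall>t. F t $ i = poly q t"
    and fin: "finite {t. F t \<notin> S}"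
  shows "F t0 \<in> zariski closure_of S"
proof (rule in_zariski_closureI)
  fix p assume p: "poly_fun p" "\<And>y. y \<in> S \<Longrightarrow> p y = 0"
  obtain q where q: "\<And>t. p (F t) = poly q t"
    using poly_fun_along_curve[OF p(1) F] by auto
  have "- {t. F t \<notin> S} \<subseteq> {t. poly q t = 0}"
    using p(2) q by force
  moreover have "infinite (- {t. F t \<notin> S})"
    using fin by (simp add: Compl_eq_Diff_UNIV infinite_UNIV_char_0)
  ultimately have "q = 0" using poly_roots_finite finite_subset by metis
  then show "p (F t0) = 0" by (simp add: q)
qed

section \<open>Irreducibility and irreducible components\<close>

definition irreducible_in :: "'a topology \<Rightarrow> 'a set \<Rightarrow> bool" where
  "irreducible_in X S \<longleftrightarrow> S \<noteq> {} \<and> S \<subseteq> topspace X \<and>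
     (\<forall>A B. closedin X A \<longrightarrow> closedin X B \<longrightarrow> S \<subseteq> A \<union> B \<longrightarrow> S \<subseteq> A \<or> S \<subseteq> B)"

text \<open>Irreducibility of a subspace is expressed through closed sets of the ambient space, which avoids
  iterated subspace topologies.\<close>

lemma irreducible_space_subtopology_iff:
  assumes "S \<subseteq> topspace X"
  shows "irreducible_space (subtopology X S) \<longleftrightarrow> irreducible_in X S"
proof
  assume irr: "irreducible_space (subtopology X S)"
  have top: "topspace (subtopology X S) = S" using assms by auto
  show "irreducible_in X S"
    unfolding irreducible_in_def
  proof (intro conjI allI impI)
    show "S \<noteq> {}" using irr top by (auto simp: irreducible_space_def)
    fix A B assume "closedin X A" "closedin X B" "S \<subseteq> A \<union> B"
    then have "closedin (subtopology X S) (A \<inter> S)" "closedin (subtopology X S) (B \<inter> S)"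
      "S = (A \<inter> S) \<union> (B \<inter> S)"
      by (auto simp: closedin_subtopology)
    then have "A \<inter> S = S \<or> B \<inter> S = S"
      using irr top unfolding irreducible_space_def by metis
    then show "S \<subseteq> A \<or> S \<subseteq> B" by auto
  qed (use assms in auto)
next
  assume irr: "irreducible_in X S"
  have top: "topspace (subtopology X S) = S" using assms by auto
  show "irreducible_space (subtopology X S)"
    unfolding irreducible_space_def top
  proof (intro conjI allI impI)
    show "S \<noteq> {}" using irr by (auto simp: irreducible_in_def)
    fix A B assume *: "closedin (subtopology X S) A \<and> closedin (subtopology X S) B \<and> S = A \<union> B"
    obtain A' where A: "closedin X A'" "A = A' \<inter> S"
      using * unfolding closedin_subtopology by metis
    obtain B' where B: "closedin X B'" "B = B' \<inter> S"
      using * unfolding closedin_subtopology by metis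
    have "S \<subseteq> A' \<union> B'" using * A(2) B(2) by blast
    then have "S \<subseteq> A' \<or> S \<subseteq> B'"
      using irr A(1) B(1) by (simp add: irreducible_in_def)
    then show "A = S \<or> B = S" using A(2) B(2) by blast
  qed
qed

lemma irreducible_in_subset_Union:
  assumes irr: "irreducible_in X S" and fin: "finite \<F>"
    and cl: "\<And>C. C \<in> \<F> \<Longrightarrow> closedin X C" and sub: "S \<subseteq> \<Union>\<F>"
  shows "\<exists>C\<in>\<F>. S \<subseteq> C"
  using fin cl sub
proof (induction \<F> rule: finite_induct)
  case empty
  then show ?case using irr by (auto simp: irreducible_in_def)
next
  case (insert C \<F>)
  have "closedin X C" "S \<subseteq> C \<union> \<Union>\<F>" using insert.prems by auto
  moreover have "closedin X (\<Union>\<F>)"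
    by (rule closedin_Union) (use insert in auto)
  ultimately have "S \<subseteq> C \<or> S \<subseteq> \<Union>\<F>"
    using irr unfolding irreducible_in_def by blast
  then show ?case
  proof
    assume "S \<subseteq> \<Union>\<F>"
    then have "\<exists>C\<in>\<F>. S \<subseteq> C" by (rule insert.IH[rotated]) (use insert.prems in simp)
    then show ?case by auto
  qed auto
qed

lemma irreducible_in_closure:
  assumes "irreducible_in X S"
  shows "irreducible_in X (X closure_of S)"
  unfolding irreducible_in_def
proof (intro conjI allI impI)
  have "S \<noteq> {}" and sub: "S \<subseteq> X closure_of S"
    using assms by (auto simp: irreducible_in_def closure_of_subset)
  then show "X closure_of S \<noteq> {}" by auto
  show "X closure_of S \<subseteq> topspace X" by (rule closure_of_subset_topspace)
  fix A B assume AB: "closedin X A" "closedin X B" "X closure_of S \<subseteq> A \<union> B"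
  then have "S \<subseteq> A \<or> S \<subseteq> B" using assms sub unfolding irreducible_in_def by blast
  then show "X closure_of S \<subseteq> A \<or> X closure_of S \<subseteq> B"
    using AB closure_of_minimal by metis
qed

text \<open>An irreducible subset of a finite union of closed sets lies in one of them; hence a finite
  irredundant cover by irreducible closed sets consists of the maximal irreducible subsets.\<close>

lemma irreducible_components_eq:
  assumes fin: "finite \<F>" and cover: "N = \<Union>\<F>" and top: "N \<subseteq> topspace X"
    and cl: "\<And>C. C \<in> \<F> \<Longrightarrow> closedin X C"
    and irr: "\<And>C. C \<in> \<F> \<Longrightarrow> irreducible_in X C"
    and irredundant: "\<And>C D. C \<in> \<F> \<Longrightarrow> D \<in> \<F> \<Longrightarrow> C \<subseteq> D \<Longrightarrow> C = D"
  shows "irreducible_components (subtopology X N) = \<F>"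
proof -
  have irr_iff: "irreducible_space (subtopology (subtopology X N) C) \<longleftrightarrow> irreducible_in X C"
    if "C \<subseteq> N" for C
    using that top irreducible_space_subtopology_iff[of C X]
    by (simp add: subtopology_subtopology Int_absorb1 subset_trans)
  have topN: "topspace (subtopology X N) = N" using top by auto
  have comp_iff: "C \<in> irreducible_components (subtopology X N) \<longleftrightarrow>
      C \<subseteq> N \<and> irreducible_in X C \<and>
      (\<forall>D. C \<subseteq> D \<and> D \<subseteq> N \<and> irreducible_in X D \<longrightarrow> D = C)" for C
    unfolding irreducible_components_def topN mem_Collect_eq using irr_iff by metis
  have inN: "C \<subseteq> N" if "C \<in> \<F>" for C
    using that cover by blast
  have in_member: "\<exists>D\<in>\<F>. C \<subseteq> D" if "irreducible_in X C" "C \<subseteq> N" for C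
    by (rule irreducible_in_subset_Union[OF that(1) fin cl]) (use that(2) cover in simp_all)
  show ?thesis
  proof (intro equalityI subsetI)
    fix C assume "C \<in> irreducible_components (subtopology X N)"
    then have C: "C \<subseteq> N" "irreducible_in X C"
      and max: "\<And>D. C \<subseteq> D \<Longrightarrow> D \<subseteq> N \<Longrightarrow> irreducible_in X D \<Longrightarrow> D = C"
      unfolding comp_iff by metis+
    obtain D where D: "D \<in> \<F>" "C \<subseteq> D"
      using in_member[OF C(2,1)] by metis
    have "D = C" by (rule max[OF D(2) inN[OF D(1)] irr[OF D(1)]])
    then show "C \<in> \<F>" using D(1) by simp
  next
    fix C assume C: "C \<in> \<F>"
    have "D = C" if D: "C \<subseteq> D" "D \<subseteq> N" "irreducible_in X D" for D
    proof -
      obtain E where E: "E \<in> \<F>" "D \<subseteq> E"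
        using in_member[OF D(3,2)] by metis
      have "C = E" by (rule irredundant[OF C E(1) subset_trans[OF D(1) E(2)]])
      then show ?thesis using D(1) E(2) by simp
    qed
    then show "C \<in> irreducible_components (subtopology X N)"
      unfolding comp_iff using inN[OF C] irr[OF C] by metis
  qed
qed

section \<open>Structure constants, bases and isomorphisms\<close>

definition even_vec :: "'m::finite \<Rightarrow> complex ^ ('m + 'n::finite)" where
  "even_vec i = axis (Inl i) 1"

definition odd_vec :: "'n::finite \<Rightarrow> complex ^ ('m::finite + 'n)" where
  "odd_vec j = axis (Inr j) 1"

lemma even_vec_nth [simp]: "even_vec i $ Inl k = (if k = i then 1 else 0)" "even_vec i $ Inr l = 0"
  by (auto simp: even_vec_def axis_def)

lemma odd_vec_nth [simp]: "odd_vec j $ Inr l = (if l = j then 1 else 0)" "odd_vec j $ Inl k = 0"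
  by (auto simp: odd_vec_def axis_def)

lemma even_vec_even [simp]: "even_vec i \<in> even_part"
  and odd_vec_odd [simp]: "odd_vec j \<in> odd_part"
  by (auto simp: even_part_def odd_part_def)

lemma super_vec_eq_iff:
  fixes x :: "complex ^ ('m::finite + 'n::finite)"
  shows "x = y \<longleftrightarrow> (\<forall>i. x $ Inl i = y $ Inl i) \<and> (\<forall>j. x $ Inr j = y $ Inr j)"
  unfolding vec_eq_iff by (metis sum.exhaust)

definition even_proj :: "complex ^ ('m::finite + 'n::finite) \<Rightarrow> complex ^ ('m + 'n)" where
  "even_proj x = (\<Sum>i\<in>UNIV. x $ Inl i *s even_vec i)"

definition odd_proj :: "complex ^ ('m::finite + 'n::finite) \<Rightarrow> complex ^ ('m + 'n)" where
  "odd_proj x = (\<Sum>j\<in>UNIV. x $ Inr j *s odd_vec j)"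

lemma even_proj_nth [simp]: "even_proj x $ Inl k = x $ Inl k" "even_proj x $ Inr l = 0"
  by (simp_all add: even_proj_def if_distrib cong: if_cong)

lemma odd_proj_nth [simp]: "odd_proj x $ Inr l = x $ Inr l" "odd_proj x $ Inl k = 0"
  by (simp_all add: odd_proj_def if_distrib cong: if_cong)

lemma proj_add: "even_proj x + odd_proj x = x"
  by (simp add: super_vec_eq_iff)

lemma proj_part [simp]: "even_proj x \<in> even_part" "odd_proj x \<in> odd_part"
  by (auto simp: even_part_def odd_part_def)

lemma vec_expansion: "x = (\<Sum>i\<in>UNIV. x $ Inl i *s even_vec i) + (\<Sum>j\<in>UNIV. x $ Inr j *s odd_vec j)"
  using proj_add[of x] by (simp add: even_proj_def odd_proj_def)

abbreviation vlinear :: "(complex ^ 'a \<Rightarrow> complex ^ 'b) \<Rightarrow> bool" where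
  "vlinear \<equiv> Vector_Spaces.linear (*s) (*s)"

lemma vlinearI:
  assumes "\<And>x y. f (x + y) = f x + f y" "\<And>c x. f (c *s x) = c *s f x"
  shows "vlinear f"
  using assms by (simp add: Vector_Spaces.linear_iff vec.vector_space_axioms)

lemma vlinear_add: "vlinear f \<Longrightarrow> f (x + y) = f x + f y"
  and vlinear_scale: "vlinear f \<Longrightarrow> f (c *s x) = c *s f x"
  by (simp_all add: Vector_Spaces.linear_iff)

lemma vlinear_0: "vlinear f \<Longrightarrow> f 0 = 0"
  using vlinear_scale[of f 0 0] by simp

lemma vlinear_sum: "vlinear f \<Longrightarrow> f (\<Sum>i\<in>I. g i) = (\<Sum>i\<in>I. f (g i))"
  by (induction I rule: infinite_finite_induct) (simp_all add: vlinear_0 vlinear_add)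

lemma vlinear_compose: "vlinear f \<Longrightarrow> vlinear g \<Longrightarrow> vlinear (\<lambda>x. f (g x))"
  by (intro vlinearI) (simp_all add: vlinear_add vlinear_scale)

lemma vlinear_expand:
  assumes "vlinear f"
  shows "f x = (\<Sum>i\<in>UNIV. x $ Inl i *s f (even_vec i)) + (\<Sum>j\<in>UNIV. x $ Inr j *s f (odd_vec j))"
  by (subst vec_expansion[of x]) (simp add: assms vlinear_add vlinear_scale vlinear_sum)

lemma vlinear_eqI:
  assumes "vlinear f" "vlinear g"
    and "\<And>i. f (even_vec i) = g (even_vec i)" "\<And>j. f (odd_vec j) = g (odd_vec j)"
  shows "f = g"
  by (rule ext, subst vlinear_expand[OF assms(1)], subst vlinear_expand[OF assms(2)])
    (simp add: assms(3,4))

lemma sc_mult_nth: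
  "sc_mult s x y $ Inl k = (\<Sum>i\<in>UNIV. \<Sum>j\<in>UNIV. sc_c s i j k * x $ Inl i * y $ Inl j)
      + (\<Sum>i\<in>UNIV. \<Sum>j\<in>UNIV. sc_Gamma s i j k * x $ Inr i * y $ Inr j)"
  "sc_mult s x y $ Inr l = (\<Sum>i\<in>UNIV. \<Sum>j\<in>UNIV. sc_rho s i j l * x $ Inl i * y $ Inr j)
      + (\<Sum>i\<in>UNIV. \<Sum>j\<in>UNIV. sc_rho s i j l * x $ Inr j * y $ Inl i)"
  by (simp_all add: sc_mult_def)

lemma sc_mult_linear: "vlinear (sc_mult s x)" "vlinear (\<lambda>x. sc_mult s x y)"
  by (intro vlinearI;
      simp add: super_vec_eq_iff sc_mult_nth algebra_simps sum.distrib sum_distrib_left)+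

lemmas sc_mult_add = vlinear_add[OF sc_mult_linear(1)] vlinear_add[OF sc_mult_linear(2)]
lemmas sc_mult_scale = vlinear_scale[OF sc_mult_linear(1)] vlinear_scale[OF sc_mult_linear(2)]
lemmas sc_mult_zero [simp] = vlinear_0[OF sc_mult_linear(1)] vlinear_0[OF sc_mult_linear(2)]

lemma sc_mult_even_even: "x \<in> even_part \<Longrightarrow> y \<in> even_part \<Longrightarrow> sc_mult s x y \<in> even_part"
  and sc_mult_even_odd: "x \<in> even_part \<Longrightarrow> y \<in> odd_part \<Longrightarrow> sc_mult s x y \<in> odd_part"
  and sc_mult_odd_even: "x \<in> odd_part \<Longrightarrow> y \<in> even_part \<Longrightarrow> sc_mult s x y \<in> odd_part"
  and sc_mult_odd_odd: "x \<in> odd_part \<Longrightarrow> y \<in> odd_part \<Longrightarrow> sc_mult s x y \<in> even_part"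
  by (auto simp: even_part_def odd_part_def sc_mult_nth)

lemma superalgebra_sc_mult: "superalgebra (sc_mult s)"
  unfolding superalgebra_def
  by (auto intro: sc_mult_linear sc_mult_even_even sc_mult_even_odd sc_mult_odd_even sc_mult_odd_odd)

lemma sum_delta_scaled:
  fixes f :: "'a::finite \<Rightarrow> complex"
  shows "(\<Sum>j\<in>UNIV. f j * (if j = i then 1 else 0)) = f i"
    "(\<Sum>j\<in>UNIV. f j * (if i = j then 1 else 0)) = f i"
  by (simp_all add: if_distrib cong: if_cong)

lemma sc_mult_basis:
  "sc_mult s (even_vec i) (even_vec j) $ Inl k = sc_c s i j k"
  "sc_mult s (even_vec i) (odd_vec l) $ Inr l' = sc_rho s i l l'"
  "sc_mult s (odd_vec l) (odd_vec l') $ Inl k = sc_Gamma s l l' k"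
  by (simp_all add: sc_mult_nth sum_delta_scaled)

lemma sc_mult_odd_even_comm:
  assumes "x \<in> even_part" "y \<in> odd_part"
  shows "sc_mult s y x = sc_mult s x y"
  using assms by (simp add: super_vec_eq_iff sc_mult_nth even_part_def odd_part_def mult.assoc
      mult.commute[of "x $ _"])

lemma mk_sconsts_nth [simp]:
  "sc_c (mk_sconsts c r g) = c" "sc_rho (mk_sconsts c r g) = r" "sc_Gamma (mk_sconsts c r g) = g"
  by (simp_all add: fun_eq_iff mk_sconsts_def sc_c_def sc_rho_def sc_Gamma_def)

lemma sconsts_eq_iff:
  "s = t \<longleftrightarrow> sc_c s = sc_c t \<and> sc_rho s = sc_rho t \<and> sc_Gamma s = sc_Gamma t"
proof
  assume *: "sc_c s = sc_c t \<and> sc_rho s = sc_rho t \<and> sc_Gamma s = sc_Gamma t"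
  show "s = t"
    unfolding vec_eq_iff
  proof
    fix i show "s $ i = t $ i"
    proof (cases i)
      case (Inl p)
      then show ?thesis using * by (cases p) (auto simp: sc_c_def fun_eq_iff)
    next
      case (Inr q)
      then show ?thesis
        using * by (cases q) (auto simp: sc_rho_def sc_Gamma_def fun_eq_iff)
    qed
  qed
qed simp

lemma sc_mult_inject: "sc_mult s = sc_mult t \<longleftrightarrow> s = t"
proof
  assume *: "sc_mult s = sc_mult t"
  show "s = t"
    unfolding sconsts_eq_iff by (simp add: fun_eq_iff sc_mult_basis[symmetric] *)
qed simp

lemma bilinear_eqI:
  assumes "\<And>x. vlinear (M x)" "\<And>y. vlinear (\<lambda>x. M x y)" "\<And>x. vlinear (N x)" "\<And>y. vlinear (\<lambda>x. N x y)"
    and "\<And>i j. M (even_vec i) (even_vec j) = N (even_vec i) (even_vec j)"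
    and "\<And>i j. M (even_vec i) (odd_vec j) = N (even_vec i) (odd_vec j)"
    and "\<And>i j. M (odd_vec i) (even_vec j) = N (odd_vec i) (even_vec j)"
    and "\<And>i j. M (odd_vec i) (odd_vec j) = N (odd_vec i) (odd_vec j)"
  shows "M = N"
proof (rule ext)
  fix x
  have "(\<lambda>x. M x (even_vec j)) = (\<lambda>x. N x (even_vec j))" for j
    by (rule vlinear_eqI) (simp_all add: assms)
  moreover have "(\<lambda>x. M x (odd_vec j)) = (\<lambda>x. N x (odd_vec j))" for j
    by (rule vlinear_eqI) (simp_all add: assms)
  ultimately show "M x = N x"
    by (intro vlinear_eqI) (simp_all add: assms fun_eq_iff)
qed

definition block :: "complex ^ 'm ^ 'm \<Rightarrow> complex ^ 'n ^ 'n \<Rightarrow>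
    complex ^ ('m::finite + 'n::finite) \<Rightarrow> complex ^ ('m + 'n)" where
  "block P Q x = (\<chi> t. case t of
      Inl k \<Rightarrow> \<Sum>i\<in>UNIV. P $ k $ i * x $ Inl i
    | Inr k \<Rightarrow> \<Sum>j\<in>UNIV. Q $ k $ j * x $ Inr j)"

lemma block_nth [simp]:
  "block P Q x $ Inl k = (\<Sum>i\<in>UNIV. P $ k $ i * x $ Inl i)"
  "block P Q x $ Inr l = (\<Sum>j\<in>UNIV. Q $ l $ j * x $ Inr j)"
  by (simp_all add: block_def)

lemma block_linear: "vlinear (block P Q)"
  by (intro vlinearI; simp add: super_vec_eq_iff algebra_simps sum.distrib sum_distrib_left)

lemma block_even: "x \<in> even_part \<Longrightarrow> block P Q x \<in> even_part"
  and block_odd: "x \<in> odd_part \<Longrightarrow> block P Q x \<in> odd_part"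
  by (auto simp: even_part_def odd_part_def)

lemma block_block: "block P Q (block P' Q' x) = block (P ** P') (Q ** Q') x"
proof -
  have *: "(\<Sum>i\<in>UNIV. A $ k $ i * (\<Sum>j\<in>UNIV. B $ i $ j * v j)) = (\<Sum>j\<in>UNIV. (A ** B) $ k $ j * v j)"
    for A B :: "complex ^ 'c::finite ^ 'c" and v k
    unfolding matrix_matrix_mult_def
    by (simp add: sum_distrib_left sum_distrib_right mult.assoc) (rule sum.swap)
  show ?thesis by (simp add: super_vec_eq_iff *)
qed

lemma block_id: "block (mat 1) (mat 1) x = x"
  by (simp add: super_vec_eq_iff mat_def if_distrib[of "\<lambda>a. a * _"] cong: if_cong)

lemma matrix_inv_inverse:
  fixes A :: "complex ^ 'n::finite ^ 'n"
  assumes "invertible A"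
  shows "A ** matrix_inv A = mat 1" "matrix_inv A ** A = mat 1"
  using assms unfolding invertible_def matrix_inv_def by (metis (mono_tags, lifting) someI_ex)+

lemma block_inverse:
  assumes "invertible P" "invertible Q"
  shows "block P Q (block (matrix_inv P) (matrix_inv Q) x) = x"
    "block (matrix_inv P) (matrix_inv Q) (block P Q x) = x"
  using assms by (simp_all add: block_block block_id matrix_inv_inverse)

text \<open>Hence grading-preserving linear bijections are the same as pairs of invertible matrices.\<close>

lemma graded_linear_eq_block:
  assumes "vlinear T" "T ` even_part \<subseteq> even_part" "T ` odd_part \<subseteq> odd_part"
  shows "T = block (\<chi> k i. T (even_vec i) $ Inl k) (\<chi> l j. T (odd_vec j) $ Inr l)"
proof (rule vlinear_eqI[OF assms(1) block_linear])
  fix i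
  have "T (even_vec i) \<in> even_part" using assms(2) by auto
  then show "T (even_vec i) = block (\<chi> k i. T (even_vec i) $ Inl k) (\<chi> l j. T (odd_vec j) $ Inr l) (even_vec i)"
    by (simp add: super_vec_eq_iff sum_delta_scaled even_part_def)
next
  fix j
  have "T (odd_vec j) \<in> odd_part" using assms(3) by auto
  then show "T (odd_vec j) = block (\<chi> k i. T (even_vec i) $ Inl k) (\<chi> l j. T (odd_vec j) $ Inr l) (odd_vec j)"
    by (simp add: super_vec_eq_iff sum_delta_scaled odd_part_def)
qed

text \<open>This translates between the coordinate formula for the action and isomorphisms. Both sides are
  bilinear, and on basis vectors the right-hand side expands to the defining sums.\<close>

lemma sc_mult_sc_act:
  "sc_mult (sc_act P Q s) x y =
     block P Q (sc_mult s (block (matrix_inv P) (matrix_inv Q) x) (block (matrix_inv P) (matrix_inv Q) y))"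
proof -
  let ?B = "block (matrix_inv P) (matrix_inv Q)"
  have "sc_mult (sc_act P Q s) = (\<lambda>x y. block P Q (sc_mult s (?B x) (?B y)))"
  proof (rule bilinear_eqI)
    fix x y :: "complex ^ ('a + 'b)"
    show "vlinear (\<lambda>y. block P Q (sc_mult s (?B x) (?B y)))"
      by (intro vlinear_compose[OF block_linear] vlinear_compose[OF sc_mult_linear(1)] block_linear)
    show "vlinear (\<lambda>x. block P Q (sc_mult s (?B x) (?B y)))"
      by (intro vlinear_compose[OF block_linear] vlinear_compose[OF sc_mult_linear(2)] block_linear)
  next
    have rearrange: "(\<Sum>l\<in>UNIV. p l * (\<Sum>a\<in>UNIV. \<Sum>b\<in>UNIV. c a b l * u a * v b))
        = (\<Sum>a\<in>UNIV. \<Sum>b\<in>UNIV. \<Sum>l\<in>UNIV. u a * v b * c a b l * p l)"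
      for p :: "'p::finite \<Rightarrow> complex" and u :: "'q::finite \<Rightarrow> complex" and v :: "'r::finite \<Rightarrow> complex" and c
    proof -
      have "(\<Sum>l\<in>UNIV. p l * (\<Sum>a\<in>UNIV. \<Sum>b\<in>UNIV. c a b l * u a * v b))
          = (\<Sum>l\<in>UNIV. \<Sum>a\<in>UNIV. \<Sum>b\<in>UNIV. u a * v b * c a b l * p l)"
        by (simp add: sum_distrib_left mult_ac)
      also have "\<dots> = (\<Sum>a\<in>UNIV. \<Sum>l\<in>UNIV. \<Sum>b\<in>UNIV. u a * v b * c a b l * p l)"
        by (rule sum.swap)
      also have "\<dots> = (\<Sum>a\<in>UNIV. \<Sum>b\<in>UNIV. \<Sum>l\<in>UNIV. u a * v b * c a b l * p l)"
        by (intro sum.cong refl sum.swap)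
      finally show ?thesis .
    qed
    have rearrange': "(\<Sum>l\<in>UNIV. p l * (\<Sum>a\<in>UNIV. \<Sum>b\<in>UNIV. c a b l * u b * v a))
        = (\<Sum>a\<in>UNIV. \<Sum>b\<in>UNIV. \<Sum>l\<in>UNIV. v a * u b * c a b l * p l)"
      for p :: "'p::finite \<Rightarrow> complex" and u :: "'q::finite \<Rightarrow> complex" and v :: "'r::finite \<Rightarrow> complex" and c
      using rearrange[of p "\<lambda>a b l. c a b l" v u] by (simp add: mult_ac)
    note simps = super_vec_eq_iff sc_mult_nth sum_delta_scaled sc_act_def rearrange rearrange'
    fix i j :: 'a and k l :: 'b
    show "sc_mult (sc_act P Q s) (even_vec i) (even_vec j) =
        block P Q (sc_mult s (?B (even_vec i)) (?B (even_vec j)))"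
      by (simp add: simps)
    show eo: "sc_mult (sc_act P Q s) (even_vec i) (odd_vec l) =
        block P Q (sc_mult s (?B (even_vec i)) (?B (odd_vec l)))"
      by (simp add: simps)
    show "sc_mult (sc_act P Q s) (odd_vec l) (even_vec i) =
        block P Q (sc_mult s (?B (odd_vec l)) (?B (even_vec i)))"
      using eo by (simp add: sc_mult_odd_even_comm block_even block_odd)
    show "sc_mult (sc_act P Q s) (odd_vec k) (odd_vec l) =
        block P Q (sc_mult s (?B (odd_vec k)) (?B (odd_vec l)))"
      by (simp add: simps)
  qed (rule sc_mult_linear)+
  then show ?thesis by simp
qed

lemma isomorphicI:
  assumes "vlinear T" "bij T" "\<And>x. x \<in> even_part \<Longrightarrow> T x \<in> even_part"
    "\<And>x. x \<in> odd_part \<Longrightarrow> T x \<in> odd_part" "\<And>x y. T (sc_mult s x y) = sc_mult t (T x) (T y)"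
  shows "isomorphic s t"
proof -
  have "T ` even_part \<subseteq> even_part" "T ` odd_part \<subseteq> odd_part"
    using assms(3,4) by (auto simp only: image_subset_iff)
  then show ?thesis
    unfolding isomorphic_def using assms(1,2,5) by (intro exI[of _ T] conjI allI)
qed

lemma isomorphicE:
  assumes "isomorphic s t"
  obtains T where "vlinear T" "bij T" "\<forall>x\<in>even_part. T x \<in> even_part"
    "\<forall>x\<in>odd_part. T x \<in> odd_part" "\<forall>x y. T (sc_mult s x y) = sc_mult t (T x) (T y)"
  using assms unfolding isomorphic_def image_subset_iff by (elim exE conjE)

lemma isomorphic_refl: "isomorphic s s"
  by (rule isomorphicI[of "\<lambda>x. x"]) (simp_all add: vlinearI bij_def inj_def surj_def)

lemma isomorphic_trans:
  assumes "isomorphic s t" "isomorphic t u"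
  shows "isomorphic s u"
proof -
  obtain T where T: "vlinear T" "bij T" "\<forall>x\<in>even_part. T x \<in> even_part"
    "\<forall>x\<in>odd_part. T x \<in> odd_part" "\<forall>x y. T (sc_mult s x y) = sc_mult t (T x) (T y)"
    by (rule isomorphicE[OF assms(1)])
  obtain S where S: "vlinear S" "bij S" "\<forall>x\<in>even_part. S x \<in> even_part"
    "\<forall>x\<in>odd_part. S x \<in> odd_part" "\<forall>x y. S (sc_mult t x y) = sc_mult u (S x) (S y)"
    by (rule isomorphicE[OF assms(2)])
  have "vlinear (\<lambda>x. S (T x))" by (rule vlinear_compose[OF S(1) T(1)])
  moreover have "bij (\<lambda>x. S (T x))"
    using bij_comp[OF T(2) S(2)] by (simp add: comp_def)
  ultimately show ?thesis
    by (rule isomorphicI) (simp_all add: T(3-5) S(3-5))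
qed

text \<open>Isomorphisms are easier to construct and compose than pairs of matrices, so orbits are treated as
  isomorphism classes below.\<close>

lemma orbit_iff_isomorphic:
  fixes s t :: "('m::finite, 'n::finite) sconsts"
  shows "t \<in> orbit s \<longleftrightarrow> isomorphic s t"
proof
  assume "t \<in> orbit s"
  then obtain P Q where inv: "invertible P" "invertible Q" and t: "t = sc_act P Q s"
    unfolding orbit_def by blast
  have "bij (block P Q)"
    by (rule bij_betw_byWitness[where f' = "block (matrix_inv P) (matrix_inv Q)"])
      (simp_all add: block_inverse inv)
  then show "isomorphic s t"
    by (intro isomorphicI[of "block P Q"])
      (simp_all add: block_linear block_even block_odd t sc_mult_sc_act block_inverse inv)
next
  assume "isomorphic s t"
  then obtain T where T: "vlinear T" "bij T" "\<forall>x\<in>even_part. T x \<in> even_part"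
    "\<forall>x\<in>odd_part. T x \<in> odd_part" "\<forall>x y. T (sc_mult s x y) = sc_mult t (T x) (T y)"
    by (rule isomorphicE)
  define P where "P = (\<chi> k i. T (even_vec i) $ Inl k)"
  define Q where "Q = (\<chi> l j. T (odd_vec j) $ Inr l)"
  have TB: "T = block P Q"
    unfolding P_def Q_def by (rule graded_linear_eq_block) (use T in auto)
  have "inj T" using T(2) by (rule bij_is_inj)
  have "inj ((*v) P)"
  proof (rule injI)
    fix x y assume eq: "P *v x = P *v y"
    let ?e = "\<lambda>x. (\<chi> t. case t of Inl k \<Rightarrow> x $ k | Inr l \<Rightarrow> 0) :: complex ^ ('m + 'n)"
    have "T (?e x) = T (?e y)"
      using eq by (simp add: TB super_vec_eq_iff matrix_vector_mult_def vec_eq_iff)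
    then have "?e x = ?e y" by (rule injD[OF \<open>inj T\<close>])
    then show "x = y" by (simp add: super_vec_eq_iff vec_eq_iff)
  qed
  then have P: "invertible P"
    using invertible_left_inverse matrix_left_invertible_injective by blast
  have "inj ((*v) Q)"
  proof (rule injI)
    fix x y assume eq: "Q *v x = Q *v y"
    let ?e = "\<lambda>x. (\<chi> t. case t of Inl k \<Rightarrow> 0 | Inr l \<Rightarrow> x $ l) :: complex ^ ('m + 'n)"
    have "T (?e x) = T (?e y)"
      using eq by (simp add: TB super_vec_eq_iff matrix_vector_mult_def vec_eq_iff)
    then have "?e x = ?e y" by (rule injD[OF \<open>inj T\<close>])
    then show "x = y" by (simp add: super_vec_eq_iff vec_eq_iff)
  qed
  then have Q: "invertible Q"
    using invertible_left_inverse matrix_left_invertible_injective by blast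
  have "sc_mult t = sc_mult (sc_act P Q s)"
    using T(5) by (simp add: fun_eq_iff sc_mult_sc_act TB block_inverse P Q)
  then have "t = sc_act P Q s" by (simp add: sc_mult_inject)
  then show "t \<in> orbit s" unfolding orbit_def using P Q by blast
qed

lemma isomorphic_sym:
  assumes "isomorphic s t"
  shows "isomorphic t s"
proof -
  obtain P Q where inv: "invertible P" "invertible Q" and t: "t = sc_act P Q s"
    using assms unfolding orbit_iff_isomorphic[symmetric] orbit_def by blast
  let ?B = "block (matrix_inv P) (matrix_inv Q)"
  have "bij ?B"
    by (rule bij_betw_byWitness[where f' = "block P Q"]) (simp_all add: block_inverse inv)
  then show ?thesis
    by (intro isomorphicI[of ?B])
      (simp_all add: block_linear block_even block_odd t sc_mult_sc_act block_inverse inv)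
qed

lemma orbit_refl: "s \<in> orbit s"
  by (simp add: orbit_iff_isomorphic isomorphic_refl)

lemma orbit_eq: "isomorphic s t \<Longrightarrow> orbit s = orbit t"
  unfolding set_eq_iff orbit_iff_isomorphic by (metis isomorphic_trans isomorphic_sym)

text \<open>Isomorphisms are constructed by exhibiting a basis: the linear map that sends the standard basis
  to \<open>u\<close>, \<open>v\<close> is injective by the independence hypothesis, and it is multiplicative because both
  products are bilinear.\<close>

lemma isomorphic_of_basis:
  fixes t :: "('m::finite, 'n::finite) sconsts"
  assumes even: "\<And>i. u i \<in> even_part" and odd: "\<And>j. v j \<in> odd_part"
    and ind: "\<And>x y. (\<Sum>i\<in>UNIV. x i *s u i) + (\<Sum>j\<in>UNIV. y j *s v j) = 0 \<Longrightarrow> x = (\<lambda>_. 0) \<and> y = (\<lambda>_. 0)"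
    and ee: "\<And>i j. sc_mult s (u i) (u j) = (\<Sum>k\<in>UNIV. sc_c t i j k *s u k)"
    and eo: "\<And>i j. sc_mult s (u i) (v j) = (\<Sum>k\<in>UNIV. sc_rho t i j k *s v k)"
    and oo: "\<And>i j. sc_mult s (v i) (v j) = (\<Sum>k\<in>UNIV. sc_Gamma t i j k *s u k)"
  shows "isomorphic t s"
proof -
  define T where "T x = (\<Sum>i\<in>UNIV. x $ Inl i *s u i) + (\<Sum>j\<in>UNIV. x $ Inr j *s v j)" for x
  have lin: "vlinear T"
    by (intro vlinearI)
      (simp_all add: T_def vec.scale_left_distrib vec.scale_right_distrib sum.distrib
        vec.scale_sum_right)
  have Te: "T (even_vec i) = u i" and To: "T (odd_vec j) = v j" for i j
    by (simp_all add: T_def if_distrib[of "\<lambda>a. a *s _"] cong: if_cong)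
  have "inj T"
    unfolding vec.linear_inj_iff_eq_0[OF lin]
  proof (intro allI impI)
    fix x assume "T x = 0"
    then have "(\<lambda>i. x $ Inl i) = (\<lambda>_. 0)" "(\<lambda>j. x $ Inr j) = (\<lambda>_. 0)"
      using ind[of "\<lambda>i. x $ Inl i" "\<lambda>j. x $ Inr j"] by (simp_all add: T_def)
    then show "x = 0" by (simp add: super_vec_eq_iff fun_eq_iff)
  qed
  then have bij: "bij T"
    by (simp add: bij_def vec.linear_inj_imp_surj[OF lin])
  have "(\<lambda>x y. T (sc_mult t x y)) = (\<lambda>x y. sc_mult s (T x) (T y))"
  proof (rule bilinear_eqI)
    fix i j k l
    have E: "sc_mult t (even_vec i) (even_vec j) = (\<Sum>k\<in>UNIV. sc_c t i j k *s even_vec k)"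
      by (simp add: super_vec_eq_iff sc_mult_nth sum_delta_scaled)
    have EO: "sc_mult t (even_vec i) (odd_vec l) = (\<Sum>k\<in>UNIV. sc_rho t i l k *s odd_vec k)"
      by (simp add: super_vec_eq_iff sc_mult_nth sum_delta_scaled)
    have O: "sc_mult t (odd_vec k) (odd_vec l) = (\<Sum>m\<in>UNIV. sc_Gamma t k l m *s even_vec m)"
      by (simp add: super_vec_eq_iff sc_mult_nth sum_delta_scaled)
    note simps = vlinear_sum[OF lin] vlinear_scale[OF lin] Te To
    show "T (sc_mult t (even_vec i) (even_vec j)) = sc_mult s (T (even_vec i)) (T (even_vec j))"
      by (simp add: E simps ee)
    show eo': "T (sc_mult t (even_vec i) (odd_vec l)) = sc_mult s (T (even_vec i)) (T (odd_vec l))"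
      by (simp add: EO simps eo)
    show "T (sc_mult t (odd_vec l) (even_vec i)) = sc_mult s (T (odd_vec l)) (T (even_vec i))"
      using eo' by (simp add: sc_mult_odd_even_comm even odd Te To)
    show "T (sc_mult t (odd_vec k) (odd_vec l)) = sc_mult s (T (odd_vec k)) (T (odd_vec l))"
      by (simp add: O simps oo)
  qed (intro vlinear_compose[OF lin] vlinear_compose[OF sc_mult_linear(1)]
      vlinear_compose[OF sc_mult_linear(2)] sc_mult_linear lin)+
  then have hom: "T (sc_mult t x y) = sc_mult s (T x) (T y)" for x y
    by (simp add: fun_eq_iff)
  show ?thesis
  proof (rule isomorphicI[OF lin bij _ _ hom])
    show "T x \<in> even_part" if "x \<in> even_part" for x
      using that even by (simp add: T_def even_part_def)
    show "T x \<in> odd_part" if "x \<in> odd_part" for x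
      using that odd by (simp add: T_def odd_part_def)
  qed
qed

section \<open>Nilpotency\<close>

lemma alg_power_small: "k \<le> 1 \<Longrightarrow> alg_power mul k = UNIV"
  by (simp add: alg_power.simps)

lemma alg_power_subspace: "vec.subspace (alg_power mul k)"
  by (cases "k \<le> 1") (subst alg_power.simps, simp add: vec.subspace_UNIV vec.subspace_span)+

lemma alg_power_mult:
  assumes "1 \<le> i" "1 \<le> j" "x \<in> alg_power mul i" "y \<in> alg_power mul j"
  shows "mul x y \<in> alg_power mul (i + j)"
proof -
  have "mul x y \<in> (\<Union>l\<in>{1..<i + j}. {mul x y | x y. x \<in> alg_power mul l \<and> y \<in> alg_power mul (i + j - l)})"
    using assms by (intro UN_I[of i]) auto
  moreover have "\<not> i + j \<le> 1" using assms by simp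
  ultimately show ?thesis
    by (subst alg_power.simps) (simp only: if_False vec.span_base)
qed

lemma alg_power_subset:
  assumes "2 \<le> k" "vec.subspace W"
    and "\<And>i x y. 1 \<le> i \<Longrightarrow> i < k \<Longrightarrow> x \<in> alg_power mul i \<Longrightarrow> y \<in> alg_power mul (k - i) \<Longrightarrow> mul x y \<in> W"
  shows "alg_power mul k \<subseteq> W"
proof -
  have "\<not> k \<le> 1" using assms(1) by simp
  moreover have "vec.span (\<Union>i\<in>{1..<k}. {mul x y | x y. x \<in> alg_power mul i \<and> y \<in> alg_power mul (k - i)}) \<subseteq> W"
    by (rule vec.span_minimal[OF _ assms(2)]) (use assms(3) in auto)
  ultimately show ?thesis by (subst alg_power.simps) simp
qed

text \<open>The powers form the smallest multiplicative filtration that starts with the whole algebra.\<close>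

lemma alg_power_subset_filtration:
  assumes "\<And>k. vec.subspace (W k)" "W 1 = UNIV" "1 \<le> k"
    and mult: "\<And>i j x y. 1 \<le> i \<Longrightarrow> 1 \<le> j \<Longrightarrow> x \<in> W i \<Longrightarrow> y \<in> W j \<Longrightarrow> mul x y \<in> W (i + j)"
  shows "alg_power mul k \<subseteq> W k"
  using assms(3)
proof (induction k rule: less_induct)
  case (less k)
  show ?case
  proof (cases "k = 1")
    case True
    then show ?thesis using assms(2) by simp
  next
    case False
    show ?thesis
    proof (rule alg_power_subset)
      fix i x y assume i: "1 \<le> i" "i < k" and xy: "x \<in> alg_power mul i" "y \<in> alg_power mul (k - i)"
      have "x \<in> W i" "y \<in> W (k - i)"
        using less.IH[of i] less.IH[of "k - i"] i xy by (auto simp: subset_iff)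
      then show "mul x y \<in> W k"
        using mult[of i "k - i" x y] i by simp
    qed (use False less.prems assms(1) in auto)
  qed
qed

text \<open>By induction, a set that reproduces itself under multiplication lies in all powers. This is what
  nilpotency contributes to the classification: it produces the flags of an adapted basis, and the
  equation \<open>\<rho>(\<gamma>) = 0\<close>.\<close>

lemma nilpotent_no_fixed_set:
  assumes nil: "nilpotent_algebra mul"
    and W: "W \<subseteq> vec.span {mul x w | x w. w \<in> W}"
  shows "W \<subseteq> {0}"
proof -
  have "W \<subseteq> alg_power mul k" for k
  proof (induction k)
    case 0
    show ?case by (simp add: alg_power_small)
  next
    case (Suc k)
    show ?case
    proof (cases "k = 0")
      case True
      then show ?thesis by (simp add: alg_power_small)
    next
      case False
      have "mul x w \<in> alg_power mul (Suc k)" if "w \<in> W" for x w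
        using alg_power_mult[of 1 k x mul w] that Suc False by (auto simp: alg_power_small)
      then have "vec.span {mul x w | x w. w \<in> W} \<subseteq> alg_power mul (Suc k)"
        by (intro vec.span_minimal alg_power_subspace) auto
      then show ?thesis using W by blast
    qed
  qed
  then show ?thesis using nil by (auto simp: nilpotent_algebra_def)
qed

section \<open>Invariance under isomorphism\<close>

lemma homogeneous_map:
  assumes "vlinear T" "inj T" "\<forall>x\<in>even_part. T x \<in> even_part" "\<forall>x\<in>odd_part. T x \<in> odd_part"
    and "homogeneous x"
  shows "homogeneous (T x)" "parity (T x) = parity x"
proof -
  have 0: "T x \<noteq> 0"
    using assms(1,2,5) vec.linear_inj_iff_eq_0[OF assms(1)] by (auto simp: homogeneous_def)
  then show "homogeneous (T x)"
    using assms(3-5) by (auto simp: homogeneous_def)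
  have disj: "y = 0" if "y \<in> even_part" "y \<in> odd_part" for y :: "complex ^ ('c::finite + 'd::finite)"
    using that by (auto simp: even_part_def odd_part_def super_vec_eq_iff)
  show "parity (T x) = parity x"
    using assms(3-5) 0 disj[of "T x"] by (auto simp: homogeneous_def parity_def)
qed

lemma jordan_superalgebra_isomorphic:
  fixes s t :: "('m::finite, 'n::finite) sconsts"
  assumes "isomorphic t s" "jordan_superalgebra (sc_mult s)"
  shows "jordan_superalgebra (sc_mult t)"
proof -
  obtain T where T: "vlinear T" "bij T" "\<forall>x\<in>even_part. T x \<in> even_part"
    "\<forall>x\<in>odd_part. T x \<in> odd_part" "\<forall>x y. T (sc_mult t x y) = sc_mult s (T x) (T y)"
    by (rule isomorphicE[OF assms(1)])
  have inj: "inj T" using T(2) by (rule bij_is_inj)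
  note hom = homogeneous_map[OF T(1) inj T(3,4)]
  have diff: "T (x - y) = T x - T y" for x y
    using vec.linear_diff[OF T(1)] .
  note simps = vlinear_add[OF T(1)] vlinear_scale[OF T(1)] diff T(5)[rule_format]
  have inj0: "T x = 0 \<Longrightarrow> x = 0" for x
    using vec.linear_inj_iff_eq_0[OF T(1)] inj by blast
  show ?thesis
    unfolding jordan_superalgebra_def
  proof (intro conjI allI impI superalgebra_sc_mult)
    fix x y :: "complex ^ ('m + 'n)" assume xy: "homogeneous x \<and> homogeneous y"
    have hs: "homogeneous (T x) \<and> homogeneous (T y)"
      using xy hom(1) by simp
    have ps: "parity (T x) = parity x" "parity (T y) = parity y"
      using xy hom(2) by simp_all
    have "T (sc_mult t x y) = T ((- 1) ^ (parity x * parity y) *s sc_mult t y x)"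
      unfolding simps
      by (rule assms(2)[unfolded jordan_superalgebra_def, THEN conjunct2, THEN conjunct1,
          THEN spec[of _ "T x"], THEN spec[of _ "T y"], THEN mp, OF hs, unfolded ps])
    then show "sc_mult t x y = (- 1) ^ (parity x * parity y) *s sc_mult t y x"
      by (rule injD[OF inj])
  next
    fix x y z w :: "complex ^ ('m + 'n)"
    assume *: "homogeneous x \<and> homogeneous y \<and> homogeneous z \<and> homogeneous w"
    have hs: "homogeneous (T x) \<and> homogeneous (T y) \<and> homogeneous (T z) \<and> homogeneous (T w)"
      using * hom(1) by simp
    have ps: "parity (T x) = parity x" "parity (T y) = parity y" "parity (T z) = parity z"
      "parity (T w) = parity w"
      using * hom(2) by simp_all
    show "sc_mult t (sc_mult t w x) (sc_mult t y z)
        + (- 1) ^ (parity x * parity y) *s sc_mult t (sc_mult t w y) (sc_mult t x z)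
        + (- 1) ^ ((parity x + parity y) * parity z) *s sc_mult t (sc_mult t w z) (sc_mult t x y)
        - (- 1) ^ (parity w * parity x) *s sc_mult t x (sc_mult t w (sc_mult t y z))
        - (- 1) ^ (parity y * (parity w + parity x)) *s sc_mult t y (sc_mult t w (sc_mult t x z))
        - (- 1) ^ (parity z * (parity w + parity x + parity y)) *s sc_mult t z (sc_mult t w (sc_mult t x y))
        = 0"
      by (rule inj0, unfold simps)
        (rule assms(2)[unfolded jordan_superalgebra_def, THEN conjunct2, THEN conjunct2,
          THEN spec[of _ "T x"], THEN spec[of _ "T y"], THEN spec[of _ "T z"], THEN spec[of _ "T w"],
          THEN mp, OF hs, unfolded ps])
  qed
qed

lemma alg_power_eq_0_isomorphic:
  assumes "isomorphic t s" and k: "alg_power (sc_mult s) k = {0}"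
  shows "alg_power (sc_mult t) k = {0}"
proof -
  obtain T where T: "vlinear T" "bij T" "\<forall>x\<in>even_part. T x \<in> even_part"
    "\<forall>x\<in>odd_part. T x \<in> odd_part" "\<forall>x y. T (sc_mult t x y) = sc_mult s (T x) (T y)"
    by (rule isomorphicE[OF assms(1)])
  have power: "alg_power (sc_mult t) k \<subseteq> {x. T x \<in> alg_power (sc_mult s) k}" for k
  proof (induction k rule: less_induct)
    case (less k)
    show ?case
    proof (cases "k \<le> 1")
      case True
      then show ?thesis by (simp add: alg_power_small)
    next
      case False
      show ?thesis
      proof (rule alg_power_subset)
        show "vec.subspace {x. T x \<in> alg_power (sc_mult s) k}"
          using alg_power_subspace[of "sc_mult s" k]
          by (simp add: vec.subspace_def vlinear_0[OF T(1)] vlinear_add[OF T(1)] vlinear_scale[OF T(1)])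
        fix i x y
        assume i: "1 \<le> i" "i < k"
          and xy: "x \<in> alg_power (sc_mult t) i" "y \<in> alg_power (sc_mult t) (k - i)"
        have "T x \<in> alg_power (sc_mult s) i" "T y \<in> alg_power (sc_mult s) (k - i)"
          using less.IH[of i] less.IH[of "k - i"] i xy by auto
        then show "sc_mult t x y \<in> {x. T x \<in> alg_power (sc_mult s) k}"
          using alg_power_mult[of i "k - i" "T x" "sc_mult s" "T y"] i T(5) by simp
      qed (use False in simp)
    qed
  qed
  have "x = 0" if "x \<in> alg_power (sc_mult t) k" for x
  proof -
    have "T x = 0" using power[of k] that k by auto
    then show ?thesis using vec.linear_inj_iff_eq_0[OF T(1)] bij_is_inj[OF T(2)] by blast
  qed
  then show "alg_power (sc_mult t) k = {0}"
    using vec.subspace_0[OF alg_power_subspace] by blast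
qed

lemma nilpotent_algebra_isomorphic:
  "isomorphic t s \<Longrightarrow> nilpotent_algebra (sc_mult s) \<Longrightarrow> nilpotent_algebra (sc_mult t)"
  unfolding nilpotent_algebra_def using alg_power_eq_0_isomorphic by metis

lemma NJS_isomorphic: "isomorphic t s \<Longrightarrow> s \<in> NJS \<Longrightarrow> t \<in> NJS"
  by (simp add: NJS_def jordan_superalgebra_isomorphic[of t s] nilpotent_algebra_isomorphic[of t s])

lemma orbit_subset_NJS: "s \<in> NJS \<Longrightarrow> orbit s \<subseteq> NJS"
  unfolding orbit_iff_isomorphic[abs_def] subset_iff orbit_iff_isomorphic
  using NJS_isomorphic isomorphic_sym by metis

section \<open>Closed conditions on structure constants\<close>

definition poly_vec :: "(complex ^ 'd::finite \<Rightarrow> complex ^ 'e) \<Rightarrow> bool" where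
  "poly_vec F \<longleftrightarrow> (\<forall>i. poly_fun (\<lambda>s. F s $ i))"

lemma poly_vec_const [intro]: "poly_vec (\<lambda>s. v)"
  by (simp add: poly_vec_def poly_fun.const)

lemma poly_vec_add [intro]: "poly_vec F \<Longrightarrow> poly_vec G \<Longrightarrow> poly_vec (\<lambda>s. F s + G s)"
  by (simp add: poly_vec_def poly_fun.add)

lemma poly_vec_diff [intro]: "poly_vec F \<Longrightarrow> poly_vec G \<Longrightarrow> poly_vec (\<lambda>s. F s - G s)"
  by (simp add: poly_vec_def poly_fun_diff)

lemma poly_vec_scale [intro]: "poly_fun f \<Longrightarrow> poly_vec G \<Longrightarrow> poly_vec (\<lambda>s. f s *s G s)"
  by (simp add: poly_vec_def poly_fun.mult)

lemma poly_vec_nth: "poly_vec F \<Longrightarrow> poly_fun (\<lambda>s. F s $ i)"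
  by (simp add: poly_vec_def)

lemma poly_vec_sc_mult [intro]:
  assumes "poly_vec F" "poly_vec G"
  shows "poly_vec (\<lambda>s. sc_mult s (F s) (G s))"
  unfolding poly_vec_def
proof
  fix i show "poly_fun (\<lambda>s. sc_mult s (F s) (G s) $ i)"
    by (cases i; simp add: sc_mult_nth sc_c_def sc_rho_def sc_Gamma_def;
        intro poly_fun.add poly_fun.mult poly_fun_sum poly_fun.coord poly_vec_nth assms)
qed

lemma poly_fun_linear_form:
  assumes "Vector_Spaces.linear (*s) (*) \<phi>" "poly_vec F"
  shows "poly_fun (\<lambda>s. \<phi> (F s))"
proof -
  have expand: "\<phi> v = (\<Sum>i\<in>UNIV. v $ i * \<phi> (axis i 1))" for v
  proof -
    interpret \<phi>: Vector_Spaces.linear "(*s)" "(*)" \<phi> by (rule assms(1))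
    have "\<phi> v = \<phi> (\<Sum>i\<in>UNIV. v $ i *s axis i 1)" by (simp add: basis_expansion)
    also have "\<dots> = (\<Sum>i\<in>UNIV. v $ i * \<phi> (axis i 1))"
      by (simp add: \<phi>.sum \<phi>.scale)
    finally show ?thesis .
  qed
  have "poly_fun (\<lambda>s. \<Sum>i\<in>UNIV. F s $ i * \<phi> (axis i 1))"
    by (intro poly_fun_sum poly_fun.mult poly_fun.const poly_vec_nth assms(2))
  then show ?thesis by (subst expand)
qed

lemma zariski_closed_poly_vec_eq_0: "poly_vec F \<Longrightarrow> zariski_closed {s. F s = 0}"
  by (rule zariski_closed_vec_eq_0) (simp add: poly_vec_def)

lemma zariski_closed_jordan: "zariski_closed {s. jordan_superalgebra (sc_mult s)}"
proof -
  have comm: "mul x y = c *s mul y x \<longleftrightarrow> mul x y - c *s mul y x = 0"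
    for mul :: "complex ^ ('a + 'b) \<Rightarrow> complex ^ ('a + 'b) \<Rightarrow> complex ^ ('a + 'b)" and x y c
    by simp
  show ?thesis
    unfolding jordan_superalgebra_def comm
    by (intro zariski_closed_Collect_conj zariski_closed_Collect_all zariski_closed_Collect_imp
        zariski_closed_poly_vec_eq_0 poly_vec_add poly_vec_diff poly_vec_scale poly_vec_sc_mult
        poly_vec_const poly_fun.const)
      (simp_all add: superalgebra_sc_mult zariski_closed_UNIV)
qed

text \<open>The \<open>k\<close>-th power is spanned by the values of the monomials of degree \<open>k\<close> in constant vectors.
  So its vanishing is a polynomial condition on the structure constants.\<close>

inductive sc_monomial :: "nat \<Rightarrow> (('m::finite, 'n::finite) sconsts \<Rightarrow> complex ^ ('m + 'n)) \<Rightarrow> bool" where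
  const: "sc_monomial k (\<lambda>s. v)" if "k \<le> 1"
| mult: "sc_monomial i F \<Longrightarrow> sc_monomial j G \<Longrightarrow> 1 \<le> i \<Longrightarrow> 1 \<le> j \<Longrightarrow>
    sc_monomial (i + j) (\<lambda>s. sc_mult s (F s) (G s))"

lemma sc_monomial_poly_vec: "sc_monomial k F \<Longrightarrow> poly_vec F"
  by (induction rule: sc_monomial.induct) auto

lemma sc_monomial_in_alg_power: "sc_monomial k F \<Longrightarrow> F s \<in> alg_power (sc_mult s) k"
  by (induction rule: sc_monomial.induct) (auto simp: alg_power_small alg_power_mult)

lemma span_sc_mult:
  assumes "x \<in> vec.span A" "y \<in> vec.span B"
  shows "sc_mult s x y \<in> vec.span {sc_mult s a b | a b. a \<in> A \<and> b \<in> B}" (is "_ \<in> ?S")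
proof -
  have left: "sc_mult s a y \<in> ?S" if "a \<in> A" for a
    using assms(2)
  proof (induction rule: vec.span_induct_alt)
    case base
    show ?case by (simp add: vec.span_zero)
  next
    case (step c b z)
    have "sc_mult s a b \<in> ?S" using that step(1) by (intro vec.span_base) blast
    then show ?case
      by (simp add: sc_mult_add sc_mult_scale vec.span_add vec.span_scale step(2))
  qed
  show ?thesis
    using assms(1)
  proof (induction rule: vec.span_induct_alt)
    case base
    show ?case by (simp add: vec.span_zero)
  next
    case (step c a z)
    then show ?case by (simp add: left sc_mult_add sc_mult_scale vec.span_add vec.span_scale)
  qed
qed

lemma alg_power_eq_span_monomials:
  fixes s :: "('m::finite, 'n::finite) sconsts"
  shows "alg_power (sc_mult s) k = vec.span {F s | F. sc_monomial k F}"
proof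
  show "vec.span {F s | F. sc_monomial k F} \<subseteq> alg_power (sc_mult s) k"
    by (rule vec.span_minimal[OF _ alg_power_subspace]) (auto intro: sc_monomial_in_alg_power)
  show "alg_power (sc_mult s) k \<subseteq> vec.span {F s | F. sc_monomial k F}"
  proof (induction k rule: less_induct)
    case (less k)
    show ?case
    proof (cases "k \<le> 1")
      case True
      have "v \<in> {F s | F. sc_monomial k F}" for v
        using sc_monomial.const[OF True, of v] by auto
      then show ?thesis using vec.span_base by blast
    next
      case False
      show ?thesis
      proof (rule alg_power_subset[OF _ vec.subspace_span])
        fix i x y
        assume i: "1 \<le> i" "i < k"
          and xy: "x \<in> alg_power (sc_mult s) i" "y \<in> alg_power (sc_mult s) (k - i)"
        have "x \<in> vec.span {F s | F. sc_monomial i F}" "y \<in> vec.span {F s | F. sc_monomial (k - i) F}"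
          using less.IH[of i] less.IH[of "k - i"] i xy by auto
        then have "sc_mult s x y \<in> vec.span {sc_mult s a b | a b.
            a \<in> {F s | F. sc_monomial i F} \<and> b \<in> {F s | F. sc_monomial (k - i) F}}"
          by (rule span_sc_mult)
        moreover have "{sc_mult s a b | a b.
            a \<in> {F s | F. sc_monomial i F} \<and> b \<in> {F s | F. sc_monomial (k - i) F}}
            \<subseteq> {F s | F. sc_monomial k F}"
        proof clarify
          fix F G :: "('m, 'n) sconsts \<Rightarrow> complex ^ ('m + 'n)"
          assume "sc_monomial i F" "sc_monomial (k - i) G"
          then have "sc_monomial k (\<lambda>s. sc_mult s (F s) (G s))"
            using sc_monomial.mult[of i F "k - i" G] i by simp
          then show "\<exists>H. sc_mult s (F s) (G s) = H s \<and> sc_monomial k H"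
            by (intro exI[of _ "\<lambda>s. sc_mult s (F s) (G s)"]) simp
        qed
        ultimately show "sc_mult s x y \<in> vec.span {F s | F. sc_monomial k F}"
          using vec.span_mono by blast
      qed (use False in simp)
    qed
  qed
qed

lemma zariski_closed_alg_power_eq_0:
  "zariski_closed {s :: ('m::finite, 'n::finite) sconsts. alg_power (sc_mult s) k = {0}}"
proof -
  have "alg_power (sc_mult s) k = {0} \<longleftrightarrow> (\<forall>F. sc_monomial k F \<longrightarrow> F s = 0)"
    for s :: "('m, 'n) sconsts"
  proof
    assume "alg_power (sc_mult s) k = {0}"
    then show "\<forall>F. sc_monomial k F \<longrightarrow> F s = 0"
      using sc_monomial_in_alg_power by blast
  next
    assume "\<forall>F. sc_monomial k F \<longrightarrow> F s = 0"
    then have "vec.span {F s | F. sc_monomial k F} \<subseteq> {0}"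
      by (intro vec.span_minimal) auto
    then show "alg_power (sc_mult s) k = {0}"
      unfolding alg_power_eq_span_monomials using vec.span_zero by blast
  qed
  then show ?thesis
    by (simp only:) (intro zariski_closed_Collect_all zariski_closed_Collect_imp
        zariski_closed_poly_vec_eq_0 sc_monomial_poly_vec)
qed

text \<open>Nilpotency alone allows powers of unbounded length and is not visibly a closed condition; the
  vanishing of a fixed power is, and it passes from an orbit to its closure.\<close>

lemma closure_orbit_subset_NJS:
  fixes s :: "('m::finite, 'n::finite) sconsts"
  assumes "jordan_superalgebra (sc_mult s)" "1 \<le> k" "alg_power (sc_mult s) k = {0}"
  shows "zariski closure_of orbit s \<subseteq> NJS"
proof -
  let ?N = "{t :: ('m, 'n) sconsts. jordan_superalgebra (sc_mult t) \<and> alg_power (sc_mult t) k = {0}}"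
  have "zariski closure_of orbit s \<subseteq> ?N"
  proof (rule zariski_closure_minimal)
    show "zariski_closed ?N"
      by (intro zariski_closed_Collect_conj zariski_closed_jordan zariski_closed_alg_power_eq_0)
    show "orbit s \<subseteq> ?N"
    proof
      fix t assume "t \<in> orbit s"
      then have "isomorphic t s" by (simp add: orbit_iff_isomorphic isomorphic_sym)
      then show "t \<in> ?N"
        using jordan_superalgebra_isomorphic alg_power_eq_0_isomorphic assms(1,3) by blast
    qed
  qed
  then show ?thesis using assms(2) by (auto simp: NJS_def nilpotent_algebra_def)
qed

section \<open>Orbit closures\<close>

definition is_poly :: "(complex \<Rightarrow> complex) \<Rightarrow> bool" where
  "is_poly f \<longleftrightarrow> (\<exists>q. \<forall>t. f t = poly q t)"

lemma is_poly_const [intro]: "is_poly (\<lambda>t. a)"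
  unfolding is_poly_def by (rule exI[of _ "[:a:]"]) simp

lemma is_poly_ident [intro]: "is_poly (\<lambda>t. t)"
  unfolding is_poly_def by (rule exI[of _ "[:0, 1:]"]) simp

lemma is_poly_add [intro]: "is_poly f \<Longrightarrow> is_poly g \<Longrightarrow> is_poly (\<lambda>t. f t + g t)"
  unfolding is_poly_def by (metis poly_add)

lemma is_poly_diff [intro]: "is_poly f \<Longrightarrow> is_poly g \<Longrightarrow> is_poly (\<lambda>t. f t - g t)"
  unfolding is_poly_def by (metis poly_diff)

lemma is_poly_mult [intro]: "is_poly f \<Longrightarrow> is_poly g \<Longrightarrow> is_poly (\<lambda>t. f t * g t)"
  unfolding is_poly_def by (metis poly_mult)

lemma is_poly_power [intro]: "is_poly f \<Longrightarrow> is_poly (\<lambda>t. f t ^ k)"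
  unfolding is_poly_def by (metis poly_power)

lemma is_poly_sum: "(\<And>i. i \<in> I \<Longrightarrow> is_poly (f i)) \<Longrightarrow> is_poly (\<lambda>t. \<Sum>i\<in>I. f i t)"
  by (induction I rule: infinite_finite_induct) auto

lemma is_poly_prod: "(\<And>i. i \<in> I \<Longrightarrow> is_poly (f i)) \<Longrightarrow> is_poly (\<lambda>t. \<Prod>i\<in>I. f i t)"
  by (induction I rule: infinite_finite_induct) auto

lemma is_poly_det:
  assumes "\<And>i j. is_poly (\<lambda>t. A t $ i $ j)"
  shows "is_poly (\<lambda>t. det (A t))"
  unfolding det_def by (intro is_poly_sum is_poly_mult is_poly_const is_poly_prod assms)

text \<open>Regular functions on the open set where \<open>\<delta>\<close> does not vanish.\<close>

definition regular_on :: "(complex \<Rightarrow> complex) \<Rightarrow> (complex \<Rightarrow> complex) \<Rightarrow> bool" where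
  "regular_on \<delta> f \<longleftrightarrow> (\<exists>k g. is_poly g \<and> (\<forall>t. \<delta> t \<noteq> 0 \<longrightarrow> f t * \<delta> t ^ k = g t))"

lemma regular_on_poly: "is_poly f \<Longrightarrow> regular_on \<delta> f"
  unfolding regular_on_def by (intro exI[of _ 0] exI[of _ f]) simp

lemma regular_on_add:
  assumes "is_poly \<delta>" "regular_on \<delta> f" "regular_on \<delta> g"
  shows "regular_on \<delta> (\<lambda>t. f t + g t)"
proof -
  obtain k u where f: "is_poly u" "\<And>t. \<delta> t \<noteq> 0 \<Longrightarrow> f t * \<delta> t ^ k = u t"
    using assms(2) by (auto simp: regular_on_def)
  obtain l v where g: "is_poly v" "\<And>t. \<delta> t \<noteq> 0 \<Longrightarrow> g t * \<delta> t ^ l = v t"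
    using assms(3) by (auto simp: regular_on_def)
  have "(f t + g t) * \<delta> t ^ (k + l) = u t * \<delta> t ^ l + v t * \<delta> t ^ k" if "\<delta> t \<noteq> 0" for t
    using f(2)[OF that, symmetric] g(2)[OF that, symmetric] by (simp add: algebra_simps power_add)
  moreover have "is_poly (\<lambda>t. u t * \<delta> t ^ l + v t * \<delta> t ^ k)"
    by (intro is_poly_add is_poly_mult is_poly_power f g assms)
  ultimately show ?thesis
    unfolding regular_on_def
    by (intro exI[of _ "k + l"] exI[of _ "\<lambda>t. u t * \<delta> t ^ l + v t * \<delta> t ^ k"]) simp
qed

lemma regular_on_mult:
  assumes "regular_on \<delta> f" "regular_on \<delta> g"
  shows "regular_on \<delta> (\<lambda>t. f t * g t)"
proof -
  obtain k u where f: "is_poly u" "\<And>t. \<delta> t \<noteq> 0 \<Longrightarrow> f t * \<delta> t ^ k = u t"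
    using assms(1) by (auto simp: regular_on_def)
  obtain l v where g: "is_poly v" "\<And>t. \<delta> t \<noteq> 0 \<Longrightarrow> g t * \<delta> t ^ l = v t"
    using assms(2) by (auto simp: regular_on_def)
  have "(f t * g t) * \<delta> t ^ (k + l) = u t * v t" if "\<delta> t \<noteq> 0" for t
    using f(2)[OF that, symmetric] g(2)[OF that, symmetric] by (simp add: algebra_simps power_add)
  then show ?thesis
    unfolding regular_on_def
    by (intro exI[of _ "k + l"] exI[of _ "\<lambda>t. u t * v t"]) (simp add: is_poly_mult f g)
qed

lemma regular_on_sum:
  "is_poly \<delta> \<Longrightarrow> (\<And>i. i \<in> I \<Longrightarrow> regular_on \<delta> (f i)) \<Longrightarrow> regular_on \<delta> (\<lambda>t. \<Sum>i\<in>I. f i t)"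
  by (induction I rule: infinite_finite_induct)
    (simp_all add: regular_on_add regular_on_poly is_poly_const)

lemma regular_on_poly_fun:
  assumes "poly_fun p" "is_poly \<delta>" "\<And>i. regular_on \<delta> (\<lambda>t. F t $ i)"
  shows "regular_on \<delta> (\<lambda>t. p (F t))"
  using assms(1)
  by induction (auto intro: regular_on_poly regular_on_add regular_on_mult assms(2,3))

text \<open>By Cramer's rule. What matters is that the entries of the inverse are polynomials in the entries
  of \<open>A\<close> divided by the determinant.\<close>

lemma matrix_inv_nth:
  fixes A :: "complex ^ 'n::finite ^ 'n"
  assumes "det A \<noteq> 0"
  shows "matrix_inv A $ i $ j = det (\<chi> a b. if b = i then axis j 1 $ a else A $ a $ b) / det A"
proof -
  have "A *v (matrix_inv A *v axis j 1) = axis j 1"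
    using matrix_inv_inverse(1)[of A] assms by (simp add: matrix_vector_mul_assoc invertible_det_nz)
  then have "matrix_inv A *v axis j 1
      = (\<chi> k. det (\<chi> a b. if b = k then axis j 1 $ a else A $ a $ b) / det A)"
    using cramer[OF assms] by blast
  then have "(matrix_inv A *v axis j 1) $ i
      = det (\<chi> a b. if b = i then axis j 1 $ a else A $ a $ b) / det A"
    by simp
  then show ?thesis
    by (simp add: matrix_vector_mult_def axis_def if_distrib[of "\<lambda>a. _ * a"] cong: if_cong)
qed

lemma regular_on_matrix_inv:
  fixes A :: "complex \<Rightarrow> complex ^ 'n::finite ^ 'n"
  assumes A: "\<And>i j. is_poly (\<lambda>t. A t $ i $ j)" and u: "is_poly u"
    and \<delta>: "\<And>t. \<delta> t = det (A t) * u t"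
  shows "regular_on \<delta> (\<lambda>t. matrix_inv (A t) $ i $ j)"
proof -
  let ?M = "\<lambda>t. (\<chi> a b. if b = i then axis j 1 $ a else A t $ a $ b) :: complex ^ 'n ^ 'n"
  have "matrix_inv (A t) $ i $ j * \<delta> t = det (?M t) * u t" if "\<delta> t \<noteq> 0" for t
    using that by (simp add: \<delta> matrix_inv_nth)
  moreover have "is_poly (\<lambda>t. det (?M t) * u t)"
  proof (intro is_poly_mult is_poly_det u)
    show "is_poly (\<lambda>t. ?M t $ a $ b)" for a b
      by (cases "b = i") (simp_all add: A is_poly_const)
  qed
  ultimately show ?thesis
    unfolding regular_on_def by (intro exI[of _ 1] exI[of _ "\<lambda>t. det (?M t) * u t"]) simp
qed

lemma sc_index_cases [case_names c rho Gamma]: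
  fixes t :: "('m, 'n) sc_index"
  obtains i j k where "t = Inl (i, j, k)" | i j k where "t = Inr (Inl (i, j, k))"
    | i j k where "t = Inr (Inr (i, j, k))"
  by (metis sum.exhaust prod_cases3)

text \<open>Two points \<open>g\<^sub>0\<close>, \<open>g\<^sub>1\<close> of \<open>GL\<^sub>m \<times> GL\<^sub>n\<close> lie on a line that meets the group in a cofinite set, and
  polynomial functions of \<open>g s\<close> are rational along this line. If \<open>p\<close> does not vanish at \<open>g\<^sub>0 s\<close> and
  \<open>q\<close> does not vanish at \<open>g\<^sub>1 s\<close>, then neither vanishes at a general point of the line.\<close>

lemma orbit_irreducible: "irreducible_in zariski (orbit s)"
  unfolding irreducible_in_def
proof (intro conjI allI impI)
  show "orbit s \<noteq> {}" using orbit_refl by blast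
  show "orbit s \<subseteq> topspace zariski" by simp
  fix A B assume cl: "closedin zariski A" "closedin zariski B" and sub: "orbit s \<subseteq> A \<union> B"
  show "orbit s \<subseteq> A \<or> orbit s \<subseteq> B"
  proof (rule ccontr)
    assume "\<not> (orbit s \<subseteq> A \<or> orbit s \<subseteq> B)"
    then obtain x y where x: "x \<in> orbit s" "x \<notin> A" and y: "y \<in> orbit s" "y \<notin> B" by blast
    obtain p where p: "poly_fun p" "\<And>z. z \<in> A \<Longrightarrow> p z = 0" "p x \<noteq> 0"
      using cl(1) x(2) unfolding closedin_zariski zariski_closed_def zero_locus_def by blast
    obtain q where q: "poly_fun q" "\<And>z. z \<in> B \<Longrightarrow> q z = 0" "q y \<noteq> 0"
      using cl(2) y(2) unfolding closedin_zariski zariski_closed_def zero_locus_def by blast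
    obtain P0 Q0 where 0: "invertible P0" "invertible Q0" "x = sc_act P0 Q0 s"
      using x(1) unfolding orbit_def by blast
    obtain P1 Q1 where 1: "invertible P1" "invertible Q1" "y = sc_act P1 Q1 s"
      using y(1) unfolding orbit_def by blast
    \<comment> \<open>The line through the two group elements; it stays in the group where \<open>\<delta>\<close> does not vanish.\<close>
    define P where "P t = (\<chi> i j. (1 - t) * P0 $ i $ j + t * P1 $ i $ j)" for t
    define Q where "Q t = (\<chi> i j. (1 - t) * Q0 $ i $ j + t * Q1 $ i $ j)" for t
    have ends: "P 0 = P0" "P 1 = P1" "Q 0 = Q0" "Q 1 = Q1"
      by (simp_all add: P_def Q_def vec_eq_iff)
    have polyP: "is_poly (\<lambda>t. P t $ i $ j)" for i j
      by (simp add: P_def) (intro is_poly_add is_poly_mult is_poly_diff is_poly_const is_poly_ident)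
    have polyQ: "is_poly (\<lambda>t. Q t $ i $ j)" for i j
      by (simp add: Q_def) (intro is_poly_add is_poly_mult is_poly_diff is_poly_const is_poly_ident)
    define \<delta> where "\<delta> t = det (P t) * det (Q t)" for t
    have \<delta>: "is_poly \<delta>"
      unfolding \<delta>_def by (intro is_poly_mult is_poly_det polyP polyQ)
    have invP: "regular_on \<delta> (\<lambda>t. matrix_inv (P t) $ i $ j)" for i j
      by (rule regular_on_matrix_inv[OF polyP is_poly_det[OF polyQ]]) (simp add: \<delta>_def)
    have invQ: "regular_on \<delta> (\<lambda>t. matrix_inv (Q t) $ i $ j)" for i j
      by (rule regular_on_matrix_inv[OF polyQ is_poly_det[OF polyP]]) (simp add: \<delta>_def)
    have reg: "regular_on \<delta> (\<lambda>t. sc_act (P t) (Q t) s $ i)" for i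
      by (cases i rule: sc_index_cases; simp add: sc_act_def mk_sconsts_def;
          (intro regular_on_sum[OF \<delta>] regular_on_mult invP invQ
            regular_on_poly[OF polyP] regular_on_poly[OF polyQ] regular_on_poly[OF is_poly_const]))
    obtain k f where f: "is_poly f" "\<And>t. \<delta> t \<noteq> 0 \<Longrightarrow> p (sc_act (P t) (Q t) s) * \<delta> t ^ k = f t"
      using regular_on_poly_fun[OF p(1) \<delta> reg] unfolding regular_on_def by blast
    obtain l g where g: "is_poly g" "\<And>t. \<delta> t \<noteq> 0 \<Longrightarrow> q (sc_act (P t) (Q t) s) * \<delta> t ^ l = g t"
      using regular_on_poly_fun[OF q(1) \<delta> reg] unfolding regular_on_def by blast
    have \<delta>01: "\<delta> 0 \<noteq> 0" "\<delta> 1 \<noteq> 0"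
      using 0 1 by (simp_all add: \<delta>_def ends invertible_det_nz)
    have f0: "f 0 \<noteq> 0" using f(2)[of 0] \<delta>01 p(3) by (auto simp: ends 0(3))
    have g1: "g 1 \<noteq> 0" using g(2)[of 1] \<delta>01 q(3) by (auto simp: ends 1(3))
    obtain F G D where FGD: "\<And>t. f t = poly F t" "\<And>t. g t = poly G t" "\<And>t. \<delta> t = poly D t"
      using f(1) g(1) \<delta> unfolding is_poly_def by metis
    have "F \<noteq> 0" "G \<noteq> 0" "D \<noteq> 0" using f0 g1 \<delta>01 FGD by auto
    then have "F * G * D \<noteq> 0" by simp
    then obtain t where "poly (F * G * D) t \<noteq> 0"
      using poly_all_0_iff_0 by blast
    then have t: "f t \<noteq> 0" "g t \<noteq> 0" "\<delta> t \<noteq> 0" using FGD by auto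
    have "p (sc_act (P t) (Q t) s) \<noteq> 0" "q (sc_act (P t) (Q t) s) \<noteq> 0"
      using f(2)[OF t(3)] g(2)[OF t(3)] t by auto
    then have "sc_act (P t) (Q t) s \<notin> A \<union> B" using p(2) q(2) by blast
    moreover have "sc_act (P t) (Q t) s \<in> orbit s"
      using t(3) unfolding orbit_def by (auto simp: \<delta>_def invertible_det_nz)
    ultimately show False using sub by blast
  qed
qed

lemma poly_fun_sc_act: "poly_fun (\<lambda>s. sc_act P Q s $ i)"
  by (cases i rule: sc_index_cases;
      simp add: sc_act_def mk_sconsts_def sc_c_def sc_rho_def sc_Gamma_def;
      (intro poly_fun_sum poly_fun.mult poly_fun.const poly_fun.coord))

text \<open>A fixed group element acts by a linear map on structure constants, so it preserves the closure of an
  orbit.\<close>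

lemma closure_orbit_isomorphic:
  assumes "s \<in> zariski closure_of orbit r" "isomorphic s t"
  shows "t \<in> zariski closure_of orbit r"
proof -
  obtain P Q where inv: "invertible P" "invertible Q" and t: "t = sc_act P Q s"
    using assms(2) unfolding orbit_iff_isomorphic[symmetric] orbit_def by blast
  have "sc_act P Q ` orbit r \<subseteq> orbit r"
  proof clarify
    fix x assume "x \<in> orbit r"
    moreover have "sc_act P Q x \<in> orbit x" unfolding orbit_def using inv by blast
    ultimately show "sc_act P Q x \<in> orbit r"
      unfolding orbit_iff_isomorphic by (rule isomorphic_trans)
  qed
  then show ?thesis
    unfolding t by (rule zariski_closure_image[OF poly_fun_sc_act _ assms(1)])
qed

section \<open>Triangular multiplication tables in type \<open>(3, 2)\<close>\<close>

text \<open>The table \<open>e\<^sub>1\<^sup>2 = a e\<^sub>2 + b e\<^sub>3\<close>, \<open>e\<^sub>1 e\<^sub>2 = c e\<^sub>3\<close>, \<open>e\<^sub>2\<^sup>2 = d e\<^sub>3\<close>, \<open>e\<^sub>i f\<^sub>2 = r\<^sub>i f\<^sub>1\<close>,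
  \<open>f\<^sub>1 f\<^sub>2 = g\<^sub>1 e\<^sub>1 + g\<^sub>2 e\<^sub>2 + g\<^sub>3 e\<^sub>3\<close>.\<close>

definition triang :: "complex \<Rightarrow> complex \<Rightarrow> complex \<Rightarrow> complex \<Rightarrow> complex \<Rightarrow> complex \<Rightarrow> complex \<Rightarrow>
    complex \<Rightarrow> complex \<Rightarrow> complex \<Rightarrow> (3, 2) sconsts" where
  "triang a b c d r1 r2 r3 g1 g2 g3 = mk_sconsts
     (\<lambda>i j k. if i = 1 \<and> j = 1 then (if k = 2 then a else if k = 3 then b else 0)
        else if k = 3 then
          (if (i = 1 \<and> j = 2) \<or> (i = 2 \<and> j = 1) then c else if i = 2 \<and> j = 2 then d else 0)
        else 0)
     (\<lambda>i j k. if j = 2 \<and> k = 1 then (if i = 1 then r1 else if i = 2 then r2 else r3) else 0)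
     (\<lambda>i j k. (if i = 1 \<and> j = 2 then 1 else if i = 2 \<and> j = 1 then - 1 else 0) *
        (if k = 1 then g1 else if k = 2 then g2 else g3))"

lemma numeral_type_neq:
  "(1::3) \<noteq> 2" "(1::3) \<noteq> 3" "(2::3) \<noteq> 1" "(2::3) \<noteq> 3" "(3::3) \<noteq> 1" "(3::3) \<noteq> 2"
  "(1::2) \<noteq> 2" "(2::2) \<noteq> 1"
  by simp_all

lemma sc_mult_triang:
  "sc_mult (triang a b c d r1 r2 r3 g1 g2 g3) x y $ Inl 1 =
     g1 * (x $ Inr 1 * y $ Inr 2 - x $ Inr 2 * y $ Inr 1)"
  "sc_mult (triang a b c d r1 r2 r3 g1 g2 g3) x y $ Inl 2 =
     a * x $ Inl 1 * y $ Inl 1 + g2 * (x $ Inr 1 * y $ Inr 2 - x $ Inr 2 * y $ Inr 1)"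
  "sc_mult (triang a b c d r1 r2 r3 g1 g2 g3) x y $ Inl 3 =
     b * x $ Inl 1 * y $ Inl 1 + c * (x $ Inl 1 * y $ Inl 2 + x $ Inl 2 * y $ Inl 1)
     + d * x $ Inl 2 * y $ Inl 2 + g3 * (x $ Inr 1 * y $ Inr 2 - x $ Inr 2 * y $ Inr 1)"
  "sc_mult (triang a b c d r1 r2 r3 g1 g2 g3) x y $ Inr 1 =
     (r1 * x $ Inl 1 + r2 * x $ Inl 2 + r3 * x $ Inl 3) * y $ Inr 2
     + x $ Inr 2 * (r1 * y $ Inl 1 + r2 * y $ Inl 2 + r3 * y $ Inl 3)"
  "sc_mult (triang a b c d r1 r2 r3 g1 g2 g3) x y $ Inr 2 = 0"
  unfolding sc_mult_nth triang_def mk_sconsts_nth sum_3 sum_2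
  by (simp_all add: numeral_type_neq algebra_simps)

lemma J_eq_triang:
  "J18 = triang 0 0 1 0  0 0 0  1 1 0"
  "J19 = triang 0 0 1 0  0 0 1  0 0 0"
  "J23 = triang 0 0 1 0  1 1 0  0 0 1"
  "J25 = triang 1 0 1 0  0 0 0  0 1 0"
  "J27 = triang 1 0 1 0  0 1 0  0 0 0"
  "J29 = triang 1 0 1 0  1 0 0  0 0 1"
  unfolding J18_def J19_def J23_def J25_def J27_def J29_def table_def triang_def
  by (simp_all add: sconsts_eq_iff fun_eq_iff forall_3 forall_2)

lemma super32_eq_iff:
  fixes x y :: "complex ^ (3 + 2)"
  shows "x = y \<longleftrightarrow> x $ Inl 1 = y $ Inl 1 \<and> x $ Inl 2 = y $ Inl 2 \<and> x $ Inl 3 = y $ Inl 3 \<and>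
    x $ Inr 1 = y $ Inr 1 \<and> x $ Inr 2 = y $ Inr 2"
  by (simp add: super_vec_eq_iff forall_3 forall_2)

lemma even32_iff: "x \<in> (even_part :: (complex ^ (3 + 2)) set) \<longleftrightarrow> x $ Inr 1 = 0 \<and> x $ Inr 2 = 0"
  by (simp add: even_part_def forall_2)

lemma odd32_iff: "x \<in> (odd_part :: (complex ^ (3 + 2)) set) \<longleftrightarrow>
    x $ Inl 1 = 0 \<and> x $ Inl 2 = 0 \<and> x $ Inl 3 = 0"
  by (simp add: odd_part_def forall_3)

definition supercommutative :: "('m::finite, 'n::finite) sconsts \<Rightarrow> bool" where
  "supercommutative s \<longleftrightarrow>
     (\<forall>x\<in>even_part. \<forall>y\<in>even_part. sc_mult s x y = sc_mult s y x) \<and>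
     (\<forall>x\<in>odd_part. \<forall>y\<in>odd_part. sc_mult s x y = - sc_mult s y x)"

lemma supercommutative_triang: "supercommutative (triang a b c d r1 r2 r3 g1 g2 g3)"
  by (simp add: supercommutative_def super32_eq_iff sc_mult_triang even32_iff odd32_iff algebra_simps)

lemma supercommutative_jordan:
  assumes "jordan_superalgebra (sc_mult s)"
  shows "supercommutative s"
  unfolding supercommutative_def
proof (intro conjI ballI)
  have comm: "sc_mult s x y = (- 1) ^ (parity x * parity y) *s sc_mult s y x"
    if "homogeneous x" "homogeneous y" for x y
    by (rule assms[unfolded jordan_superalgebra_def, THEN conjunct2, THEN conjunct1,
        THEN spec[of _ x], THEN spec[of _ y], THEN mp, OF conjI, OF that])
  show "sc_mult s x y = sc_mult s y x" if "x \<in> even_part" "y \<in> even_part" for x y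
    using comm[of x y] that
    by (cases "x = 0"; cases "y = 0"; simp add: homogeneous_def parity_def)
  have odd: "parity x = 1" if "x \<noteq> 0" "x \<in> odd_part" for x :: "complex ^ ('a + 'b)"
    using that by (auto simp: parity_def even_part_def odd_part_def super_vec_eq_iff)
  show "sc_mult s x y = - sc_mult s y x" if "x \<in> odd_part" "y \<in> odd_part" for x y
    using comm[of x y] that
    by (cases "x = 0"; cases "y = 0"; simp add: homogeneous_def odd)
qed

lemma triang_of_basis:
  assumes sc: "supercommutative s"
    and even: "u1 \<in> even_part" "u2 \<in> even_part" "u3 \<in> even_part"
    and odd: "v1 \<in> odd_part" "v2 \<in> odd_part"
    and ind: "\<And>x1 x2 x3 y1 y2. x1 *s u1 + x2 *s u2 + x3 *s u3 + y1 *s v1 + y2 *s v2 = 0 \<Longrightarrow>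
        x1 = 0 \<and> x2 = 0 \<and> x3 = 0 \<and> y1 = 0 \<and> y2 = 0"
    and m: "sc_mult s u1 u1 = a *s u2 + b *s u3" "sc_mult s u1 u2 = c *s u3" "sc_mult s u1 u3 = 0"
      "sc_mult s u2 u2 = d *s u3" "sc_mult s u2 u3 = 0" "sc_mult s u3 u3 = 0"
      "sc_mult s u1 v1 = 0" "sc_mult s u2 v1 = 0" "sc_mult s u3 v1 = 0"
      "sc_mult s u1 v2 = r1 *s v1" "sc_mult s u2 v2 = r2 *s v1" "sc_mult s u3 v2 = r3 *s v1"
      "sc_mult s v1 v2 = g1 *s u1 + g2 *s u2 + g3 *s u3"
  shows "isomorphic (triang a b c d r1 r2 r3 g1 g2 g3) s"
proof -
  define u where "u = (\<lambda>i::3. if i = 1 then u1 else if i = 2 then u2 else u3)"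
  define v where "v = (\<lambda>j::2. if j = 1 then v1 else v2)"
  have u: "u 1 = u1" "u 2 = u2" "u 3 = u3" and v: "v 1 = v1" "v 2 = v2"
    by (simp_all add: u_def v_def)
  have comm: "sc_mult s u2 u1 = c *s u3" "sc_mult s u3 u1 = 0" "sc_mult s u3 u2 = 0"
    using sc even m by (auto simp: supercommutative_def)
  have "sc_mult s x x = 0" if "x \<in> odd_part" for x
  proof -
    have "sc_mult s x x = - sc_mult s x x" using sc that unfolding supercommutative_def by blast
    then have "sc_mult s x x $ i = - sc_mult s x x $ i" for i by (metis vector_uminus_component)
    then show ?thesis by (simp add: vec_eq_iff)
  qed
  moreover have "sc_mult s v2 v1 = - sc_mult s v1 v2"
    using sc odd unfolding supercommutative_def by blast
  ultimately have anti: "sc_mult s v1 v1 = 0" "sc_mult s v2 v2 = 0"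
    "sc_mult s v2 v1 = - (g1 *s u1 + g2 *s u2 + g3 *s u3)"
    using odd m by simp_all
  show ?thesis
  proof (rule isomorphic_of_basis[where u = u and v = v])
    show "u i \<in> even_part" for i using even by (simp add: u_def)
    show "v j \<in> odd_part" for j using odd by (simp add: v_def)
    fix x :: "3 \<Rightarrow> complex" and y :: "2 \<Rightarrow> complex"
    assume "(\<Sum>i\<in>UNIV. x i *s u i) + (\<Sum>j\<in>UNIV. y j *s v j) = 0"
    then have "x 1 *s u1 + x 2 *s u2 + x 3 *s u3 + y 1 *s v1 + y 2 *s v2 = 0"
      by (simp add: sum_3 sum_2 u v add.assoc)
    then have "x 1 = 0 \<and> x 2 = 0 \<and> x 3 = 0 \<and> y 1 = 0 \<and> y 2 = 0" by (rule ind)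
    then show "x = (\<lambda>_. 0) \<and> y = (\<lambda>_. 0)" by (simp add: fun_eq_iff forall_3 forall_2)
  next
    let ?t = "triang a b c d r1 r2 r3 g1 g2 g3"
    have "\<forall>i j. sc_mult s (u i) (u j) = (\<Sum>k\<in>UNIV. sc_c ?t i j k *s u k)"
      unfolding forall_3 sum_3 u by (simp add: triang_def m comm)
    then show "sc_mult s (u i) (u j) = (\<Sum>k\<in>UNIV. sc_c ?t i j k *s u k)" for i j by blast
    have "\<forall>i j. sc_mult s (u i) (v j) = (\<Sum>k\<in>UNIV. sc_rho ?t i j k *s v k)"
      unfolding forall_3 forall_2 sum_2 u v by (simp add: triang_def m)
    then show "sc_mult s (u i) (v j) = (\<Sum>k\<in>UNIV. sc_rho ?t i j k *s v k)" for i j by blast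
    have "\<forall>i j. sc_mult s (v i) (v j) = (\<Sum>k\<in>UNIV. sc_Gamma ?t i j k *s u k)"
      unfolding forall_2 sum_3 u v by (simp add: triang_def m anti vec_eq_iff)
    then show "sc_mult s (v i) (v j) = (\<Sum>k\<in>UNIV. sc_Gamma ?t i j k *s u k)" for i j by blast
  qed
qed

text \<open>A change of basis \<open>E\<^sub>1 = (x\<^sub>1, x\<^sub>2, x\<^sub>3)\<close>, \<open>E\<^sub>2 = (y\<^sub>1, y\<^sub>2, y\<^sub>3)\<close>, \<open>E\<^sub>3 = (z\<^sub>1, z\<^sub>2, z\<^sub>3)\<close>,
  \<open>F\<^sub>1 = l f\<^sub>1\<close>, \<open>F\<^sub>2 = m f\<^sub>2\<close> between triangular tables.\<close>

lemma triang_change_basis: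
  assumes ind: "\<And>p q r. p * x1 + q * y1 + r * z1 = 0 \<Longrightarrow> p * x2 + q * y2 + r * z2 = 0 \<Longrightarrow>
        p * x3 + q * y3 + r * z3 = 0 \<Longrightarrow> p = 0 \<and> q = 0 \<and> r = 0"
      and lm: "l \<noteq> 0" "m \<noteq> 0"
    and m11: "a' * y1 + b' * z1 = 0" "a' * y2 + b' * z2 = a * x1 * x1"
        "a' * y3 + b' * z3 = b * x1 * x1 + 2 * c * x1 * x2 + d * x2 * x2"
    and m12: "c' * z1 = 0" "c' * z2 = a * x1 * y1"
        "c' * z3 = b * x1 * y1 + c * (x1 * y2 + x2 * y1) + d * x2 * y2"
    and m13: "a * x1 * z1 = 0" "b * x1 * z1 + c * (x1 * z2 + x2 * z1) + d * x2 * z2 = 0"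
    and m22: "d' * z1 = 0" "d' * z2 = a * y1 * y1"
        "d' * z3 = b * y1 * y1 + 2 * c * y1 * y2 + d * y2 * y2"
    and m23: "a * y1 * z1 = 0" "b * y1 * z1 + c * (y1 * z2 + y2 * z1) + d * y2 * z2 = 0"
    and m33: "a * z1 * z1 = 0" "b * z1 * z1 + 2 * c * z1 * z2 + d * z2 * z2 = 0"
    and r: "(r1 * x1 + r2 * x2 + r3 * x3) * m = r1' * l"
        "(r1 * y1 + r2 * y2 + r3 * y3) * m = r2' * l"
        "(r1 * z1 + r2 * z2 + r3 * z3) * m = r3' * l"
    and g: "g1 * l * m = g1' * x1 + g2' * y1 + g3' * z1" "g2 * l * m = g1' * x2 + g2' * y2 + g3' * z2"
        "g3 * l * m = g1' * x3 + g2' * y3 + g3' * z3"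
  shows "isomorphic (triang a' b' c' d' r1' r2' r3' g1' g2' g3') (triang a b c d r1 r2 r3 g1 g2 g3)"
proof -
  define vec5 :: "complex \<Rightarrow> complex \<Rightarrow> complex \<Rightarrow> complex \<Rightarrow> complex \<Rightarrow> complex ^ (3 + 2)" where
    "vec5 p q r k h = p *s even_vec 1 + q *s even_vec 2 + r *s even_vec 3 + k *s odd_vec 1 + h *s odd_vec 2"
    for p q r k h
  have v5: "vec5 p q r k h $ Inl 1 = p" "vec5 p q r k h $ Inl 2 = q" "vec5 p q r k h $ Inl 3 = r"
    "vec5 p q r k h $ Inr 1 = k" "vec5 p q r k h $ Inr 2 = h" for p q r k h
    by (simp_all add: vec5_def numeral_type_neq)
  note simps = super32_eq_iff even32_iff odd32_iff v5 sc_mult_triang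
  show ?thesis
  proof (rule triang_of_basis[OF supercommutative_triang, where
        ?u1.0 = "vec5 x1 x2 x3 0 0" and ?u2.0 = "vec5 y1 y2 y3 0 0" and ?u3.0 = "vec5 z1 z2 z3 0 0" and
        ?v1.0 = "vec5 0 0 0 l 0" and ?v2.0 = "vec5 0 0 0 0 m"])
    fix p q r h k
    assume "p *s vec5 x1 x2 x3 0 0 + q *s vec5 y1 y2 y3 0 0 + r *s vec5 z1 z2 z3 0 0
       + h *s vec5 0 0 0 l 0 + k *s vec5 0 0 0 0 m = 0"
    then have "p * x1 + q * y1 + r * z1 = 0" "p * x2 + q * y2 + r * z2 = 0"
        "p * x3 + q * y3 + r * z3 = 0" "h * l = 0" "k * m = 0"
      by (simp_all add: simps)
    then show "p = 0 \<and> q = 0 \<and> r = 0 \<and> h = 0 \<and> k = 0"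
      using ind[of p q r] lm by simp
  qed (use assms(4-) in \<open>simp_all add: simps algebra_simps\<close>)
qed

section \<open>Generic tables\<close>

lemma isomorphic_J27:
  assumes "a \<noteq> 0" "c \<noteq> 0" "r2 \<noteq> 0"
  shows "isomorphic J27 (triang a b c 0 r1 r2 0 0 0 0)"
proof -
  \<comment> \<open>Replacing \<open>e\<^sub>1\<close> by \<open>e\<^sub>1 + t e\<^sub>2\<close> moves the generator of the even part into the kernel of \<open>\<rho>\<close>.\<close>
  define t where "t = - r1 / r2"
  have t: "r1 + r2 * t = 0" using assms by (simp add: t_def)
  show ?thesis
    unfolding J_eq_triang
    by (rule triang_change_basis[where ?x1.0 = 1 and ?x2.0 = t and ?x3.0 = 0 and
          ?y1.0 = 0 and ?y2.0 = a and ?y3.0 = "b + 2 * t * c" and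
          ?z1.0 = 0 and ?z2.0 = 0 and ?z3.0 = "a * c" and l = "a * r2" and m = 1])
      (use assms t in \<open>auto simp: algebra_simps\<close>)
qed

lemma isomorphic_J25:
  assumes "a \<noteq> 0" "c \<noteq> 0" "g2 \<noteq> 0"
  shows "isomorphic J25 (triang a b c 0 0 0 0 0 g2 g3)"
proof -
  \<comment> \<open>Here \<open>t\<close> is chosen so that the square of \<open>e\<^sub>1 + t e\<^sub>2\<close> is proportional to \<open>\<gamma>\<close>.\<close>
  define t where "t = (a * g3 / g2 - b) / (2 * c)"
  have "2 * t * c = a * g3 / g2 - b" using assms by (simp add: t_def)
  then have t: "a * g3 / g2 = b + c * (t * 2)" by (simp add: algebra_simps)
  show ?thesis
    unfolding J_eq_triang
    by (rule triang_change_basis[where ?x1.0 = 1 and ?x2.0 = t and ?x3.0 = 0 and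
          ?y1.0 = 0 and ?y2.0 = a and ?y3.0 = "b + 2 * t * c" and
          ?z1.0 = 0 and ?z2.0 = 0 and ?z3.0 = "a * c" and l = 1 and m = "a / g2"])
      (use assms t in \<open>auto simp: algebra_simps\<close>)
qed

lemma isomorphic_J29:
  assumes "a \<noteq> 0" "c \<noteq> 0" "r1 \<noteq> 0" "g3 \<noteq> 0"
  shows "isomorphic J29 (triang a b c 0 r1 0 0 0 0 g3)"
proof -
  \<comment> \<open>Scaling \<open>f\<^sub>2\<close> by \<open>m\<close> scales \<open>F\<^sub>1 = E\<^sub>1 F\<^sub>2\<close> too, so the coefficient of \<open>F\<^sub>1 F\<^sub>2\<close> scales by \<open>m\<^sup>2\<close>.\<close>
  define m where "m = csqrt (a * c / (r1 * g3))"
  have m2: "m * m = a * c / (r1 * g3)"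
    by (metis m_def power2_csqrt power2_eq_square)
  then have m: "g3 * (m * r1) * m = a * c" "m \<noteq> 0"
    using assms by (auto simp: field_simps)
  show ?thesis
    unfolding J_eq_triang
    by (rule triang_change_basis[where ?x1.0 = 1 and ?x2.0 = 0 and ?x3.0 = 0 and
          ?y1.0 = 0 and ?y2.0 = a and ?y3.0 = b and
          ?z1.0 = 0 and ?z2.0 = 0 and ?z3.0 = "a * c" and l = "m * r1" and m = m])
      (use assms m in \<open>auto simp: algebra_simps\<close>)
qed

text \<open>Over the complex numbers a nondegenerate quadratic form \<open>b x\<^sup>2 + 2 c x y + d y\<^sup>2\<close> is the product
  \<open>k (q x - p y) (q' x - p' y)\<close> of independent linear forms, so it has a basis of isotropic vectors
  \<open>(p, q)\<close> and \<open>(p', q')\<close>.\<close>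

lemma quadratic_form_factors:
  fixes b c d :: complex
  assumes "b * d - c * c \<noteq> 0"
  obtains k p q p' q' where "k \<noteq> 0" "p * q' - p' * q \<noteq> 0" "b = k * q * q'"
    "2 * c = - k * (p * q' + p' * q)" "d = k * p * p'"
proof (cases "b = 0")
  case True
  show ?thesis
    by (rule that[of 1 "-1" "2 * c" "- d" 0]) (use True assms in auto)
next
  case False
  define w where "w = csqrt (c * c - b * d)"
  have w: "w * w = c * c - b * d" by (metis w_def power2_csqrt power2_eq_square)
  have d: "d = (c * c - w * w) / b" using w False by (simp add: field_simps)
  have "w \<noteq> 0" using w assms by auto
  then show ?thesis
    using False
    by (intro that[of b "(- c + w) / b" 1 "(- c - w) / b" 1]) (auto simp: d field_simps)
qed

text \<open>In the isotropic basis \<open>(p, q)\<close>, \<open>(p', q')\<close> the form becomes \<open>2 n x y\<close> with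
  \<open>n = \<beta>((p, q), (p', q'))\<close>, and the vector \<open>n e\<^sub>3\<close> absorbs the factor \<open>n\<close>. The remaining coefficients
  are those of \<open>\<rho>\<close> and \<open>\<gamma>\<close> in the new basis.\<close>

lemma triang_hyperbolic:
  assumes "k \<noteq> 0" "p * q' - p' * q \<noteq> 0" "b = k * q * q'"
    "2 * c = - k * (p * q' + p' * q)" "d = k * p * p'"
  defines "\<Delta> \<equiv> p * q' - p' * q"
  defines "n \<equiv> - k * \<Delta> * \<Delta> / 2"
  shows "isomorphic
     (triang 0 0 1 0 (r1 * p + r2 * q) (r1 * p' + r2 * q') (r3 * n)
       ((g1 * q' - g2 * p') / \<Delta>) ((p * g2 - q * g1) / \<Delta>) (g3 / n))
     (triang 0 b c d r1 r2 r3 g1 g2 g3)"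
proof -
  have D: "\<Delta> \<noteq> 0" and n: "n \<noteq> 0" using assms by auto
  have c: "c = - k * (p * q' + p' * q) / 2" using assms(4) by (simp add: field_simps)
  show ?thesis
  proof (rule triang_change_basis[where ?x1.0 = p and ?x2.0 = q and ?x3.0 = 0 and
          ?y1.0 = p' and ?y2.0 = q' and ?y3.0 = 0 and
          ?z1.0 = 0 and ?z2.0 = 0 and ?z3.0 = n and l = 1 and m = 1])
    fix u v w assume *: "u * p + v * p' + w * 0 = 0" "u * q + v * q' + w * 0 = 0"
      "u * 0 + v * 0 + w * n = 0"
    have "u * \<Delta> = (u * p + v * p') * q' - (u * q + v * q') * p'"
      "v * \<Delta> = (u * q + v * q') * p - (u * p + v * p') * q"
      by (simp_all add: \<Delta>_def algebra_simps)
    then have "u * \<Delta> = 0" "v * \<Delta> = 0" using * by (simp_all del: mult_eq_0_iff)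
    then show "u = 0 \<and> v = 0 \<and> w = 0" using * D n by simp
  next
    show "1 * n = b * p * p' + c * (p * q' + q * p') + d * q * q'"
      unfolding n_def \<Delta>_def assms(3,5) c by (simp add: field_simps)
    show "0 * 0 + 0 * n = b * p * p + 2 * c * p * q + d * q * q"
      unfolding assms(3,4,5) by (simp add: algebra_simps)
    show "0 * n = b * p' * p' + 2 * c * p' * q' + d * q' * q'"
      unfolding assms(3,4,5) by (simp add: algebra_simps)
    show "g1 * 1 * 1 = (g1 * q' - g2 * p') / \<Delta> * p + (p * g2 - q * g1) / \<Delta> * p' + g3 / n * 0"
      using D by (simp add: field_simps) (simp add: \<Delta>_def algebra_simps)
    show "g2 * 1 * 1 = (g1 * q' - g2 * p') / \<Delta> * q + (p * g2 - q * g1) / \<Delta> * q' + g3 / n * 0"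
      using D by (simp add: field_simps) (simp add: \<Delta>_def algebra_simps)
  qed (use n in simp_all)
qed

text \<open>In hyperbolic coordinates, multiples of \<open>e\<^sub>3\<close> correct the two isotropic vectors to lie in the kernel
  of \<open>\<rho>\<close>.\<close>

lemma isomorphic_J19:
  assumes "b * d - c * c \<noteq> 0" "r3 \<noteq> 0"
  shows "isomorphic J19 (triang 0 b c d r1 r2 r3 0 0 0)"
proof -
  obtain k p q p' q' where f: "k \<noteq> 0" "p * q' - p' * q \<noteq> 0" "b = k * q * q'"
    "2 * c = - k * (p * q' + p' * q)" "d = k * p * p'"
    by (rule quadratic_form_factors[OF assms(1)])
  have hyp: "isomorphic J19 (triang 0 0 1 0 s1 s2 s3 0 0 0)" if "s3 \<noteq> 0" for s1 s2 s3
    unfolding J_eq_triang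
    by (rule triang_change_basis[where ?x1.0 = 1 and ?x2.0 = 0 and ?x3.0 = "- s1 / s3" and
          ?y1.0 = 0 and ?y2.0 = 1 and ?y3.0 = "- s2 / s3" and
          ?z1.0 = 0 and ?z2.0 = 0 and ?z3.0 = 1 and l = s3 and m = 1])
      (use that in auto)
  have "isomorphic (triang 0 0 1 0 (r1 * p + r2 * q) (r1 * p' + r2 * q')
      (r3 * (- k * (p * q' - p' * q) * (p * q' - p' * q) / 2)) 0 0 0) (triang 0 b c d r1 r2 r3 0 0 0)"
    using triang_hyperbolic[OF f, of r1 r2 r3 0 0 0] by (simp only: mult_zero_left mult_zero_right div_0 diff_self)
  with hyp show ?thesis
    by (rule isomorphic_trans) (use f assms(2) in simp)
qed

text \<open>In hyperbolic coordinates, the two components of \<open>\<gamma>\<close> along the isotropic vectors are nonzero because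
  \<open>\<beta>(\<gamma>, \<gamma>) \<noteq> 0\<close>; up to a multiple of \<open>e\<^sub>3\<close>, they are the new \<open>e\<^sub>1\<close> and \<open>e\<^sub>2\<close>.\<close>

lemma isomorphic_J18:
  assumes "b * d - c * c \<noteq> 0" "b * g1 * g1 + 2 * c * g1 * g2 + d * g2 * g2 \<noteq> 0"
  shows "isomorphic J18 (triang 0 b c d 0 0 0 g1 g2 g3)"
proof -
  obtain k p q p' q' where f: "k \<noteq> 0" "p * q' - p' * q \<noteq> 0" "b = k * q * q'"
    "2 * c = - k * (p * q' + p' * q)" "d = k * p * p'"
    by (rule quadratic_form_factors[OF assms(1)])
  have hyp: "isomorphic J18 (triang 0 0 1 0 0 0 0 h1 h2 h3)" if "h1 \<noteq> 0" "h2 \<noteq> 0" for h1 h2 h3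
    unfolding J_eq_triang
    by (rule triang_change_basis[where ?x1.0 = h1 and ?x2.0 = 0 and ?x3.0 = h3 and
          ?y1.0 = 0 and ?y2.0 = h2 and ?y3.0 = 0 and
          ?z1.0 = 0 and ?z2.0 = 0 and ?z3.0 = "h1 * h2" and l = 1 and m = 1])
      (use that in auto)
  have iso: "isomorphic (triang 0 0 1 0 0 0 0
       ((g1 * q' - g2 * p') / (p * q' - p' * q)) ((p * g2 - q * g1) / (p * q' - p' * q))
       (g3 / (- k * (p * q' - p' * q) * (p * q' - p' * q) / 2))) (triang 0 b c d 0 0 0 g1 g2 g3)"
    using triang_hyperbolic[OF f, of 0 0 0 g1 g2 g3] by (simp only: mult_zero_left add_0)
  have form: "b * g1 * g1 + 2 * c * g1 * g2 + d * g2 * g2 = - k * (g1 * q' - g2 * p') * (p * g2 - q * g1)"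
    unfolding f(3-5) by (simp add: algebra_simps)
  from hyp iso show ?thesis
    by (rule isomorphic_trans) (use f assms(2) form in auto)
qed

text \<open>The second hypothesis says that the vector \<open>r\<^sub>2 e\<^sub>1 - r\<^sub>1 e\<^sub>2\<close>, which \<open>\<rho>\<close> kills, is not isotropic, so \<open>\<rho>\<close> is
  nonzero on both isotropic vectors, which are then scaled to have \<open>\<rho> = 1\<close>.\<close>

lemma isomorphic_J23:
  assumes "b * d - c * c \<noteq> 0" "d * r1 * r1 - 2 * c * r1 * r2 + b * r2 * r2 \<noteq> 0" "g3 \<noteq> 0"
  shows "isomorphic J23 (triang 0 b c d r1 r2 0 0 0 g3)"
proof -
  obtain k p q p' q' where f: "k \<noteq> 0" "p * q' - p' * q \<noteq> 0" "b = k * q * q'"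
    "2 * c = - k * (p * q' + p' * q)" "d = k * p * p'"
    by (rule quadratic_form_factors[OF assms(1)])
  have hyp: "isomorphic J23 (triang 0 0 1 0 s1 s2 0 0 0 h)" if "s1 \<noteq> 0" "s2 \<noteq> 0" "h \<noteq> 0" for s1 s2 h
  proof -
    \<comment> \<open>As both \<open>f\<^sub>1\<close> and \<open>f\<^sub>2\<close> are scaled by \<open>m\<close>, the coefficient of \<open>f\<^sub>1 f\<^sub>2\<close> is scaled by \<open>m\<^sup>2\<close>.\<close>
    define m where "m = csqrt (1 / (s1 * s2 * h))"
    have m2: "m * m = 1 / (s1 * s2 * h)"
      by (metis m_def power2_csqrt power2_eq_square)
    then have m: "h * m * m = 1 / (s1 * s2)" "m \<noteq> 0"
      using that by (auto simp: field_simps)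
    show ?thesis
      unfolding J_eq_triang
      by (rule triang_change_basis[where ?x1.0 = "1 / s1" and ?x2.0 = 0 and ?x3.0 = 0 and
            ?y1.0 = 0 and ?y2.0 = "1 / s2" and ?y3.0 = 0 and
            ?z1.0 = 0 and ?z2.0 = 0 and ?z3.0 = "1 / (s1 * s2)" and l = m and m = m])
        (use that m in auto)
  qed
  have iso: "isomorphic (triang 0 0 1 0 (r1 * p + r2 * q) (r1 * p' + r2 * q') 0 0 0
       (g3 / (- k * (p * q' - p' * q) * (p * q' - p' * q) / 2))) (triang 0 b c d r1 r2 0 0 0 g3)"
    using triang_hyperbolic[OF f, of r1 r2 0 0 0 g3]
    by (simp only: mult_zero_left mult_zero_right div_0 diff_self)
  have form: "d * r1 * r1 - 2 * c * r1 * r2 + b * r2 * r2 = k * (r1 * p + r2 * q) * (r1 * p' + r2 * q')"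
    unfolding f(3-5) by (simp add: algebra_simps)
  from hyp iso show ?thesis
    by (rule isomorphic_trans) (use f assms(2,3) form in auto)
qed

section \<open>Degenerations\<close>

lemma is_poly_if: "is_poly f \<Longrightarrow> is_poly g \<Longrightarrow> is_poly (\<lambda>t. if P then f t else g t)"
  by (cases P) simp_all

lemma is_poly_uminus: "is_poly f \<Longrightarrow> is_poly (\<lambda>t. - f t)"
  unfolding is_poly_def by (metis poly_minus)

lemma triang_curve_in_closure:
  assumes "is_poly a" "is_poly b" "is_poly c" "is_poly d" "is_poly r1" "is_poly r2" "is_poly r3"
    "is_poly g1" "is_poly g2" "is_poly g3"
    and "finite {t. \<not> isomorphic J (triang (a t) (b t) (c t) (d t) (r1 t) (r2 t) (r3 t) (g1 t) (g2 t) (g3 t))}"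
  shows "triang (a 0) (b 0) (c 0) (d 0) (r1 0) (r2 0) (r3 0) (g1 0) (g2 0) (g3 0) \<in> zariski closure_of orbit J"
proof -
  let ?F = "\<lambda>t. triang (a t) (b t) (c t) (d t) (r1 t) (r2 t) (r3 t) (g1 t) (g2 t) (g3 t)"
  have "is_poly (\<lambda>t. ?F t $ i)" for i
    by (cases i rule: sc_index_cases; simp add: triang_def mk_sconsts_def;
        intro conjI impI is_poly_if is_poly_uminus is_poly_const assms(1-10))
  then show ?thesis
    using assms(11)
    by (intro curve_in_zariski_closure[of ?F "orbit J" 0]) (simp_all add: is_poly_def orbit_iff_isomorphic)
qed

lemma finite_linear_zeros: "finite {t::complex. b + t = 0}"
proof -
  have "{t. b + t = 0} = {- b}" by (auto simp: add_eq_0_iff)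
  then show ?thesis by simp
qed

lemma finite_quadratic_zeros: "finite {t::complex. (b + t) * (d + t) - c * c = 0}"
proof -
  have eq: "(b + t) * (d + t) - c * c = poly [:b * d - c * c, b + d, 1:] t" for t
    by (simp add: algebra_simps)
  show ?thesis unfolding eq by (rule poly_roots_finite) simp
qed

text \<open>The polynomial in \<open>t\<close> is monic of degree 3 whatever the coefficients are. This is why the curves below
  move one coefficient of \<open>\<gamma>\<close> or \<open>\<rho>\<close> together with \<open>b\<close> and \<open>d\<close>: with that coefficient fixed the polynomial
  could vanish identically.\<close>

lemma finite_cubic_zeros:
  "finite {t::complex. (b + t) * (g + t) * (g + t) + 2 * c * (g + t) * h + (d + t) * h * h = 0}"
proof -
  let ?p = "[:b * g * g + 2 * c * g * h + d * h * h, g * g + 2 * b * g + 2 * c * h + h * h, b + 2 * g, 1:]"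
  have eq: "(b + t) * (g + t) * (g + t) + 2 * c * (g + t) * h + (d + t) * h * h = poly ?p t" for t
    by (simp add: algebra_simps)
  show ?thesis unfolding eq by (rule poly_roots_finite) simp
qed

text \<open>Degenerate coefficients are allowed here. With \<open>c = 0\<close> the family contains the tables
  \<open>e\<^sub>1\<^sup>2 = a e\<^sub>2\<close>, \<open>e\<^sub>1 f\<^sub>2 = r\<^sub>1 f\<^sub>1\<close>, \<open>f\<^sub>1 f\<^sub>2 = g\<^sub>3 e\<^sub>3\<close> whose even part has vanishing cube.\<close>

lemma triang_in_closure_29: "triang a b c 0 r1 0 0 0 0 g3 \<in> zariski closure_of orbit J29"
proof -
  have "{t. \<not> isomorphic J29 (triang (a + t) b (c + t) 0 (r1 + t) 0 0 0 0 (g3 + t))}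
      \<subseteq> {t. a + t = 0} \<union> {t. c + t = 0} \<union> {t. r1 + t = 0} \<union> {t. g3 + t = 0}"
    using isomorphic_J29 by blast
  then have "finite {t. \<not> isomorphic J29 (triang (a + t) b (c + t) 0 (r1 + t) 0 0 0 0 (g3 + t))}"
    by (rule finite_subset) (simp add: finite_linear_zeros)
  from triang_curve_in_closure[OF _ _ _ _ _ _ _ _ _ _ this]
  show ?thesis by (simp add: is_poly_add is_poly_const is_poly_ident)
qed

lemma triang_in_closure_19: "triang 0 b c d r1 r2 r3 0 0 0 \<in> zariski closure_of orbit J19"
proof -
  have "{t. \<not> isomorphic J19 (triang 0 (b + t) c (d + t) r1 r2 (r3 + t) 0 0 0)}
      \<subseteq> {t. (b + t) * (d + t) - c * c = 0} \<union> {t. r3 + t = 0}"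
    using isomorphic_J19 by blast
  then have "finite {t. \<not> isomorphic J19 (triang 0 (b + t) c (d + t) r1 r2 (r3 + t) 0 0 0)}"
    by (rule finite_subset) (intro finite_UnI finite_quadratic_zeros finite_linear_zeros)
  from triang_curve_in_closure[OF _ _ _ _ _ _ _ _ _ _ this]
  show ?thesis by (simp add: is_poly_add is_poly_const is_poly_ident)
qed

lemma triang_in_closure_18: "triang 0 b c d 0 0 0 g1 g2 g3 \<in> zariski closure_of orbit J18"
proof -
  have "{t. \<not> isomorphic J18 (triang 0 (b + t) c (d + t) 0 0 0 (g1 + t) g2 g3)}
      \<subseteq> {t. (b + t) * (d + t) - c * c = 0} \<union>
        {t. (b + t) * (g1 + t) * (g1 + t) + 2 * c * (g1 + t) * g2 + (d + t) * g2 * g2 = 0}"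
    using isomorphic_J18 by blast
  then have "finite {t. \<not> isomorphic J18 (triang 0 (b + t) c (d + t) 0 0 0 (g1 + t) g2 g3)}"
    by (rule finite_subset) (intro finite_UnI finite_quadratic_zeros finite_cubic_zeros)
  from triang_curve_in_closure[OF _ _ _ _ _ _ _ _ _ _ this]
  show ?thesis by (simp add: is_poly_add is_poly_const is_poly_ident)
qed

lemma triang_in_closure_23: "triang 0 b c d r1 r2 0 0 0 g3 \<in> zariski closure_of orbit J23"
proof -
  have cubic: "finite {t. (d + t) * (r1 + t) * (r1 + t) - 2 * c * (r1 + t) * r2 + (b + t) * r2 * r2 = 0}"
    using finite_cubic_zeros[of d r1 "- c" r2 b] by simp
  have "{t. \<not> isomorphic J23 (triang 0 (b + t) c (d + t) (r1 + t) r2 0 0 0 (g3 + t))}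
      \<subseteq> {t. (b + t) * (d + t) - c * c = 0} \<union>
        {t. (d + t) * (r1 + t) * (r1 + t) - 2 * c * (r1 + t) * r2 + (b + t) * r2 * r2 = 0} \<union> {t. g3 + t = 0}"
    using isomorphic_J23 by blast
  then have "finite {t. \<not> isomorphic J23 (triang 0 (b + t) c (d + t) (r1 + t) r2 0 0 0 (g3 + t))}"
    by (rule finite_subset) (intro finite_UnI finite_quadratic_zeros finite_linear_zeros cubic)
  from triang_curve_in_closure[OF _ _ _ _ _ _ _ _ _ _ this]
  show ?thesis by (simp add: is_poly_add is_poly_const is_poly_ident)
qed

section \<open>The six algebras are nilpotent Jordan superalgebras\<close>

definition parity_part :: "nat \<Rightarrow> (complex ^ ('m::finite + 'n::finite)) set" where
  "parity_part p = (if p = 0 then even_part else odd_part)"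

text \<open>Quantifying over parities instead of homogeneous vectors includes the zero vector and reduces the
  identity to 16 polynomial identities in coordinates.\<close>

lemma jordan_superalgebraI:
  assumes sc: "supercommutative s"
    and jordan: "\<And>p q r h x y z w. p \<in> {0, 1} \<Longrightarrow> q \<in> {0, 1} \<Longrightarrow> r \<in> {0, 1} \<Longrightarrow> h \<in> {0, 1} \<Longrightarrow>
        x \<in> parity_part p \<Longrightarrow> y \<in> parity_part q \<Longrightarrow> z \<in> parity_part r \<Longrightarrow> w \<in> parity_part h \<Longrightarrow>
        sc_mult s (sc_mult s w x) (sc_mult s y z)
        + (- 1) ^ (p * q) *s sc_mult s (sc_mult s w y) (sc_mult s x z)
        + (- 1) ^ ((p + q) * r) *s sc_mult s (sc_mult s w z) (sc_mult s x y)
        - (- 1) ^ (h * p) *s sc_mult s x (sc_mult s w (sc_mult s y z))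
        - (- 1) ^ (q * (h + p)) *s sc_mult s y (sc_mult s w (sc_mult s x z))
        - (- 1) ^ (r * (h + p + q)) *s sc_mult s z (sc_mult s w (sc_mult s x y)) = 0"
  shows "jordan_superalgebra (sc_mult s)"
proof -
  have part: "parity x \<in> {0, 1}" "x \<in> parity_part (parity x)" if "homogeneous x"
    for x :: "complex ^ ('a + 'b)"
    using that by (auto simp: homogeneous_def parity_def parity_part_def)
  show ?thesis
    unfolding jordan_superalgebra_def
  proof (intro conjI allI impI superalgebra_sc_mult)
    fix x y :: "complex ^ ('a + 'b)" assume *: "homogeneous x \<and> homogeneous y"
    show "sc_mult s x y = (- 1) ^ (parity x * parity y) *s sc_mult s y x"
    proof (cases "x \<in> even_part \<and> y \<in> even_part \<or> x \<in> odd_part \<and> y \<in> odd_part")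
      case True
      have "parity v = 1" if "v \<in> odd_part" "homogeneous v" for v :: "complex ^ ('a + 'b)"
        using that by (auto simp: homogeneous_def parity_def even_part_def odd_part_def super_vec_eq_iff)
      with True * show ?thesis
      proof (elim disjE conjE)
        assume "x \<in> even_part" "y \<in> even_part"
        then have "sc_mult s x y = sc_mult s y x"
          using sc unfolding supercommutative_def by blast
        then show ?thesis using \<open>x \<in> even_part\<close> by (simp add: parity_def)
      next
        assume xy: "x \<in> odd_part" "y \<in> odd_part" "homogeneous x" "homogeneous y"
          and odd: "\<And>v :: complex ^ ('a + 'b). v \<in> odd_part \<Longrightarrow> homogeneous v \<Longrightarrow> parity v = 1"
        have "sc_mult s x y = - sc_mult s y x"
          using sc xy unfolding supercommutative_def by blast
        then show ?thesis using odd[OF xy(1,3)] odd[OF xy(2,4)] by simp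
      qed
    next
      case False
      then have "x \<in> even_part \<and> y \<in> odd_part \<or> x \<in> odd_part \<and> y \<in> even_part"
        using * by (auto simp: homogeneous_def)
      then show ?thesis
        by (elim disjE conjE) (simp_all add: parity_def sc_mult_odd_even_comm[of x y] sc_mult_odd_even_comm[of y x])
    qed
  next
    fix x y z w :: "complex ^ ('a + 'b)"
    assume *: "homogeneous x \<and> homogeneous y \<and> homogeneous z \<and> homogeneous w"
    show "sc_mult s (sc_mult s w x) (sc_mult s y z)
        + (- 1) ^ (parity x * parity y) *s sc_mult s (sc_mult s w y) (sc_mult s x z)
        + (- 1) ^ ((parity x + parity y) * parity z) *s sc_mult s (sc_mult s w z) (sc_mult s x y)
        - (- 1) ^ (parity w * parity x) *s sc_mult s x (sc_mult s w (sc_mult s y z))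
        - (- 1) ^ (parity y * (parity w + parity x)) *s sc_mult s y (sc_mult s w (sc_mult s x z))
        - (- 1) ^ (parity z * (parity w + parity x + parity y)) *s sc_mult s z (sc_mult s w (sc_mult s x y))
        = 0"
      by (rule jordan) (use * part in blast)+
  qed
qed

lemma mem_parity_part:
  "x \<in> (parity_part 0 :: (complex ^ (3 + 2)) set) \<longleftrightarrow> x $ Inr 1 = 0 \<and> x $ Inr 2 = 0"
  "x \<in> (parity_part (Suc 0) :: (complex ^ (3 + 2)) set) \<longleftrightarrow> x $ Inl 1 = 0 \<and> x $ Inl 2 = 0 \<and> x $ Inl 3 = 0"
  by (simp_all add: parity_part_def even32_iff odd32_iff)

lemma jordan_J:
  "jordan_superalgebra (sc_mult J18)" "jordan_superalgebra (sc_mult J19)"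
  "jordan_superalgebra (sc_mult J23)" "jordan_superalgebra (sc_mult J25)"
  "jordan_superalgebra (sc_mult J27)" "jordan_superalgebra (sc_mult J29)"
  unfolding J_eq_triang
  by (rule jordan_superalgebraI[OF supercommutative_triang];
      elim insertE emptyE;
      simp add: mem_parity_part super32_eq_iff sc_mult_triang algebra_simps)+

text \<open>Nilpotency is certified by positive weights of the basis vectors that are superadditive under
  multiplication.\<close>

definition weight :: "nat \<Rightarrow> nat \<Rightarrow> nat \<Rightarrow> nat \<Rightarrow> nat \<Rightarrow> 3 + 2 \<Rightarrow> nat" where
  "weight w1 w2 w3 v1 v2 t = (case t of Inl i \<Rightarrow> if i = 1 then w1 else if i = 2 then w2 else w3
     | Inr j \<Rightarrow> if j = 1 then v1 else v2)"

lemma weight_simps [simp]: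
  "weight w1 w2 w3 v1 v2 (Inl 1) = w1" "weight w1 w2 w3 v1 v2 (Inl 2) = w2"
  "weight w1 w2 w3 v1 v2 (Inl 3) = w3" "weight w1 w2 w3 v1 v2 (Inr 1) = v1"
  "weight w1 w2 w3 v1 v2 (Inr 2) = v2"
  by (simp_all add: weight_def)

lemma alg_power_eq_0_of_weights:
  fixes mul :: "complex ^ 'd::finite \<Rightarrow> complex ^ 'd \<Rightarrow> complex ^ 'd"
  assumes "\<And>t. 1 \<le> wt t" "\<And>t. wt t < n" "1 \<le> n"
    and "\<And>x y k t. (\<And>t' t''. wt t' + wt t'' < k \<Longrightarrow> x $ t' * y $ t'' = 0) \<Longrightarrow> wt t < k \<Longrightarrow> mul x y $ t = 0"
  shows "alg_power mul n = {0}"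
proof -
  define W where "W k = {x :: complex ^ 'd. \<forall>t. wt t < k \<longrightarrow> x $ t = 0}" for k
  have "alg_power mul n \<subseteq> W n"
  proof (rule alg_power_subset_filtration)
    show "vec.subspace (W k)" for k
      by (auto simp: vec.subspace_def W_def)
    have "\<not> wt t < 1" for t using assms(1)[of t] by simp
    then show "W 1 = UNIV" unfolding W_def by blast
    fix i j x y assume "x \<in> W i" "y \<in> W j"
    then have "x $ t' * y $ t'' = 0" if "wt t' + wt t'' < i + j" for t' t''
      using that by (cases "wt t' < i") (auto simp: W_def)
    then show "mul x y \<in> W (i + j)"
      using assms(4)[of "i + j" x y] by (simp add: W_def)
  qed (use assms in auto)
  also have "W n \<subseteq> {0}" using assms(2) by (auto simp: W_def vec_eq_iff)
  finally show ?thesis using vec.subspace_0[OF alg_power_subspace, of mul n] by auto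
qed

lemma alg_power_triang_eq_0:
  assumes pos: "1 \<le> w1" "1 \<le> w2" "1 \<le> w3" "1 \<le> v1" "1 \<le> v2"
    and bound: "w1 < n" "w2 < n" "w3 < n" "v1 < n" "v2 < n"
    and sup: "a \<noteq> 0 \<Longrightarrow> 2 * w1 \<le> w2" "b \<noteq> 0 \<Longrightarrow> 2 * w1 \<le> w3" "c \<noteq> 0 \<Longrightarrow> w1 + w2 \<le> w3"
      "d \<noteq> 0 \<Longrightarrow> 2 * w2 \<le> w3" "r1 \<noteq> 0 \<Longrightarrow> w1 + v2 \<le> v1" "r2 \<noteq> 0 \<Longrightarrow> w2 + v2 \<le> v1"
      "r3 \<noteq> 0 \<Longrightarrow> w3 + v2 \<le> v1" "g1 \<noteq> 0 \<Longrightarrow> v1 + v2 \<le> w1" "g2 \<noteq> 0 \<Longrightarrow> v1 + v2 \<le> w2"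
      "g3 \<noteq> 0 \<Longrightarrow> v1 + v2 \<le> w3"
  shows "alg_power (sc_mult (triang a b c d r1 r2 r3 g1 g2 g3)) n = {0}"
proof (rule alg_power_eq_0_of_weights[where wt = "weight w1 w2 w3 v1 v2"])
  show "1 \<le> weight w1 w2 w3 v1 v2 t" "weight w1 w2 w3 v1 v2 t < n" for t
    using pos bound by (auto simp: weight_def split: sum.split)
  show "1 \<le> n" using pos(1) bound(1) by linarith
  fix x y :: "complex ^ (3 + 2)" and k t
  assume z: "\<And>t' t''. weight w1 w2 w3 v1 v2 t' + weight w1 w2 w3 v1 v2 t'' < k \<Longrightarrow> x $ t' * y $ t'' = 0"
    and k: "weight w1 w2 w3 v1 v2 t < k"
  let ?m = "sc_mult (triang a b c d r1 r2 r3 g1 g2 g3) x y"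
  have scaled: "e * (x $ t' * y $ t'') = 0"
    if "e \<noteq> 0 \<Longrightarrow> weight w1 w2 w3 v1 v2 t' + weight w1 w2 w3 v1 v2 t'' < k" for e t' t''
    using z[of t' t''] that by (cases "e = 0") auto
  show "?m $ t = 0"
  proof -
    consider "t = Inl 1" | "t = Inl 2" | "t = Inl 3" | "t = Inr 1" | "t = Inr 2"
    proof (cases t)
      case (Inl i)
      then show thesis using exhaust_3[of i] that(1-3) by (elim disjE) simp_all
    next
      case (Inr j)
      then show thesis using exhaust_2[of j] that(4,5) by (elim disjE) simp_all
    qed
    then show ?thesis
    proof cases
      case 1
      have "g1 * (x $ Inr 1 * y $ Inr 2) = 0" "g1 * (x $ Inr 2 * y $ Inr 1) = 0"
        by (rule scaled, use k sup 1 in force)+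
      then show ?thesis unfolding 1 sc_mult_triang by algebra
    next
      case 2
      have "a * (x $ Inl 1 * y $ Inl 1) = 0" "g2 * (x $ Inr 1 * y $ Inr 2) = 0"
        "g2 * (x $ Inr 2 * y $ Inr 1) = 0"
        by (rule scaled, use k sup 2 in force)+
      then show ?thesis unfolding 2 sc_mult_triang by algebra
    next
      case 3
      have "b * (x $ Inl 1 * y $ Inl 1) = 0" "c * (x $ Inl 1 * y $ Inl 2) = 0"
        "c * (x $ Inl 2 * y $ Inl 1) = 0" "d * (x $ Inl 2 * y $ Inl 2) = 0"
        "g3 * (x $ Inr 1 * y $ Inr 2) = 0" "g3 * (x $ Inr 2 * y $ Inr 1) = 0"
        by (rule scaled, use k sup 3 in force)+
      then show ?thesis unfolding 3 sc_mult_triang by algebra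
    next
      case 4
      have "r1 * (x $ Inl 1 * y $ Inr 2) = 0" "r2 * (x $ Inl 2 * y $ Inr 2) = 0"
        "r3 * (x $ Inl 3 * y $ Inr 2) = 0" "r1 * (x $ Inr 2 * y $ Inl 1) = 0"
        "r2 * (x $ Inr 2 * y $ Inl 2) = 0" "r3 * (x $ Inr 2 * y $ Inl 3) = 0"
        by (rule scaled, use k sup 4 in force)+
      then show ?thesis unfolding 4 sc_mult_triang by algebra
    next
      case 5
      then show ?thesis by (simp add: sc_mult_triang)
    qed
  qed
qed

text \<open>The five numbers are the weights of \<open>e\<^sub>1, e\<^sub>2, e\<^sub>3, f\<^sub>1, f\<^sub>2\<close>. None exceeds 4, so products of five factors
  vanish.\<close>

lemma alg_power_J:
  "alg_power (sc_mult J18) 5 = {0}" "alg_power (sc_mult J19) 5 = {0}"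
  "alg_power (sc_mult J23) 5 = {0}" "alg_power (sc_mult J25) 5 = {0}"
  "alg_power (sc_mult J27) 5 = {0}" "alg_power (sc_mult J29) 5 = {0}"
  unfolding J_eq_triang
  by (rule alg_power_triang_eq_0[of 2 2 4 1 1] alg_power_triang_eq_0[of 1 1 2 3 1]
      alg_power_triang_eq_0[of 1 1 3 2 1] alg_power_triang_eq_0[of 1 2 3 1 1]
      alg_power_triang_eq_0[of 1 2 3 3 1] alg_power_triang_eq_0[of 1 2 3 2 1];
      (simp; fail))+

section \<open>Adapted bases\<close>

text \<open>The span of \<open>E W\<close> is a proper subspace of \<open>W\<close>, since otherwise \<open>W\<close> would reproduce itself. Any hyperplane
  of \<open>W\<close> that contains it serves as \<open>H\<close>. As \<open>E H\<close> lies in \<open>H\<close> again, the step can be repeated.\<close>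

lemma nilpotent_flag_step:
  fixes W :: "(complex ^ 'd::finite) set"
  assumes nil: "nilpotent_algebra mul" and W: "vec.subspace W" "vec.dim W = Suc n"
    and EW: "\<forall>x\<in>E. \<forall>w\<in>W. mul x w \<in> W"
  obtains e H where "vec.subspace H" "H \<subseteq> W" "vec.dim H = n" "e \<in> W" "e \<notin> H"
    "\<forall>w\<in>W. \<exists>k. \<exists>h\<in>H. w = k *s e + h" "\<forall>x\<in>E. \<forall>w\<in>W. mul x w \<in> H"
proof -
  let ?P = "{mul x w | x w. x \<in> E \<and> w \<in> W}"
  obtain S where S: "S \<subseteq> ?P" "vec.independent S" "?P \<subseteq> vec.span S"
    by (rule vec.basis_exists)
  have "S \<subseteq> W" using S(1) EW by auto
  then obtain B where B: "S \<subseteq> B" "B \<subseteq> W" "vec.independent B" "W \<subseteq> vec.span B"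
    using vec.maximal_independent_subset_extend[OF _ S(2)] by blast
  have "\<not> W \<subseteq> vec.span S"
  proof
    assume "W \<subseteq> vec.span S"
    also have "\<dots> \<subseteq> vec.span {mul x w | x w. w \<in> W}"
      by (rule vec.span_mono) (use S(1) in blast)
    finally have "W \<subseteq> {0}" by (rule nilpotent_no_fixed_set[OF nil])
    then have "vec.dim W = 0" by simp
    then show False using W(2) by simp
  qed
  then obtain e where e: "e \<in> B" "e \<notin> S"
    using B(1,4) by (metis subset_antisym subsetI)
  define H where "H = vec.span (B - {e})"
  have sub: "vec.subspace H" unfolding H_def by (rule vec.subspace_span)
  have HW: "H \<subseteq> W" unfolding H_def by (rule vec.span_minimal[OF _ W(1)]) (use B(2) in blast)
  have eH: "e \<notin> H" using B(3) e(1) unfolding H_def vec.dependent_def by blast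
  have decomp: "\<exists>k. \<exists>h\<in>H. w = k *s e + h" if "w \<in> W" for w
  proof -
    have "w \<in> vec.span B" using that B(4) by blast
    then obtain k where "w - k *s e \<in> H"
      using vec.span_breakdown[OF e(1)] unfolding H_def by blast
    then show ?thesis by (intro exI[of _ k] bexI[of _ "w - k *s e"]) simp_all
  qed
  have "vec.dim W = vec.dim (insert e (B - {e}))"
    using e(1) B(2-4) by (metis insert_Diff vec.basis_card_eq_dim vec.dim_eq_card_independent)
  also have "\<dots> = vec.dim (B - {e}) + 1"
    using eH unfolding H_def vec.dim_insert by (simp only: if_False)
  finally have "vec.dim H = n" using W(2) by (simp add: H_def)
  moreover have mem: "mul x w \<in> H" if "x \<in> E" "w \<in> W" for x w
  proof -
    have "mul x w \<in> vec.span S" using S(3) that by blast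
    also have "vec.span S \<subseteq> H" unfolding H_def using B(1) e(2) by (intro vec.span_mono) auto
    finally show ?thesis .
  qed
  moreover have "e \<in> W" using e(1) B(2) by blast
  ultimately show thesis
    using that[OF sub HW _ _ eH] decomp by simp
qed

lemma subspace_even_part: "vec.subspace even_part"
  and subspace_odd_part: "vec.subspace odd_part"
  by (auto simp: vec.subspace_def even_part_def odd_part_def)

lemma dim_even_part: "vec.dim (even_part :: (complex ^ ('m::finite + 'n::finite)) set) = CARD('m)"
proof (rule vec.dim_unique)
  let ?B = "range even_vec :: (complex ^ ('m + 'n)) set"
  show "?B \<subseteq> even_part" by auto
  show "even_part \<subseteq> vec.span ?B"
  proof
    fix x :: "complex ^ ('m + 'n)" assume "x \<in> even_part"
    then have "x = even_proj x" by (simp add: super_vec_eq_iff even_part_def)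
    also have "\<dots> \<in> vec.span ?B"
      unfolding even_proj_def by (intro vec.span_sum vec.span_scale vec.span_base) simp
    finally show "x \<in> vec.span ?B" .
  qed
  show "vec.independent ?B"
    by (rule vec.independent_mono[OF independent_cart_basis]) (auto simp: cart_basis_def even_vec_def)
  have "inj (even_vec :: 'm \<Rightarrow> complex ^ ('m + 'n))"
    by (auto simp: inj_def even_vec_def axis_eq_axis)
  then show "card ?B = CARD('m)" by (rule card_image)
qed

lemma dim_odd_part: "vec.dim (odd_part :: (complex ^ ('m::finite + 'n::finite)) set) = CARD('n)"
proof (rule vec.dim_unique)
  let ?B = "range odd_vec :: (complex ^ ('m + 'n)) set"
  show "?B \<subseteq> odd_part" by auto
  show "odd_part \<subseteq> vec.span ?B"
  proof
    fix x :: "complex ^ ('m + 'n)" assume "x \<in> odd_part"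
    then have "x = odd_proj x" by (simp add: super_vec_eq_iff odd_part_def)
    also have "\<dots> \<in> vec.span ?B"
      unfolding odd_proj_def by (intro vec.span_sum vec.span_scale vec.span_base) simp
    finally show "x \<in> vec.span ?B" .
  qed
  show "vec.independent ?B"
    by (rule vec.independent_mono[OF independent_cart_basis]) (auto simp: cart_basis_def odd_vec_def)
  have "inj (odd_vec :: 'n \<Rightarrow> complex ^ ('m + 'n))"
    by (auto simp: inj_def odd_vec_def axis_eq_axis)
  then show "card ?B = CARD('n)" by (rule card_image)
qed

lemma subspace_coefficient_0:
  assumes "vec.subspace H" "e \<notin> H" "c *s e + h = 0" "h \<in> H"
  shows "c = (0::complex)"
proof (rule ccontr)
  assume "c \<noteq> 0"
  have "e = (- inverse c) *s h"
  proof -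
    have "c *s e = - h" using assms(3) by (simp add: add_eq_0_iff2)
    then have "inverse c *s (c *s e) = inverse c *s (- h)" by simp
    then show ?thesis using \<open>c \<noteq> 0\<close> by (simp add: vector_smult_assoc vec_eq_iff)
  qed
  then show False using assms(1,2,4) by (metis vec.subspace_scale)
qed

text \<open>Three flag steps in the even part and two in the odd part, all for multiplication by even vectors.
  The last spaces are zero, so \<open>e\<^sub>3\<close> kills the even part and even vectors kill \<open>f\<^sub>1\<close>.\<close>

lemma exists_triangular_table:
  fixes s :: "(3, 2) sconsts"
  assumes "s \<in> NJS"
  shows "\<exists>a b c d r1 r2 r3 g1 g2 g3. isomorphic (triang a b c d r1 r2 r3 g1 g2 g3) s"
proof -
  have nil: "nilpotent_algebra (sc_mult s)" and sc: "supercommutative s"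
    using assms supercommutative_jordan by (auto simp: NJS_def)
  let ?E = "even_part :: (complex ^ (3 + 2)) set" and ?O = "odd_part :: (complex ^ (3 + 2)) set"
  have "vec.dim ?E = Suc 2" "\<forall>x\<in>?E. \<forall>w\<in>?E. sc_mult s x w \<in> ?E"
    by (simp_all add: dim_even_part sc_mult_even_even)
  then obtain e1 H1 where 1: "vec.subspace H1" "H1 \<subseteq> ?E" "vec.dim H1 = 2" "e1 \<in> ?E" "e1 \<notin> H1"
    "\<forall>w\<in>?E. \<exists>k. \<exists>h\<in>H1. w = k *s e1 + h" "\<forall>x\<in>?E. \<forall>w\<in>?E. sc_mult s x w \<in> H1"
    by (rule nilpotent_flag_step[OF nil subspace_even_part])
  have "vec.dim H1 = Suc 1" "\<forall>x\<in>?E. \<forall>w\<in>H1. sc_mult s x w \<in> H1"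
    using 1(2,3,7) by auto
  then obtain e2 H2 where 2: "vec.subspace H2" "H2 \<subseteq> H1" "vec.dim H2 = 1" "e2 \<in> H1" "e2 \<notin> H2"
    "\<forall>w\<in>H1. \<exists>k. \<exists>h\<in>H2. w = k *s e2 + h" "\<forall>x\<in>?E. \<forall>w\<in>H1. sc_mult s x w \<in> H2"
    by (rule nilpotent_flag_step[OF nil 1(1)])
  have "vec.dim H2 = Suc 0" "\<forall>x\<in>?E. \<forall>w\<in>H2. sc_mult s x w \<in> H2"
    using 2(2,3,7) by auto
  then obtain e3 H3 where 3: "vec.subspace H3" "H3 \<subseteq> H2" "vec.dim H3 = 0" "e3 \<in> H2" "e3 \<notin> H3"
    "\<forall>w\<in>H2. \<exists>k. \<exists>h\<in>H3. w = k *s e3 + h" "\<forall>x\<in>?E. \<forall>w\<in>H2. sc_mult s x w \<in> H3"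
    by (rule nilpotent_flag_step[OF nil 2(1)])
  have "vec.dim ?O = Suc 1" "\<forall>x\<in>?E. \<forall>w\<in>?O. sc_mult s x w \<in> ?O"
    by (simp_all add: dim_odd_part sc_mult_even_odd)
  then obtain f2 K1 where 4: "vec.subspace K1" "K1 \<subseteq> ?O" "vec.dim K1 = 1" "f2 \<in> ?O" "f2 \<notin> K1"
    "\<forall>w\<in>?O. \<exists>k. \<exists>h\<in>K1. w = k *s f2 + h" "\<forall>x\<in>?E. \<forall>w\<in>?O. sc_mult s x w \<in> K1"
    by (rule nilpotent_flag_step[OF nil subspace_odd_part])
  have "vec.dim K1 = Suc 0" "\<forall>x\<in>?E. \<forall>w\<in>K1. sc_mult s x w \<in> K1"
    using 4(2,3,7) by auto
  then obtain f1 K2 where 5: "vec.subspace K2" "K2 \<subseteq> K1" "vec.dim K2 = 0" "f1 \<in> K1" "f1 \<notin> K2"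
    "\<forall>w\<in>K1. \<exists>k. \<exists>h\<in>K2. w = k *s f1 + h" "\<forall>x\<in>?E. \<forall>w\<in>K1. sc_mult s x w \<in> K2"
    by (rule nilpotent_flag_step[OF nil 4(1)])
  have H3: "h = 0" if "h \<in> H3" for h using 3(3) that by auto
  have K2: "h = 0" if "h \<in> K2" for h using 5(3) that by auto
  have e: "e1 \<in> ?E" "e2 \<in> ?E" "e3 \<in> ?E" and f: "f1 \<in> ?O" "f2 \<in> ?O"
    using 1(2,4) 2(2,4) 3(4) 4(2,4) 5(4) by (blast dest: subsetD)+
  have inH2: "\<exists>k. w = k *s e3" if w: "w \<in> H2" for w
  proof -
    obtain k h where h: "h \<in> H3" "w = k *s e3 + h" using bspec[OF 3(6) w] by blast
    then have "w = k *s e3" using H3[OF h(1)] by simp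
    then show ?thesis by blast
  qed
  have inH1: "\<exists>k l. w = k *s e2 + l *s e3" if w: "w \<in> H1" for w
  proof -
    obtain k h where h: "h \<in> H2" "w = k *s e2 + h" using bspec[OF 2(6) w] by blast
    obtain l where "h = l *s e3" using inH2[OF h(1)] by blast
    with h(2) show ?thesis by blast
  qed
  have inE: "\<exists>j k l. w = j *s e1 + k *s e2 + l *s e3" if w: "w \<in> ?E" for w
  proof -
    obtain j h where h: "h \<in> H1" "w = j *s e1 + h" using bspec[OF 1(6) w] by blast
    obtain k l where "h = k *s e2 + l *s e3" using inH1[OF h(1)] by blast
    with h(2) have "w = j *s e1 + k *s e2 + l *s e3" by (simp add: add.assoc)
    then show ?thesis by blast
  qed
  have inK1: "\<exists>k. w = k *s f1" if w: "w \<in> K1" for w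
  proof -
    obtain k h where h: "h \<in> K2" "w = k *s f1 + h" using bspec[OF 5(6) w] by blast
    then have "w = k *s f1" using K2[OF h(1)] by simp
    then show ?thesis by blast
  qed
  obtain a b where ab: "sc_mult s e1 e1 = a *s e2 + b *s e3"
    using inH1[OF 1(7)[rule_format, OF e(1) e(1)]] by blast
  obtain c where c: "sc_mult s e1 e2 = c *s e3"
    using inH2[OF 2(7)[rule_format, OF e(1) 2(4)]] by blast
  obtain d where d: "sc_mult s e2 e2 = d *s e3"
    using inH2[OF 2(7)[rule_format, OF e(2) 2(4)]] by blast
  obtain r1 where r1: "sc_mult s e1 f2 = r1 *s f1"
    using inK1[OF 4(7)[rule_format, OF e(1) f(2)]] by blast
  obtain r2 where r2: "sc_mult s e2 f2 = r2 *s f1"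
    using inK1[OF 4(7)[rule_format, OF e(2) f(2)]] by blast
  obtain r3 where r3: "sc_mult s e3 f2 = r3 *s f1"
    using inK1[OF 4(7)[rule_format, OF e(3) f(2)]] by blast
  obtain g1 g2 g3 where g: "sc_mult s f1 f2 = g1 *s e1 + g2 *s e2 + g3 *s e3"
    using inE[OF sc_mult_odd_odd[OF f]] by blast
  have "isomorphic (triang a b c d r1 r2 r3 g1 g2 g3) s"
  proof (rule triang_of_basis[OF sc e f])
    show "sc_mult s e1 e3 = 0" "sc_mult s e2 e3 = 0" "sc_mult s e3 e3 = 0"
      by (rule H3[OF 3(7)[rule_format, OF e(1) 3(4)]] H3[OF 3(7)[rule_format, OF e(2) 3(4)]]
          H3[OF 3(7)[rule_format, OF e(3) 3(4)]])+
    show "sc_mult s e1 f1 = 0" "sc_mult s e2 f1 = 0" "sc_mult s e3 f1 = 0"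
      by (rule K2[OF 5(7)[rule_format, OF e(1) 5(4)]] K2[OF 5(7)[rule_format, OF e(2) 5(4)]]
          K2[OF 5(7)[rule_format, OF e(3) 5(4)]])+
    fix x1 x2 x3 y1 y2
    assume *: "x1 *s e1 + x2 *s e2 + x3 *s e3 + y1 *s f1 + y2 *s f2 = 0"
    let ?x = "x1 *s e1 + (x2 *s e2 + x3 *s e3)" and ?y = "y2 *s f2 + y1 *s f1"
    have "?x \<in> ?E" "?y \<in> ?O"
      by (intro vec.subspace_add vec.subspace_scale subspace_even_part subspace_odd_part e f)+
    moreover have "?x + ?y = 0" using * by (simp add: algebra_simps)
    ultimately have x: "?x = 0" and y: "?y = 0"
      by (auto simp: even_part_def odd_part_def super_vec_eq_iff)
    have "e3 \<in> H1" using 2(2) 3(4) by (rule subsetD)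
    then have "x2 *s e2 + x3 *s e3 \<in> H1"
      by (intro vec.subspace_add vec.subspace_scale 1(1) 2(4))
    then have x1: "x1 = 0" by (rule subspace_coefficient_0[OF 1(1,5) x])
    then have x': "x2 *s e2 + x3 *s e3 = 0" using x by simp
    have "x3 *s e3 \<in> H2" using 2(1) 3(4) by (rule vec.subspace_scale)
    then have x2: "x2 = 0" by (rule subspace_coefficient_0[OF 2(1,5) x'])
    then have x'': "x3 *s e3 + 0 = 0" using x' by simp
    have x3: "x3 = 0" by (rule subspace_coefficient_0[OF 3(1,5) x'' vec.subspace_0[OF 3(1)]])
    have "y1 *s f1 \<in> K1" using 4(1) 5(4) by (rule vec.subspace_scale)
    then have y2: "y2 = 0" by (rule subspace_coefficient_0[OF 4(1,5) y])
    then have y': "y1 *s f1 + 0 = 0" using y by simp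
    have y1: "y1 = 0" by (rule subspace_coefficient_0[OF 5(1,5) y' vec.subspace_0[OF 5(1)]])
    show "x1 = 0 \<and> x2 = 0 \<and> x3 = 0 \<and> y1 = 0 \<and> y2 = 0"
      using x1 x2 x3 y1 y2 by blast
  qed (fact ab c d r1 r2 r3 g)+
  then show ?thesis by blast
qed

section \<open>The equations of the triangular tables\<close>

lemma homogeneous_basis:
  "homogeneous (even_vec i)" "parity (even_vec i) = 0"
  "homogeneous (odd_vec j)" "parity (odd_vec j) = 1"
proof -
  have "even_vec i $ Inl i \<noteq> 0" by simp
  then have "even_vec i \<noteq> 0" by (metis zero_index)
  then show "homogeneous (even_vec i)" "parity (even_vec i) = 0"
    by (simp_all add: homogeneous_def parity_def)
  have j: "odd_vec j $ Inr j \<noteq> 0" by simp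
  then have "odd_vec j \<noteq> 0" by (metis zero_index)
  moreover have "odd_vec j \<notin> even_part" using j unfolding even_part_def by blast
  ultimately show "homogeneous (odd_vec j)" "parity (odd_vec j) = 1"
    by (simp_all add: homogeneous_def parity_def)
qed

text \<open>The equations say that
  \<open>\<rho>(yz) \<gamma> = \<rho>(z) y\<gamma> + \<rho>(y) z\<gamma>\<close> for even basis vectors \<open>y, z\<close> (from \<open>w = x = f\<^sub>2\<close>), that \<open>\<rho>\<close> vanishes on
  \<open>e\<^sub>1\<^sup>3\<close> and \<open>\<gamma> e\<^sub>1\<^sup>2 = 0\<close>, and that \<open>e\<^sub>1\<^sup>2 e\<^sub>1\<^sup>2 = e\<^sub>1 (e\<^sub>1 e\<^sub>1\<^sup>2)\<close>, where the right-hand side is zero. The last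
  equation \<open>\<rho>(\<gamma>) = 0\<close> comes from nilpotency.\<close>

lemma triang_Jordan_equations:
  assumes NJS: "triang a b c d r1 r2 r3 g1 g2 g3 \<in> NJS"
  shows "a * d = 0" "a * c * r3 = 0" "a * (c * g1 + d * g2) = 0"
    "(a * r2 + b * r3) * g1 = 0" "(a * r2 + b * r3) * g2 = 2 * r1 * (a * g1)"
    "(a * r2 + b * r3) * g3 = 2 * r1 * (b * g1 + c * g2)"
    "c * r3 * g1 = 0" "c * r3 * g2 = r2 * (a * g1)"
    "c * r3 * g3 = r2 * (b * g1 + c * g2) + r1 * (c * g1 + d * g2)"
    "d * r3 * g1 = 0" "d * r3 * g2 = 0" "d * r3 * g3 = 2 * r2 * (c * g1 + d * g2)"
    "r3 * (b * g1 + c * g2) = 0" "r3 * (c * g1 + d * g2) = 0"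
    "r1 * g1 + r2 * g2 + r3 * g3 = 0"
proof -
  let ?s = "triang a b c d r1 r2 r3 g1 g2 g3"
  let ?m = "sc_mult ?s"
  have jord: "?m (?m w x) (?m y z)
        + (- 1) ^ (parity x * parity y) *s ?m (?m w y) (?m x z)
        + (- 1) ^ ((parity x + parity y) * parity z) *s ?m (?m w z) (?m x y)
        - (- 1) ^ (parity w * parity x) *s ?m x (?m w (?m y z))
        - (- 1) ^ (parity y * (parity w + parity x)) *s ?m y (?m w (?m x z))
        - (- 1) ^ (parity z * (parity w + parity x + parity y)) *s ?m z (?m w (?m x y)) = 0"
    if "homogeneous x \<and> homogeneous y \<and> homogeneous z \<and> homogeneous w" for x y z w
    using NJS[unfolded NJS_def mem_Collect_eq, THEN conjunct1, unfolded jordan_superalgebra_def,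
        THEN conjunct2, THEN conjunct2] that by blast
  note ev = super32_eq_iff sc_mult_triang homogeneous_basis numeral_type_neq
  have "3 * (a * a * d) = 0"
    using jord[of "even_vec 1" "even_vec 1" "even_vec 1" "even_vec 1"]
    by (simp add: ev algebra_simps)
  then show "a * d = 0" by simp
  show "a * c * r3 = 0"
    using jord[of "even_vec 1" "even_vec 1" "odd_vec 2" "even_vec 1"]
    by (simp add: ev algebra_simps)
  have "a * (c * g1) + a * (d * g2) = 0"
    using jord[of "odd_vec 2" "even_vec 1" "even_vec 1" "odd_vec 1"]
    by (simp add: ev algebra_simps)
  then show "a * (c * g1 + d * g2) = 0" by (simp add: algebra_simps)
  have "(g1 = 0 \<or> - (r2 * a) = r3 * b) \<and> g2 * (- (r2 * a) - r3 * b) + 2 * (a * (g1 * r1)) = 0 \<and>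
      g3 * (- (r2 * a) - r3 * b) = - (2 * (b * (g1 * r1))) - 2 * (c * (g2 * r1))"
    using jord[of "odd_vec 2" "even_vec 1" "even_vec 1" "odd_vec 2"] by (simp add: ev)
  then show "(a * r2 + b * r3) * g1 = 0" "(a * r2 + b * r3) * g2 = 2 * r1 * (a * g1)"
    "(a * r2 + b * r3) * g3 = 2 * r1 * (b * g1 + c * g2)"
    by (elim conjE disjE; algebra)+
  have "(g1 = 0 \<or> r3 = 0 \<or> c = 0) \<and> a * (g1 * r2) = g2 * (r3 * c) \<and>
      - (g3 * (r3 * c)) - (- (b * (g1 * r2)) - c * (g2 * r2)) = - (c * (g1 * r1)) - d * (g2 * r1)"
    using jord[of "odd_vec 2" "even_vec 1" "even_vec 2" "odd_vec 2"] by (simp add: ev)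
  then show "c * r3 * g1 = 0" "c * r3 * g2 = r2 * (a * g1)"
    "c * r3 * g3 = r2 * (b * g1 + c * g2) + r1 * (c * g1 + d * g2)"
    by (elim conjE disjE; algebra)+
  have "(g1 = 0 \<or> r3 = 0 \<or> d = 0) \<and> (g2 = 0 \<or> r3 = 0 \<or> d = 0) \<and>
      - (g3 * (r3 * d)) = - (2 * (c * (g1 * r2))) - 2 * (d * (g2 * r2))"
    using jord[of "odd_vec 2" "even_vec 2" "even_vec 2" "odd_vec 2"] by (simp add: ev)
  then show "d * r3 * g1 = 0" "d * r3 * g2 = 0" "d * r3 * g3 = 2 * r2 * (c * g1 + d * g2)"
    by (elim conjE disjE; algebra)+
  have "c * (g2 * r3) + b * (g1 * r3) = 0"
    using jord[of "odd_vec 2" "even_vec 1" "even_vec 3" "odd_vec 2"] by (simp add: ev)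
  then show "r3 * (b * g1 + c * g2) = 0" by algebra
  have "d * (g2 * r3) + c * (g1 * r3) = 0"
    using jord[of "odd_vec 2" "even_vec 2" "even_vec 3" "odd_vec 2"] by (simp add: ev)
  then show "r3 * (c * g1 + d * g2) = 0" by algebra
  show "r1 * g1 + r2 * g2 + r3 * g3 = 0"
  proof (rule ccontr)
    \<comment> \<open>Multiplication by \<open>f\<^sub>2\<close> sends \<open>f\<^sub>1\<close> to \<open>- \<gamma>\<close> and \<open>- \<gamma>\<close> to \<open>- \<rho>(\<gamma>) f\<^sub>1\<close>.\<close>
    define q where "q = r1 * g1 + r2 * g2 + r3 * g3"
    assume "r1 * g1 + r2 * g2 + r3 * g3 \<noteq> 0"
    then have q: "q \<noteq> 0" by (simp add: q_def)
    let ?f1 = "odd_vec 1 :: complex ^ (3 + 2)" and ?f2 = "odd_vec 2 :: complex ^ (3 + 2)"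
    let ?g = "?m ?f2 ?f1"
    have "?m ?f2 ?g = (- q) *s ?f1"
      by (simp add: ev q_def algebra_simps)
    then have "?f1 = (- 1 / q) *s ?m ?f2 ?g"
      using q by (simp only: vector_smult_assoc) simp
    moreover have "(- 1 / q) *s ?m ?f2 ?g \<in> vec.span {?m x w | x w. w \<in> {?f1, ?g}}"
      by (intro vec.span_scale vec.span_base) blast
    moreover have "?g \<in> vec.span {?m x w | x w. w \<in> {?f1, ?g}}"
      by (intro vec.span_base) blast
    ultimately have "{?f1, ?g} \<subseteq> vec.span {?m x w | x w. w \<in> {?f1, ?g}}" by auto
    moreover have "nilpotent_algebra ?m" using NJS by (simp add: NJS_def)
    ultimately have "{?f1, ?g} \<subseteq> {0}" by (rule nilpotent_no_fixed_set[rotated])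
    then have "?f1 $ Inr 1 = 0" by simp
    then show False by simp
  qed
qed

section \<open>Normal forms\<close>

text \<open>The first two families carry genericity conditions and lie in single orbits; the other
  four are linear families, degenerate members included. The names refer to the algebra whose orbit
  closure contains the family.\<close>

inductive normal_table :: "(3, 2) sconsts \<Rightarrow> bool" where
  n27: "a \<noteq> 0 \<Longrightarrow> c \<noteq> 0 \<Longrightarrow> r2 \<noteq> 0 \<Longrightarrow> normal_table (triang a b c 0 r1 r2 0 0 0 0)"
| n25: "a \<noteq> 0 \<Longrightarrow> c \<noteq> 0 \<Longrightarrow> g2 \<noteq> 0 \<Longrightarrow> normal_table (triang a b c 0 0 0 0 0 g2 g3)"
| n29: "normal_table (triang a b c 0 r1 0 0 0 0 g3)"
| n19: "normal_table (triang 0 b c d r1 r2 r3 0 0 0)"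
| n18: "normal_table (triang 0 b c d 0 0 0 g1 g2 g3)"
| n23: "normal_table (triang 0 b c d r1 r2 0 0 0 g3)"

text \<open>With \<open>a = 0\<close> the product of even vectors is \<open>\<beta>(x, y) e\<^sub>3\<close>. If \<open>\<rho>(e\<^sub>3) \<noteq> 0\<close> and \<open>\<gamma> \<noteq> 0\<close>, the equations force \<open>\<beta> = 0\<close>,
  and \<open>\<gamma>\<close> can take the place of \<open>e\<^sub>3\<close>. If \<open>\<rho>(e\<^sub>3) = 0\<close> and \<open>\<rho> \<noteq> 0\<close>, they force \<open>\<gamma>\<close> into the radical of \<open>\<beta>\<close>; then
  either \<open>\<gamma>\<close> is a multiple of \<open>e\<^sub>3\<close>, or \<open>\<beta>\<close> has rank at most 1 and the basis (\<open>e\<^sub>i\<close>, \<open>e\<^sub>3\<close>, \<open>\<gamma>\<close>) for a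
  suitable \<open>i\<close> leads to the family of \<^const>\<open>J29\<close>.\<close>

lemma normal_form_even_cubes_0:
  assumes NJS: "triang 0 b c d r1 r2 r3 g1 g2 g3 \<in> NJS"
  shows "\<exists>u. normal_table u \<and> isomorphic u (triang 0 b c d r1 r2 r3 g1 g2 g3)"
proof -
  let ?s = "triang 0 b c d r1 r2 r3 g1 g2 g3"
  note eqs = triang_Jordan_equations[OF NJS]
  show ?thesis
  proof (cases "r3 = 0")
    case False
    show ?thesis
    proof (cases "g1 = 0 \<and> g2 = 0 \<and> g3 = 0")
      case True
      then show ?thesis using n19[of b c d r1 r2 r3] isomorphic_refl by blast
    next
      case g: False
      have bg: "b * g1 + c * g2 = 0" "c * g1 + d * g2 = 0" using eqs(13,14) False by simp_all
      have "b = 0" using eqs(4-6) bg g False by auto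
      moreover have "c = 0" using eqs(7-9) bg g False by auto
      moreover have "d = 0" using eqs(10-12) bg g False by auto
      ultimately have s: "?s = triang 0 0 0 0 r1 r2 r3 g1 g2 g3" by simp
      have "g1 \<noteq> 0 \<or> g2 \<noteq> 0" using eqs(15) g False by auto
      then consider "g1 \<noteq> 0" | "g2 \<noteq> 0" by blast
      then show ?thesis
      proof cases
        case 1
        have "isomorphic (triang 0 0 0 0 r2 r3 0 0 0 1) (triang 0 0 0 0 r1 r2 r3 g1 g2 g3)"
          by (rule triang_change_basis[where ?x1.0 = 0 and ?x2.0 = 1 and ?x3.0 = 0 and
                ?y1.0 = 0 and ?y2.0 = 0 and ?y3.0 = 1 and
                ?z1.0 = g1 and ?z2.0 = g2 and ?z3.0 = g3 and l = 1 and m = 1])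
            (use 1 eqs(15) in auto)
        then show ?thesis unfolding s using n23 by blast
      next
        case 2
        have "isomorphic (triang 0 0 0 0 r1 r3 0 0 0 1) (triang 0 0 0 0 r1 r2 r3 g1 g2 g3)"
          by (rule triang_change_basis[where ?x1.0 = 1 and ?x2.0 = 0 and ?x3.0 = 0 and
                ?y1.0 = 0 and ?y2.0 = 0 and ?y3.0 = 1 and
                ?z1.0 = g1 and ?z2.0 = g2 and ?z3.0 = g3 and l = 1 and m = 1])
            (use 2 eqs(15) in auto)
        then show ?thesis unfolding s using n23 by blast
      qed
    qed
  next
    case r3: True
    show ?thesis
    proof (cases "r1 = 0 \<and> r2 = 0")
      case True
      then show ?thesis unfolding r3 using n18[of b c d g1 g2 g3] isomorphic_refl by auto
    next
      case r: False
      have bg: "b * g1 + c * g2 = 0" "c * g1 + d * g2 = 0" using eqs(6,9,12) r r3 by auto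
      then have gg: "b * g1 * g1 + 2 * c * g1 * g2 + d * g2 * g2 = 0" by algebra
      consider "g1 = 0" "g2 = 0" | "g1 \<noteq> 0" | "g2 \<noteq> 0" by blast
      then show ?thesis
      proof cases
        case 1
        then show ?thesis unfolding r3 using n23[of b c d r1 r2 g3] isomorphic_refl by blast
      next
        case 2
        have "isomorphic (triang d 0 0 0 r2 0 0 0 0 1) (triang 0 b c d r1 r2 0 g1 g2 g3)"
          by (rule triang_change_basis[where ?x1.0 = 0 and ?x2.0 = 1 and ?x3.0 = 0 and
                ?y1.0 = 0 and ?y2.0 = 0 and ?y3.0 = 1 and
                ?z1.0 = g1 and ?z2.0 = g2 and ?z3.0 = g3 and l = 1 and m = 1])
            (use 2 eqs(15) r3 bg gg in auto)
        then show ?thesis unfolding r3 using n29 by blast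
      next
        case 3
        have "isomorphic (triang b 0 0 0 r1 0 0 0 0 1) (triang 0 b c d r1 r2 0 g1 g2 g3)"
          by (rule triang_change_basis[where ?x1.0 = 1 and ?x2.0 = 0 and ?x3.0 = 0 and
                ?y1.0 = 0 and ?y2.0 = 0 and ?y3.0 = 1 and
                ?z1.0 = g1 and ?z2.0 = g2 and ?z3.0 = g3 and l = 1 and m = 1])
            (use 3 eqs(15) r3 bg gg in auto)
        then show ?thesis unfolding r3 using n29 by blast
      qed
    qed
  qed
qed

lemma normal_form:
  assumes "s \<in> NJS"
  shows "\<exists>u. normal_table u \<and> isomorphic u s"
proof -
  obtain a b c d r1 r2 r3 g1 g2 g3 where iso: "isomorphic (triang a b c d r1 r2 r3 g1 g2 g3) s"
    using exists_triangular_table[OF assms] by blast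
  let ?t = "triang a b c d r1 r2 r3 g1 g2 g3"
  have NJS: "?t \<in> NJS" by (rule NJS_isomorphic[OF iso assms])
  note eqs = triang_Jordan_equations[OF NJS]
  have "\<exists>u. normal_table u \<and> isomorphic u ?t"
  proof (cases "a = 0")
    case True
    then show ?thesis using normal_form_even_cubes_0 NJS by blast
  next
    case a: False
    then have d: "d = 0" using eqs(1) by simp
    show ?thesis
    proof (cases "c = 0")
      case c: True
      \<comment> \<open>The only nonzero even product is \<open>e\<^sub>1\<^sup>2\<close>; in the basis \<open>e\<^sub>1, e\<^sub>3, e\<^sub>1\<^sup>2\<close> it is the last basis vector.\<close>
      let ?u = "triang 0 1 0 0 r1 r3 (a * r2 + b * r3) g1 (g3 - b * g2 / a) (g2 / a)"
      have iso': "isomorphic ?u (triang a b 0 0 r1 r2 r3 g1 g2 g3)"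
        by (rule triang_change_basis[where ?x1.0 = 1 and ?x2.0 = 0 and ?x3.0 = 0 and
                ?y1.0 = 0 and ?y2.0 = 0 and ?y3.0 = 1 and
                ?z1.0 = 0 and ?z2.0 = a and ?z3.0 = b and l = 1 and m = 1])
            (use a in \<open>auto simp: field_simps\<close>)
      then have "?u \<in> NJS" using NJS_isomorphic NJS c d by blast
      then show ?thesis
        using normal_form_even_cubes_0 isomorphic_trans[OF _ iso'] c d by blast
    next
      case c: False
      have r3: "r3 = 0" and g1: "g1 = 0" using eqs(2,3) a c d by auto
      have r2g2: "r2 * g2 = 0" using eqs(15) r3 g1 by simp
      show ?thesis
      proof (cases "r2 = 0")
        case False
        then have "g2 = 0" "g3 = 0" using r2g2 eqs(6) a r3 g1 by auto
        then show ?thesis using n27[OF a c False] isomorphic_refl d r3 g1 by blast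
      next
        case r2: True
        have r1g2: "r1 * g2 = 0" using eqs(6) a c r2 r3 g1 by auto
        show ?thesis
        proof (cases "g2 = 0")
          case True
          then show ?thesis using n29[of a b c r1 g3] isomorphic_refl d r2 r3 g1 by blast
        next
          case False
          then show ?thesis using n25[OF a c False] isomorphic_refl d r2 r3 g1 r1g2 by auto
        qed
      qed
    qed
  qed
  then show ?thesis using isomorphic_trans[OF _ iso] by blast
qed

definition six :: "(3, 2) sconsts set" where
  "six = {J18, J19, J23, J25, J27, J29}"

lemma normal_table_in_closure: "normal_table u \<Longrightarrow> \<exists>J\<in>six. u \<in> zariski closure_of orbit J"
proof (induction rule: normal_table.induct)
  case (n27 a c r2 b r1)
  then have "triang a b c 0 r1 r2 0 0 0 0 \<in> orbit J27"
    by (simp add: orbit_iff_isomorphic isomorphic_J27)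
  moreover have "orbit J27 \<subseteq> zariski closure_of orbit J27" by (simp add: closure_of_subset)
  ultimately show ?case by (auto simp: six_def)
next
  case (n25 a c g2 b g3)
  then have "triang a b c 0 0 0 0 0 g2 g3 \<in> orbit J25"
    by (simp add: orbit_iff_isomorphic isomorphic_J25)
  moreover have "orbit J25 \<subseteq> zariski closure_of orbit J25" by (simp add: closure_of_subset)
  ultimately show ?case by (auto simp: six_def)
next
  case n29
  then show ?case using triang_in_closure_29 by (auto simp: six_def)
next
  case n19
  then show ?case using triang_in_closure_19 by (auto simp: six_def)
next
  case n18
  then show ?case using triang_in_closure_18 by (auto simp: six_def)
next
  case n23
  then show ?case using triang_in_closure_23 by (auto simp: six_def)
qed

lemma jordan_nilpotent_six:
  "\<forall>J\<in>six. jordan_superalgebra (sc_mult J) \<and> alg_power (sc_mult J) 5 = {0}"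
  by (simp only: six_def ball_simps jordan_J alg_power_J simp_thms)

lemma NJS_eq_Union_closures: "NJS = (\<Union>J\<in>six. zariski closure_of orbit J)"
proof (intro equalityI subsetI)
  fix s :: "(3, 2) sconsts" assume "s \<in> NJS"
  then obtain u where u: "normal_table u" "isomorphic u s" using normal_form by blast
  then obtain J where "J \<in> six" "u \<in> zariski closure_of orbit J" using normal_table_in_closure by blast
  then show "s \<in> (\<Union>J\<in>six. zariski closure_of orbit J)"
    using closure_orbit_isomorphic[OF _ u(2)] by blast
next
  fix s assume "s \<in> (\<Union>J\<in>six. zariski closure_of orbit J)"
  then obtain J where J: "J \<in> six" "s \<in> zariski closure_of orbit J" by blast
  have "jordan_superalgebra (sc_mult J)" "alg_power (sc_mult J) 5 = {0}"
    using bspec[OF jordan_nilpotent_six J(1)] by (rule conjunct1, rule conjunct2)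
  then have "zariski closure_of orbit J \<subseteq> NJS"
    by (intro closure_orbit_subset_NJS[of J 5]) simp_all
  then show "s \<in> NJS" using J(2) by (rule subsetD)
qed

lemma six_subset_NJS: "J \<in> six \<Longrightarrow> J \<in> NJS"
  using closure_of_subset[of "orbit J" zariski] orbit_refl[of J]
  unfolding NJS_eq_Union_closures by auto

section \<open>Open invariants\<close>

text \<open>Linear forms extract scalars such as \<open>\<rho>(x)\<close> from products without reference to a basis, which makes
  the rank conditions below visibly invariant under isomorphism.\<close>

definition functional :: "(complex ^ ('m::finite + 'n::finite) \<Rightarrow> complex) \<Rightarrow> bool" where
  "functional \<phi> \<longleftrightarrow> Vector_Spaces.linear (*s) (*) \<phi>"

lemma functional_scale: "functional \<phi> \<Longrightarrow> \<phi> (k *s v) = k * \<phi> v"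
  and functional_add: "functional \<phi> \<Longrightarrow> \<phi> (v + w) = \<phi> v + \<phi> w"
  unfolding functional_def by (simp_all add: Vector_Spaces.linear_iff)

lemma functional_0: "functional \<phi> \<Longrightarrow> \<phi> 0 = 0"
  using functional_scale[of \<phi> 0 0] by simp

lemma functionalI:
  assumes "\<And>x y. \<phi> (x + y) = \<phi> x + \<phi> y" "\<And>c x. \<phi> (c *s x) = c * \<phi> x"
  shows "functional \<phi>"
proof -
  have "vector_space ((*) :: complex \<Rightarrow> complex \<Rightarrow> complex)"
    by unfold_locales (simp_all add: algebra_simps)
  then show ?thesis
    using assms by (simp add: functional_def Vector_Spaces.linear_iff vec.vector_space_axioms)
qed

definition even_cubes :: "('m::finite, 'n::finite) sconsts \<Rightarrow> bool" where
  "even_cubes s \<longleftrightarrow> (\<exists>x y z. x \<in> even_part \<and> y \<in> even_part \<and> z \<in> even_part \<and>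
     sc_mult s x (sc_mult s y z) \<noteq> 0)"

definition even_acts :: "('m::finite, 'n::finite) sconsts \<Rightarrow> bool" where
  "even_acts s \<longleftrightarrow> (\<exists>x f. x \<in> even_part \<and> f \<in> odd_part \<and> sc_mult s x f \<noteq> 0)"

definition even_products_act :: "('m::finite, 'n::finite) sconsts \<Rightarrow> bool" where
  "even_products_act s \<longleftrightarrow> (\<exists>x y f. x \<in> even_part \<and> y \<in> even_part \<and> f \<in> odd_part \<and>
     sc_mult s (sc_mult s x y) f \<noteq> 0)"

definition odd_products :: "('m::finite, 'n::finite) sconsts \<Rightarrow> bool" where
  "odd_products s \<longleftrightarrow> (\<exists>f g. f \<in> odd_part \<and> g \<in> odd_part \<and> sc_mult s f g \<noteq> 0)"

definition even_times_odd_products :: "('m::finite, 'n::finite) sconsts \<Rightarrow> bool" where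
  "even_times_odd_products s \<longleftrightarrow> (\<exists>x f g. x \<in> even_part \<and> f \<in> odd_part \<and> g \<in> odd_part \<and>
     sc_mult s x (sc_mult s f g) \<noteq> 0)"

definition odd_product_squares :: "('m::finite, 'n::finite) sconsts \<Rightarrow> bool" where
  "odd_product_squares s \<longleftrightarrow> (\<exists>f g. f \<in> odd_part \<and> g \<in> odd_part \<and>
     sc_mult s (sc_mult s f g) (sc_mult s f g) \<noteq> 0)"

text \<open>A nonzero 2 by 2 minor of the symmetric form \<open>\<phi>(x y)\<close>.\<close>

definition even_product_rank_2 :: "('m::finite, 'n::finite) sconsts \<Rightarrow> bool" where
  "even_product_rank_2 s \<longleftrightarrow> (\<exists>\<phi> x y z w. functional \<phi> \<and>
     x \<in> even_part \<and> y \<in> even_part \<and> z \<in> even_part \<and> w \<in> even_part \<and>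
     \<phi> (sc_mult s x z) * \<phi> (sc_mult s y w) - \<phi> (sc_mult s x w) * \<phi> (sc_mult s y z) \<noteq> 0)"

definition even_product_action_rank_2 :: "('m::finite, 'n::finite) sconsts \<Rightarrow> bool" where
  "even_product_action_rank_2 s \<longleftrightarrow> (\<exists>\<phi> f x y z w. functional \<phi> \<and> f \<in> odd_part \<and>
     x \<in> even_part \<and> y \<in> even_part \<and> z \<in> even_part \<and> w \<in> even_part \<and>
     \<phi> (sc_mult s (sc_mult s x z) f) * \<phi> (sc_mult s (sc_mult s y w) f)
     - \<phi> (sc_mult s (sc_mult s x w) f) * \<phi> (sc_mult s (sc_mult s y z) f) \<noteq> 0)"

text \<open>The vector that is squared is \<open>\<rho>(y) x - \<rho>(x) y\<close> for the linear form \<open>\<rho>(x) = \<phi>(x f)\<close>. These vectors lie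
  in the kernel of \<open>\<rho>\<close>, and they depend polynomially on the structure constants, which a vector merely
  chosen in the kernel would not.\<close>

definition action_kernel_squares :: "('m::finite, 'n::finite) sconsts \<Rightarrow> bool" where
  "action_kernel_squares s \<longleftrightarrow> (\<exists>\<phi> f x y. functional \<phi> \<and> f \<in> odd_part \<and> x \<in> even_part \<and> y \<in> even_part \<and>
     sc_mult s (\<phi> (sc_mult s y f) *s x - \<phi> (sc_mult s x f) *s y)
       (\<phi> (sc_mult s y f) *s x - \<phi> (sc_mult s x f) *s y) \<noteq> 0)"

definition open_condition :: "(('m::finite, 'n::finite) sconsts \<Rightarrow> bool) \<Rightarrow> bool" where
  "open_condition U \<longleftrightarrow> openin zariski {s. U s} \<and> (\<forall>s t. isomorphic s t \<longrightarrow> U s \<longrightarrow> U t)"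

lemma open_condition_conj:
  assumes "open_condition U" "open_condition V"
  shows "open_condition (\<lambda>s. U s \<and> V s)"
  unfolding open_condition_def
proof (intro conjI allI impI)
  have "openin zariski ({s. U s} \<inter> {s. V s})"
    by (rule openin_Int) (use assms in \<open>simp_all add: open_condition_def\<close>)
  then show "openin zariski {s. U s \<and> V s}" by (simp only: Collect_conj_eq)
  show "U t" "V t" if "isomorphic s t" "U s \<and> V s" for s t
    using assms that unfolding open_condition_def by blast+
qed

lemma open_conditionI:
  assumes "zariski_closed {s. \<not> U s}" "\<And>s t. isomorphic s t \<Longrightarrow> U s \<Longrightarrow> U t"
  shows "open_condition U"
  unfolding open_condition_def
proof (intro conjI allI impI)
  show "openin zariski {s. U s}"
    unfolding openin_zariski using assms(1) by (simp only: Collect_neg_eq)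
  show "U t" if "isomorphic s t" "U s" for s t
    by (rule assms(2)[OF that])
qed

text \<open>Everything about an isomorphism that the invariance proofs use.\<close>

definition transports :: "(complex ^ ('m::finite + 'n::finite) \<Rightarrow> complex ^ ('m + 'n)) \<Rightarrow>
    ('m, 'n) sconsts \<Rightarrow> ('m, 'n) sconsts \<Rightarrow> bool" where
  "transports T s t \<longleftrightarrow> (\<forall>x\<in>even_part. T x \<in> even_part) \<and> (\<forall>x\<in>odd_part. T x \<in> odd_part) \<and>
     (\<forall>x y. sc_mult t (T x) (T y) = T (sc_mult s x y)) \<and> (\<forall>x. T x = 0 \<longleftrightarrow> x = 0) \<and>
     (\<forall>k l x y. k *s T x - l *s T y = T (k *s x - l *s y)) \<and>
     (\<forall>\<phi>. functional \<phi> \<longrightarrow> (\<exists>\<psi>. functional \<psi> \<and> (\<forall>x. \<psi> (T x) = \<phi> x)))"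

lemma isomorphic_transports:
  assumes "isomorphic s t"
  obtains T where "transports T s t"
proof -
  obtain T where T: "vlinear T" "bij T" "\<forall>x\<in>even_part. T x \<in> even_part"
    "\<forall>x\<in>odd_part. T x \<in> odd_part" "\<forall>x y. T (sc_mult s x y) = sc_mult t (T x) (T y)"
    by (rule isomorphicE[OF assms])
  have inj: "inj T" and surj: "surj T" using T(2) by (simp_all add: bij_def)
  have zero: "\<forall>x. T x = 0 \<longleftrightarrow> x = 0"
    using inj vec.linear_inj_iff_eq_0[OF T(1)] vlinear_0[OF T(1)] by blast
  have functionals: "\<exists>\<psi>. functional \<psi> \<and> (\<forall>x. \<psi> (T x) = \<phi> x)" if \<phi>: "functional \<phi>" for \<phi>
  proof (intro exI[of _ "\<lambda>y. \<phi> (inv T y)"] conjI allI)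
    have add: "inv T (x + y) = inv T x + inv T y" for x y
      by (rule injD[OF inj]) (simp add: vlinear_add[OF T(1)] surj_f_inv_f[OF surj])
    have scale: "inv T (c *s x) = c *s inv T x" for c x
      by (rule injD[OF inj]) (simp add: vlinear_scale[OF T(1)] surj_f_inv_f[OF surj])
    show "functional (\<lambda>y. \<phi> (inv T y))"
      by (rule functionalI) (simp_all add: add scale functional_add[OF \<phi>] functional_scale[OF \<phi>])
    show "\<phi> (inv T (T x)) = \<phi> x" for x by (simp add: inv_f_f[OF inj])
  qed
  have "transports T s t"
    unfolding transports_def
    using T(3-5) zero functionals vlinear_scale[OF T(1)] vec.linear_diff[OF T(1)] by simp
  then show thesis by (rule that)
qed

lemmas zariski_closed_intros = zariski_closed_Collect_all zariski_closed_Collect_imp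
  zariski_closed_poly_vec_eq_0 zariski_closed_Collect_eq_0 poly_vec_sc_mult poly_vec_const
  poly_vec_diff poly_vec_scale poly_fun_diff poly_fun.mult

lemma open_even_cubes: "open_condition even_cubes"
proof (rule open_conditionI)
  show "zariski_closed {s. \<not> even_cubes s}"
    unfolding even_cubes_def not_ex de_Morgan_conj not_not imp_conv_disj[symmetric]
    by (intro zariski_closed_intros)
  fix s t assume "isomorphic s t" and "even_cubes s"
  then obtain x y z where x: "x \<in> even_part" "y \<in> even_part" "z \<in> even_part"
    "sc_mult s x (sc_mult s y z) \<noteq> 0" by (auto simp: even_cubes_def)
  obtain T where T: "transports T s t"
    by (rule isomorphic_transports[OF \<open>isomorphic s t\<close>])
  show "even_cubes t"
    unfolding even_cubes_def using x T[unfolded transports_def]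
    by (intro exI[of _ "T x"] exI[of _ "T y"] exI[of _ "T z"]) simp
qed

lemma open_even_acts: "open_condition even_acts"
proof (rule open_conditionI)
  show "zariski_closed {s. \<not> even_acts s}"
    unfolding even_acts_def not_ex de_Morgan_conj not_not imp_conv_disj[symmetric]
    by (intro zariski_closed_intros)
  fix s t assume "isomorphic s t" and "even_acts s"
  then obtain x f where x: "x \<in> even_part" "f \<in> odd_part" "sc_mult s x f \<noteq> 0"
    by (auto simp: even_acts_def)
  obtain T where T: "transports T s t"
    by (rule isomorphic_transports[OF \<open>isomorphic s t\<close>])
  show "even_acts t"
    unfolding even_acts_def using x T[unfolded transports_def]
    by (intro exI[of _ "T x"] exI[of _ "T f"]) simp
qed

lemma open_even_products_act: "open_condition even_products_act"
proof (rule open_conditionI)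
  show "zariski_closed {s. \<not> even_products_act s}"
    unfolding even_products_act_def not_ex de_Morgan_conj not_not imp_conv_disj[symmetric]
    by (intro zariski_closed_intros)
  fix s t assume "isomorphic s t" and "even_products_act s"
  then obtain x y f where x: "x \<in> even_part" "y \<in> even_part" "f \<in> odd_part"
    "sc_mult s (sc_mult s x y) f \<noteq> 0" by (auto simp: even_products_act_def)
  obtain T where T: "transports T s t"
    by (rule isomorphic_transports[OF \<open>isomorphic s t\<close>])
  show "even_products_act t"
    unfolding even_products_act_def using x T[unfolded transports_def]
    by (intro exI[of _ "T x"] exI[of _ "T y"] exI[of _ "T f"]) simp
qed

lemma open_odd_products: "open_condition odd_products"
proof (rule open_conditionI)
  show "zariski_closed {s. \<not> odd_products s}"
    unfolding odd_products_def not_ex de_Morgan_conj not_not imp_conv_disj[symmetric]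
    by (intro zariski_closed_intros)
  fix s t assume "isomorphic s t" and "odd_products s"
  then obtain f g where x: "f \<in> odd_part" "g \<in> odd_part" "sc_mult s f g \<noteq> 0"
    by (auto simp: odd_products_def)
  obtain T where T: "transports T s t"
    by (rule isomorphic_transports[OF \<open>isomorphic s t\<close>])
  show "odd_products t"
    unfolding odd_products_def using x T[unfolded transports_def]
    by (intro exI[of _ "T f"] exI[of _ "T g"]) simp
qed

lemma open_even_times_odd_products: "open_condition even_times_odd_products"
proof (rule open_conditionI)
  show "zariski_closed {s. \<not> even_times_odd_products s}"
    unfolding even_times_odd_products_def not_ex de_Morgan_conj not_not imp_conv_disj[symmetric]
    by (intro zariski_closed_intros)
  fix s t assume "isomorphic s t" and "even_times_odd_products s"
  then obtain x f g where x: "x \<in> even_part" "f \<in> odd_part" "g \<in> odd_part"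
    "sc_mult s x (sc_mult s f g) \<noteq> 0" by (auto simp: even_times_odd_products_def)
  obtain T where T: "transports T s t"
    by (rule isomorphic_transports[OF \<open>isomorphic s t\<close>])
  show "even_times_odd_products t"
    unfolding even_times_odd_products_def using x T[unfolded transports_def]
    by (intro exI[of _ "T x"] exI[of _ "T f"] exI[of _ "T g"]) simp
qed

lemma open_odd_product_squares: "open_condition odd_product_squares"
proof (rule open_conditionI)
  show "zariski_closed {s. \<not> odd_product_squares s}"
    unfolding odd_product_squares_def not_ex de_Morgan_conj not_not imp_conv_disj[symmetric]
    by (intro zariski_closed_intros)
  fix s t assume "isomorphic s t" and "odd_product_squares s"
  then obtain f g where x: "f \<in> odd_part" "g \<in> odd_part" "sc_mult s (sc_mult s f g) (sc_mult s f g) \<noteq> 0"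
    by (auto simp: odd_product_squares_def)
  obtain T where T: "transports T s t"
    by (rule isomorphic_transports[OF \<open>isomorphic s t\<close>])
  show "odd_product_squares t"
    unfolding odd_product_squares_def using x T[unfolded transports_def]
    by (intro exI[of _ "T f"] exI[of _ "T g"]) simp
qed

lemma poly_fun_functional: "functional \<phi> \<Longrightarrow> poly_vec F \<Longrightarrow> poly_fun (\<lambda>s. \<phi> (F s))"
  unfolding functional_def by (rule poly_fun_linear_form)

lemma open_even_product_rank_2: "open_condition even_product_rank_2"
proof (rule open_conditionI)
  show "zariski_closed {s. \<not> even_product_rank_2 s}"
    unfolding even_product_rank_2_def not_ex de_Morgan_conj not_not imp_conv_disj[symmetric]
    by (intro zariski_closed_intros poly_fun_functional)
  fix s t assume "isomorphic s t" and "even_product_rank_2 s"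
  then obtain \<phi> x y z w where x: "functional \<phi>" "x \<in> even_part" "y \<in> even_part" "z \<in> even_part" "w \<in> even_part"
     "\<phi> (sc_mult s x z) * \<phi> (sc_mult s y w) - \<phi> (sc_mult s x w) * \<phi> (sc_mult s y z) \<noteq> 0"
    unfolding even_product_rank_2_def by blast
  obtain T where T: "transports T s t"
    by (rule isomorphic_transports[OF \<open>isomorphic s t\<close>])
  obtain \<psi> where \<psi>: "functional \<psi>" "\<forall>x. \<psi> (T x) = \<phi> x"
    using T x(1) unfolding transports_def by blast
  show "even_product_rank_2 t"
    unfolding even_product_rank_2_def using x T[unfolded transports_def] \<psi>
    by (intro exI[of _ \<psi>] exI[of _ "T x"] exI[of _ "T y"] exI[of _ "T z"] exI[of _ "T w"]) simp
qed

lemma open_even_product_action_rank_2: "open_condition even_product_action_rank_2"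
proof (rule open_conditionI)
  show "zariski_closed {s. \<not> even_product_action_rank_2 s}"
    unfolding even_product_action_rank_2_def not_ex de_Morgan_conj not_not imp_conv_disj[symmetric]
    by (intro zariski_closed_intros poly_fun_functional)
  fix s t assume "isomorphic s t" and "even_product_action_rank_2 s"
  then obtain \<phi> f x y z w where x: "functional \<phi>" "f \<in> odd_part"
     "x \<in> even_part" "y \<in> even_part" "z \<in> even_part" "w \<in> even_part"
     "\<phi> (sc_mult s (sc_mult s x z) f) * \<phi> (sc_mult s (sc_mult s y w) f)
     - \<phi> (sc_mult s (sc_mult s x w) f) * \<phi> (sc_mult s (sc_mult s y z) f) \<noteq> 0"
    unfolding even_product_action_rank_2_def by blast
  obtain T where T: "transports T s t"
    by (rule isomorphic_transports[OF \<open>isomorphic s t\<close>])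
  obtain \<psi> where \<psi>: "functional \<psi>" "\<forall>x. \<psi> (T x) = \<phi> x"
    using T x(1) unfolding transports_def by blast
  show "even_product_action_rank_2 t"
    unfolding even_product_action_rank_2_def using x T[unfolded transports_def] \<psi>
    by (intro exI[of _ \<psi>] exI[of _ "T f"] exI[of _ "T x"] exI[of _ "T y"] exI[of _ "T z"] exI[of _ "T w"]) simp
qed

lemma open_action_kernel_squares: "open_condition action_kernel_squares"
proof (rule open_conditionI)
  show "zariski_closed {s. \<not> action_kernel_squares s}"
    unfolding action_kernel_squares_def not_ex de_Morgan_conj not_not imp_conv_disj[symmetric]
    by (intro zariski_closed_intros poly_fun_functional)
  fix s t assume "isomorphic s t" and "action_kernel_squares s"
  then obtain \<phi> f x y where x: "functional \<phi>" "f \<in> odd_part" "x \<in> even_part" "y \<in> even_part"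
     "sc_mult s (\<phi> (sc_mult s y f) *s x - \<phi> (sc_mult s x f) *s y)
       (\<phi> (sc_mult s y f) *s x - \<phi> (sc_mult s x f) *s y) \<noteq> 0"
    unfolding action_kernel_squares_def by blast
  obtain T where T: "transports T s t"
    by (rule isomorphic_transports[OF \<open>isomorphic s t\<close>])
  obtain \<psi> where \<psi>: "functional \<psi>" "\<forall>x. \<psi> (T x) = \<phi> x"
    using T x(1) unfolding transports_def by blast
  show "action_kernel_squares t"
    unfolding action_kernel_squares_def using x T[unfolded transports_def] \<psi>
    by (intro exI[of _ \<psi>] exI[of _ "T f"] exI[of _ "T x"] exI[of _ "T y"]) simp
qed

section \<open>The open orbits\<close>

lemma triang_even_even:
  assumes "x \<in> even_part" "y \<in> even_part"
  shows "sc_mult (triang a b c d r1 r2 r3 g1 g2 g3) x y = (a * x $ Inl 1 * y $ Inl 1) *s even_vec 2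
     + (b * x $ Inl 1 * y $ Inl 1 + c * (x $ Inl 1 * y $ Inl 2 + x $ Inl 2 * y $ Inl 1)
        + d * x $ Inl 2 * y $ Inl 2) *s even_vec 3"
  using assms by (simp add: super32_eq_iff even32_iff sc_mult_triang numeral_type_neq)

lemma triang_even_odd:
  assumes "x \<in> even_part" "f \<in> odd_part"
  shows "sc_mult (triang a b c d r1 r2 r3 g1 g2 g3) x f =
     ((r1 * x $ Inl 1 + r2 * x $ Inl 2 + r3 * x $ Inl 3) * f $ Inr 2) *s odd_vec 1"
  using assms by (simp add: super32_eq_iff even32_iff odd32_iff sc_mult_triang numeral_type_neq)

lemmas triang_ev = super32_eq_iff even32_iff odd32_iff sc_mult_triang

lemma not_even_cubes: "\<not> even_cubes (triang 0 b c d r1 r2 r3 g1 g2 g3)"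
  by (simp add: even_cubes_def triang_ev)

lemma not_odd_products: "\<not> odd_products (triang a b c d r1 r2 r3 0 0 0)"
  by (simp add: odd_products_def triang_ev)

lemma not_even_acts: "\<not> even_acts (triang a b c d 0 0 0 g1 g2 g3)"
  by (simp add: even_acts_def triang_ev)

lemma not_even_products_act:
  "\<not> even_products_act (triang a b c d 0 0 0 g1 g2 g3)"
  "\<not> even_products_act (triang a b c 0 r1 0 0 0 0 g3)"
  by (simp_all add: even_products_act_def triang_ev)

lemma not_even_times_odd_products:
  "\<not> even_times_odd_products (triang a b c d r1 r2 r3 0 0 0)"
  "\<not> even_times_odd_products (triang a b c d r1 r2 r3 0 0 g3)"
  by (simp_all add: even_times_odd_products_def triang_ev)

lemma not_odd_product_squares:
  "\<not> odd_product_squares (triang a b c 0 r1 r2 r3 0 g2 g3)"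
  "\<not> odd_product_squares (triang a b c d r1 r2 r3 0 0 g3)"
  by (simp_all add: odd_product_squares_def triang_ev)

text \<open>The product is \<open>\<beta>(x, y) e\<^sub>3\<close>, and the 2 by 2 minors of \<open>\<beta>\<close> are multiples of its determinant.\<close>

lemma even_product_rank_2_triang:
  assumes "even_product_rank_2 (triang 0 b c d r1 r2 r3 g1 g2 g3)"
  shows "b * d - c * c \<noteq> 0"
proof
  assume *: "b * d - c * c = 0"
  obtain \<phi> x y z w where \<phi>: "functional \<phi>" and
     e: "x \<in> even_part" "y \<in> even_part" "z \<in> even_part" "w \<in> even_part" and
     ne: "\<phi> (sc_mult (triang 0 b c d r1 r2 r3 g1 g2 g3) x z) *
       \<phi> (sc_mult (triang 0 b c d r1 r2 r3 g1 g2 g3) y w) -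
       \<phi> (sc_mult (triang 0 b c d r1 r2 r3 g1 g2 g3) x w) *
       \<phi> (sc_mult (triang 0 b c d r1 r2 r3 g1 g2 g3) y z) \<noteq> 0"
    using assms unfolding even_product_rank_2_def by blast
  define B where "B u v = b * u $ Inl 1 * v $ Inl 1 + c * (u $ Inl 1 * v $ Inl 2 + u $ Inl 2 * v $ Inl 1)
        + d * u $ Inl 2 * v $ Inl 2" for u v :: "complex ^ (3 + 2)"
  have "\<phi> (sc_mult (triang 0 b c d r1 r2 r3 g1 g2 g3) u v) = B u v * \<phi> (even_vec 3)"
    if "u \<in> even_part" "v \<in> even_part" for u v
    using triang_even_even[OF that, of 0 b c d r1 r2 r3 g1 g2 g3]
    by (simp add: B_def functional_scale[OF \<phi>] functional_add[OF \<phi>] algebra_simps)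
  then have "(B x z * B y w - B x w * B y z) * (\<phi> (even_vec 3) * \<phi> (even_vec 3)) \<noteq> 0"
    using ne e by (simp add: algebra_simps)
  moreover have "B x z * B y w - B x w * B y z =
      (b * d - c * c) * (x $ Inl 1 * y $ Inl 2 - x $ Inl 2 * y $ Inl 1) * (z $ Inl 1 * w $ Inl 2 - z $ Inl 2 * w $ Inl 1)"
    unfolding B_def by algebra
  ultimately show False using * by simp
qed

lemma even_product_action_rank_2_triang:
  assumes "even_product_action_rank_2 (triang a b c d r1 r2 r3 g1 g2 g3)"
  obtains x1 x2 y1 y2 z1 z2 w1 w2 where
    "(r2 * (a * x1 * z1) + r3 * (b * x1 * z1 + c * (x1 * z2 + x2 * z1) + d * x2 * z2)) *
      (r2 * (a * y1 * w1) + r3 * (b * y1 * w1 + c * (y1 * w2 + y2 * w1) + d * y2 * w2)) \<noteq>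
      (r2 * (a * x1 * w1) + r3 * (b * x1 * w1 + c * (x1 * w2 + x2 * w1) + d * x2 * w2)) *
      (r2 * (a * y1 * z1) + r3 * (b * y1 * z1 + c * (y1 * z2 + y2 * z1) + d * y2 * z2))"
proof -
  let ?s = "triang a b c d r1 r2 r3 g1 g2 g3"
  obtain \<phi> f x y z w where \<phi>: "functional \<phi>" and f: "f \<in> odd_part" and
     e: "x \<in> even_part" "y \<in> even_part" "z \<in> even_part" "w \<in> even_part" and
     ne: "\<phi> (sc_mult ?s (sc_mult ?s x z) f) * \<phi> (sc_mult ?s (sc_mult ?s y w) f)
     - \<phi> (sc_mult ?s (sc_mult ?s x w) f) * \<phi> (sc_mult ?s (sc_mult ?s y z) f) \<noteq> 0"
    using assms unfolding even_product_action_rank_2_def by blast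
  define B where "B u v = r2 * (a * u $ Inl 1 * v $ Inl 1) + r3 * (b * u $ Inl 1 * v $ Inl 1
        + c * (u $ Inl 1 * v $ Inl 2 + u $ Inl 2 * v $ Inl 1) + d * u $ Inl 2 * v $ Inl 2)"
    for u v :: "complex ^ (3 + 2)"
  have "\<phi> (sc_mult ?s (sc_mult ?s u v) f) = B u v * (f $ Inr 2 * \<phi> (odd_vec 1))"
    if "u \<in> even_part" "v \<in> even_part" for u v
    using that
    by (simp add: triang_even_odd[OF sc_mult_even_even[OF that] f] functional_scale[OF \<phi>] functional_add[OF \<phi>] B_def
        sc_mult_triang even32_iff algebra_simps)
  then have "(B x z * B y w - B x w * B y z) * (f $ Inr 2 * \<phi> (odd_vec 1)) ^ 2 \<noteq> 0"
    using ne e by (simp add: algebra_simps power2_eq_square)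
  then have "B x z * B y w \<noteq> B x w * B y z" by auto
  then show thesis unfolding B_def by (rule that)
qed

lemma even_product_action_rank_2_19:
  assumes "even_product_action_rank_2 (triang 0 b c d r1 r2 r3 0 0 0)"
  shows "b * d - c * c \<noteq> 0" "r3 \<noteq> 0"
proof -
  obtain x1 x2 y1 y2 z1 z2 w1 w2 where *:
    "(r2 * (0 * x1 * z1) + r3 * (b * x1 * z1 + c * (x1 * z2 + x2 * z1) + d * x2 * z2)) *
      (r2 * (0 * y1 * w1) + r3 * (b * y1 * w1 + c * (y1 * w2 + y2 * w1) + d * y2 * w2)) \<noteq>
      (r2 * (0 * x1 * w1) + r3 * (b * x1 * w1 + c * (x1 * w2 + x2 * w1) + d * x2 * w2)) *
      (r2 * (0 * y1 * z1) + r3 * (b * y1 * z1 + c * (y1 * z2 + y2 * z1) + d * y2 * z2))"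
    (is "?l \<noteq> ?r")
    by (rule even_product_action_rank_2_triang[OF assms])
  then show "r3 \<noteq> 0" by auto
  have "?l - ?r = r3 * r3 * (b * d - c * c) * (x1 * y2 - x2 * y1) * (z1 * w2 - z2 * w1)"
    by algebra
  then show "b * d - c * c \<noteq> 0" using * by (metis eq_iff_diff_eq_0 mult_zero_left mult_zero_right)
qed

lemma not_even_product_action_rank_2:
  "\<not> even_product_action_rank_2 (triang a b c d r1 r2 0 g1 g2 g3)"
proof
  assume "even_product_action_rank_2 (triang a b c d r1 r2 0 g1 g2 g3)"
  then show False by (rule even_product_action_rank_2_triang) (simp add: algebra_simps)
qed

lemma not_action_kernel_squares:
  "\<not> action_kernel_squares (triang a b c d 0 0 0 g1 g2 g3)"
  by (auto simp: action_kernel_squares_def triang_even_odd functional_0)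

text \<open>Modulo \<open>e\<^sub>3\<close>, the vectors \<open>\<rho>(y) x - \<rho>(x) y\<close> are the multiples of \<open>r\<^sub>2 e\<^sub>1 - r\<^sub>1 e\<^sub>2\<close>, whose square is computed
  here.\<close>

lemma action_kernel_squares_triang:
  assumes "action_kernel_squares (triang a b c d r1 r2 0 g1 g2 g3)"
  shows "a * r2 \<noteq> 0 \<or> b * r2 * r2 - 2 * c * r1 * r2 + d * r1 * r1 \<noteq> 0"
proof -
  let ?s = "triang a b c d r1 r2 0 g1 g2 g3"
  obtain \<phi> f x y where \<phi>: "functional \<phi>" and f: "f \<in> odd_part" and
     e: "x \<in> even_part" "y \<in> even_part" and
     ne: "sc_mult ?s (\<phi> (sc_mult ?s y f) *s x - \<phi> (sc_mult ?s x f) *s y)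
       (\<phi> (sc_mult ?s y f) *s x - \<phi> (sc_mult ?s x f) *s y) \<noteq> 0"
    using assms unfolding action_kernel_squares_def by blast
  define l where "l = f $ Inr 2 * \<phi> (odd_vec 1)"
  define z where "z = \<phi> (sc_mult ?s y f) *s x - \<phi> (sc_mult ?s x f) *s y"
  define k where "k = l * (x $ Inl 1 * y $ Inl 2 - x $ Inl 2 * y $ Inl 1)"
  have act: "\<phi> (sc_mult ?s u f) = (r1 * u $ Inl 1 + r2 * u $ Inl 2) * l" if "u \<in> even_part" for u
    by (simp add: triang_even_odd[OF that f] functional_scale[OF \<phi>] l_def)
  have z: "z \<in> even_part" "z $ Inl 1 = k * r2" "z $ Inl 2 = - k * r1"
    using e by (simp_all add: z_def act k_def even32_iff algebra_simps)
  have "sc_mult ?s z z = (a * (k * r2) * (k * r2)) *s even_vec 2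
      + (k * k * (b * r2 * r2 - 2 * c * r1 * r2 + d * r1 * r1)) *s even_vec 3"
    by (simp add: triang_even_even[OF z(1) z(1)] z(2,3) algebra_simps)
  moreover have "sc_mult ?s z z \<noteq> 0" using ne unfolding z_def by assumption
  ultimately have "a * (k * r2) * (k * r2) \<noteq> 0 \<or>
    k * k * (b * r2 * r2 - 2 * c * r1 * r2 + d * r1 * r1) \<noteq> 0"
    by (metis add_0 vec.scale_zero_left)
  then show ?thesis by auto
qed

text \<open>It suffices to check an invariant open condition on the normal forms.\<close>

lemma rigid_if_open_condition:
  assumes J: "J \<in> NJS" and U: "open_condition U" "U J"
    and orbit: "\<And>u. normal_table u \<Longrightarrow> U u \<Longrightarrow> isomorphic J u"
  shows "rigid J"
proof -
  have "orbit J = {s. U s} \<inter> NJS"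
  proof (intro equalityI subsetI)
    fix s assume "s \<in> orbit J"
    then have "isomorphic J s" by (simp add: orbit_iff_isomorphic)
    then show "s \<in> {s. U s} \<inter> NJS"
      using U J NJS_isomorphic isomorphic_sym unfolding open_condition_def by blast
  next
    fix s assume s: "s \<in> {s. U s} \<inter> NJS"
    then obtain u where u: "normal_table u" "isomorphic u s" using normal_form by blast
    then have "U u" using s U(1) isomorphic_sym unfolding open_condition_def by blast
    then have "isomorphic J s" using orbit u isomorphic_trans by blast
    then show "s \<in> orbit J" by (simp add: orbit_iff_isomorphic)
  qed
  then show ?thesis
    using J U(1) unfolding rigid_def open_condition_def openin_subtopology by blast
qed

lemma even_cubes_J: "even_cubes J25" "even_cubes J27" "even_cubes J29"
  unfolding J_eq_triang even_cubes_def
  by (intro exI[of _ "even_vec 1"]; simp add: triang_ev numeral_type_neq)+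

lemma even_acts_J: "even_acts J19" "even_acts J23" "even_acts J27" "even_acts J29"
  unfolding J_eq_triang even_acts_def
  by (rule exI[of _ "even_vec 3"] exI[of _ "even_vec 1"] exI[of _ "even_vec 2"],
      rule exI[of _ "odd_vec 2"], (simp add: triang_ev numeral_type_neq; fail))+

lemma odd_products_J: "odd_products J18" "odd_products J23" "odd_products J25" "odd_products J29"
  unfolding J_eq_triang odd_products_def
  by (rule exI[of _ "odd_vec 1"], rule exI[of _ "odd_vec 2"], simp add: triang_ev numeral_type_neq)+

text \<open>Among the families with nonvanishing even cubes, only this one has \<open>\<rho>(x\<^sup>2) \<noteq> 0\<close>.\<close>

lemma rigid_27: "rigid J27"
proof (rule rigid_if_open_condition[of J27 "\<lambda>s. even_cubes s \<and> even_products_act s"])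
  show "J27 \<in> NJS" by (rule six_subset_NJS) (simp add: six_def)
  show "open_condition (\<lambda>s :: (3, 2) sconsts. even_cubes s \<and> even_products_act s)"
    by (intro open_condition_conj open_even_cubes open_even_products_act)
  have "even_products_act J27"
    unfolding J_eq_triang even_products_act_def
    by (rule exI[of _ "even_vec 1"], rule exI[of _ "even_vec 1"], rule exI[of _ "odd_vec 2"],
        simp add: triang_ev numeral_type_neq)
  then show "even_cubes J27 \<and> even_products_act J27" by (simp add: even_cubes_J)
  fix u assume "normal_table u" "even_cubes u \<and> even_products_act u"
  then show "isomorphic J27 u"
    by (cases rule: normal_table.cases)
      (simp_all add: not_even_cubes not_even_products_act isomorphic_J27)
qed

text \<open>Among the families with nonvanishing even cubes, only this one has \<open>x \<gamma> \<noteq> 0\<close>.\<close>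

lemma rigid_25: "rigid J25"
proof (rule rigid_if_open_condition[of J25 "\<lambda>s. even_cubes s \<and> even_times_odd_products s"])
  show "J25 \<in> NJS" by (rule six_subset_NJS) (simp add: six_def)
  show "open_condition (\<lambda>s :: (3, 2) sconsts. even_cubes s \<and> even_times_odd_products s)"
    by (intro open_condition_conj open_even_cubes open_even_times_odd_products)
  have "even_times_odd_products J25"
    unfolding J_eq_triang even_times_odd_products_def
    by (rule exI[of _ "even_vec 1"], rule exI[of _ "odd_vec 1"], rule exI[of _ "odd_vec 2"],
        simp add: triang_ev numeral_type_neq)
  then show "even_cubes J25 \<and> even_times_odd_products J25" by (simp add: even_cubes_J)
  fix u assume "normal_table u" "even_cubes u \<and> even_times_odd_products u"
  then show "isomorphic J25 u"
    by (cases rule: normal_table.cases)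
      (simp_all add: not_even_cubes not_even_times_odd_products isomorphic_J25)
qed

text \<open>Among the families with nonvanishing even cubes, the other two have \<open>\<gamma> = 0\<close> or \<open>\<rho> = 0\<close>.\<close>

lemma rigid_29: "rigid J29"
proof (rule rigid_if_open_condition[of J29 "\<lambda>s. even_cubes s \<and> even_acts s \<and> odd_products s"])
  show "J29 \<in> NJS" by (rule six_subset_NJS) (simp add: six_def)
  show "open_condition (\<lambda>s :: (3, 2) sconsts. even_cubes s \<and> even_acts s \<and> odd_products s)"
    by (intro open_condition_conj open_even_cubes open_even_acts open_odd_products)
  show "even_cubes J29 \<and> even_acts J29 \<and> odd_products J29"
    by (simp add: even_cubes_J even_acts_J odd_products_J)
  fix u assume "normal_table u" and U: "even_cubes u \<and> even_acts u \<and> odd_products u"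
  then show "isomorphic J29 u"
  proof (cases rule: normal_table.cases)
    case (n29 a b c r1 g3)
    have "a \<noteq> 0" using U n29 not_even_cubes by metis
    moreover have "\<not> even_cubes (triang a b 0 0 r1 0 0 0 0 g3)"
      by (simp add: even_cubes_def triang_ev)
    then have "c \<noteq> 0" using U n29 by metis
    moreover have "r1 \<noteq> 0" using U n29 not_even_acts by metis
    moreover have "g3 \<noteq> 0" using U n29 not_odd_products by metis
    ultimately show ?thesis using n29 isomorphic_J29 by metis
  qed (use U in \<open>simp_all add: not_even_cubes not_even_acts not_odd_products\<close>)
qed

text \<open>The form \<open>\<rho>(x y)\<close> has rank at most 1 in the family of \<^const>\<open>J27\<close>, and it vanishes in the remaining
  families because \<open>\<rho>\<close> kills all products of even vectors.\<close>

lemma rigid_19: "rigid J19"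
proof (rule rigid_if_open_condition[of J19 even_product_action_rank_2])
  show "J19 \<in> NJS" by (rule six_subset_NJS) (simp add: six_def)
  show "open_condition (even_product_action_rank_2 :: (3, 2) sconsts \<Rightarrow> bool)"
    by (rule open_even_product_action_rank_2)
  have fn: "functional (\<lambda>v :: complex ^ (3 + 2). v $ Inr 1)" by (rule functionalI) simp_all
  show "even_product_action_rank_2 J19"
    unfolding J_eq_triang even_product_action_rank_2_def
    by (rule exI[of _ "\<lambda>v. v $ Inr 1"], rule exI[of _ "odd_vec 2"], rule exI[of _ "even_vec 1"],
        rule exI[of _ "even_vec 2"], rule exI[of _ "even_vec 1"], rule exI[of _ "even_vec 2"])
      (simp add: fn triang_ev numeral_type_neq)
  fix u assume "normal_table u" and U: "even_product_action_rank_2 u"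
  then show "isomorphic J19 u"
  proof (cases rule: normal_table.cases)
    case (n19 b c d r1 r2 r3)
    then show ?thesis using isomorphic_J19 even_product_action_rank_2_19 U by metis
  qed (use U in \<open>simp_all add: not_even_product_action_rank_2\<close>)
qed

text \<open>The condition \<open>\<gamma>\<^sup>2 \<noteq> 0\<close> singles out the family, but not its members with \<open>\<beta>\<close> of rank 1; the second
  condition excludes them.\<close>

lemma rigid_18: "rigid J18"
proof (rule rigid_if_open_condition[of J18 "\<lambda>s. odd_product_squares s \<and> even_product_rank_2 s"])
  show "J18 \<in> NJS" by (rule six_subset_NJS) (simp add: six_def)
  show "open_condition (\<lambda>s :: (3, 2) sconsts. odd_product_squares s \<and> even_product_rank_2 s)"
    by (intro open_condition_conj open_odd_product_squares open_even_product_rank_2)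
  have "odd_product_squares J18"
    unfolding J_eq_triang odd_product_squares_def
    by (rule exI[of _ "odd_vec 1"], rule exI[of _ "odd_vec 2"], simp add: triang_ev numeral_type_neq)
  moreover have fn: "functional (\<lambda>v :: complex ^ (3 + 2). v $ Inl 3)" by (rule functionalI) simp_all
  have "even_product_rank_2 J18"
    unfolding J_eq_triang even_product_rank_2_def
    by (rule exI[of _ "\<lambda>v. v $ Inl 3"], rule exI[of _ "even_vec 1"],
        rule exI[of _ "even_vec 2"], rule exI[of _ "even_vec 1"], rule exI[of _ "even_vec 2"])
      (simp add: fn triang_ev numeral_type_neq)
  ultimately show "odd_product_squares J18 \<and> even_product_rank_2 J18" by simp
  fix u assume "normal_table u" and U: "odd_product_squares u \<and> even_product_rank_2 u"
  then show "isomorphic J18 u"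
  proof (cases rule: normal_table.cases)
    case (n18 b c d g1 g2 g3)
    have "b * g1 * g1 + 2 * c * g1 * g2 + d * g2 * g2 \<noteq> 0"
    proof
      assume *: "b * g1 * g1 + 2 * c * g1 * g2 + d * g2 * g2 = 0"
      have "b * (g1 * t) * (g1 * t) + c * (2 * (g1 * (g2 * (t * t)))) + d * (g2 * t) * (g2 * t) = 0" for t
        using * by algebra
      then have "\<not> odd_product_squares (triang 0 b c d 0 0 0 g1 g2 g3)"
        by (simp add: odd_product_squares_def triang_ev)
      then show False using U n18 by simp
    qed
    then show ?thesis using isomorphic_J18 even_product_rank_2_triang U n18 by metis
  qed (use U in \<open>simp_all add: not_odd_product_squares\<close>)
qed

text \<open>The conditions \<open>\<gamma> \<noteq> 0\<close> and \<open>\<rho> \<noteq> 0\<close> leave the families of \<^const>\<open>J23\<close> and \<^const>\<open>J29\<close>. In the latter the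
  kernel of \<open>\<rho>\<close> on the even part is spanned by \<open>e\<^sub>2\<close> and \<open>e\<^sub>3\<close> and has zero square. The rank condition
  excludes members of the former with \<open>\<beta>\<close> of rank 1.\<close>

lemma rigid_23: "rigid J23"
proof (rule rigid_if_open_condition[of J23 "\<lambda>s. odd_products s \<and> action_kernel_squares s \<and> even_product_rank_2 s"])
  show "J23 \<in> NJS" by (rule six_subset_NJS) (simp add: six_def)
  show "open_condition (\<lambda>s :: (3, 2) sconsts. odd_products s \<and> action_kernel_squares s \<and> even_product_rank_2 s)"
    by (intro open_condition_conj open_odd_products open_action_kernel_squares open_even_product_rank_2)
  have fn: "functional (\<lambda>v :: complex ^ (3 + 2). v $ Inl 3)" "functional (\<lambda>v :: complex ^ (3 + 2). v $ Inr 1)"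
    by (rule functionalI; simp)+
  have "even_product_rank_2 J23"
    unfolding J_eq_triang even_product_rank_2_def
    by (rule exI[of _ "\<lambda>v. v $ Inl 3"], rule exI[of _ "even_vec 1"],
        rule exI[of _ "even_vec 2"], rule exI[of _ "even_vec 1"], rule exI[of _ "even_vec 2"])
      (simp add: fn triang_ev numeral_type_neq)
  moreover have "action_kernel_squares J23"
    unfolding J_eq_triang action_kernel_squares_def
    by (rule exI[of _ "\<lambda>v. v $ Inr 1"], rule exI[of _ "odd_vec 2"], rule exI[of _ "even_vec 1"],
        rule exI[of _ "even_vec 2"]) (simp add: fn triang_ev numeral_type_neq)
  ultimately show "odd_products J23 \<and> action_kernel_squares J23 \<and> even_product_rank_2 J23"
    by (simp add: odd_products_J)
  fix u assume "normal_table u" and U: "odd_products u \<and> action_kernel_squares u \<and> even_product_rank_2 u"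
  then show "isomorphic J23 u"
  proof (cases rule: normal_table.cases)
    case (n23 b c d r1 r2 g3)
    have "b * d - c * c \<noteq> 0" using even_product_rank_2_triang U n23 by metis
    moreover have "g3 \<noteq> 0" using U n23 not_odd_products by metis
    moreover have "d * r1 * r1 - 2 * c * r1 * r2 + b * r2 * r2 \<noteq> 0"
    proof -
      have "action_kernel_squares (triang 0 b c d r1 r2 0 0 0 g3)" using U n23 by simp
      from action_kernel_squares_triang[OF this] show ?thesis by (simp add: algebra_simps)
    qed
    ultimately show ?thesis using isomorphic_J23 n23 by metis
  next
    case (n29 a b c r1 g3)
    have "action_kernel_squares (triang a b c 0 r1 0 0 0 0 g3)" using U n29 by simp
    from action_kernel_squares_triang[OF this] show ?thesis by simp
  qed (use U in \<open>simp_all add: not_odd_products not_action_kernel_squares\<close>)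
qed

lemma rigid_six: "J \<in> six \<Longrightarrow> rigid J"
  using rigid_18 rigid_19 rigid_23 rigid_25 rigid_27 rigid_29 by (auto simp: six_def)

section \<open>Components and rigid algebras\<close>

text \<open>The open orbit of \<open>s\<close> meets the orbit of \<open>J\<close>, since \<open>s\<close> lies in the closure of the latter.\<close>

lemma isomorphic_of_rigid_in_closure:
  assumes "rigid s" "s \<in> zariski closure_of orbit J" "J \<in> NJS"
  shows "isomorphic s J"
proof -
  obtain V where V: "openin zariski V" "orbit s = V \<inter> NJS"
    using assms(1) unfolding rigid_def openin_subtopology by blast
  have "s \<in> V" using V(2) orbit_refl[of s] by blast
  then obtain t where t: "t \<in> orbit J" "t \<in> V"
    using assms(2) V(1) unfolding in_closure_of by blast
  then have "t \<in> orbit s" using V(2) orbit_subset_NJS[OF assms(3)] by blast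
  then have "isomorphic s t" by (simp add: orbit_iff_isomorphic)
  moreover have "isomorphic t J" using t(1) by (simp add: orbit_iff_isomorphic isomorphic_sym)
  ultimately show ?thesis by (rule isomorphic_trans)
qed

lemma isomorphic_invariants:
  assumes "isomorphic s t"
  shows "even_cubes s \<longleftrightarrow> even_cubes t" "even_acts s \<longleftrightarrow> even_acts t" "odd_products s \<longleftrightarrow> odd_products t"
  using assms isomorphic_sym[OF assms] open_even_cubes open_even_acts open_odd_products
  unfolding open_condition_def by blast+

text \<open>The three truth values differ between any two of the six algebras.\<close>

lemma invariants_six:
  "\<not> even_cubes J18" "\<not> even_acts J18" "odd_products J18"
  "\<not> even_cubes J19" "even_acts J19" "\<not> odd_products J19"
  "\<not> even_cubes J23" "even_acts J23" "odd_products J23"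
  "even_cubes J25" "\<not> even_acts J25" "odd_products J25"
  "even_cubes J27" "even_acts J27" "\<not> odd_products J27"
  "even_cubes J29" "even_acts J29" "odd_products J29"
  using even_cubes_J even_acts_J odd_products_J
  by (simp_all add: J_eq_triang not_even_cubes not_even_acts not_odd_products)

lemma six_not_isomorphic:
  assumes "J \<in> six" "K \<in> six" "isomorphic J K"
  shows "J = K"
  using assms(1,2) isomorphic_invariants[OF assms(3)] unfolding six_def
  by (elim insertE emptyE) (simp_all add: invariants_six)

lemma card_six: "card six = 6"
proof -
  have "J18 \<noteq> J19" "J18 \<noteq> J23" "J18 \<noteq> J25" "J18 \<noteq> J27" "J18 \<noteq> J29"
    "J19 \<noteq> J23" "J19 \<noteq> J25" "J19 \<noteq> J27" "J19 \<noteq> J29" "J23 \<noteq> J25" "J23 \<noteq> J27" "J23 \<noteq> J29"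
    "J25 \<noteq> J27" "J25 \<noteq> J29" "J27 \<noteq> J29"
    using invariants_six by metis+
  then show ?thesis by (simp add: six_def)
qed

lemma closure_orbit_six_subset:
  assumes "J \<in> six" "K \<in> six" "zariski closure_of orbit J \<subseteq> zariski closure_of orbit K"
  shows "J = K"
proof -
  have "J \<in> zariski closure_of orbit J"
    using closure_of_subset[of "orbit J" zariski] orbit_refl[of J] by auto
  then have "J \<in> zariski closure_of orbit K" using assms(3) by blast
  then have "isomorphic J K"
    by (rule isomorphic_of_rigid_in_closure[OF rigid_six[OF assms(1)] _ six_subset_NJS[OF assms(2)]])
  then show ?thesis by (rule six_not_isomorphic[OF assms(1,2)])
qed

theorem theorem4p3:
  shows "irreducible_components (subtopology zariski (NJS :: (3, 2) sconsts set)) =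
           {zariski closure_of orbit J18, zariski closure_of orbit J19,
            zariski closure_of orbit J23, zariski closure_of orbit J25,
            zariski closure_of orbit J27, zariski closure_of orbit J29} \<and>
         card (irreducible_components (subtopology zariski (NJS :: (3, 2) sconsts set))) = 6 \<and>
         (\<forall>s :: (3, 2) sconsts.
            rigid s \<longleftrightarrow> (\<exists>t \<in> {J18, J19, J23, J25, J27, J29}. isomorphic s t))"
proof -
  let ?C = "\<lambda>J :: (3, 2) sconsts. zariski closure_of orbit J"
  have comps: "irreducible_components (subtopology zariski (NJS :: (3, 2) sconsts set)) = ?C ` six"
  proof (rule irreducible_components_eq)
    show "finite (?C ` six)" by (simp add: six_def)
    show "NJS = \<Union>(?C ` six)" by (rule NJS_eq_Union_closures)
    show "NJS \<subseteq> topspace zariski" by simp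
    show "closedin zariski C" if "C \<in> ?C ` six" for C
      using that by auto
    show "irreducible_in zariski C" if "C \<in> ?C ` six" for C
      using that irreducible_in_closure[OF orbit_irreducible] by blast
    show "C = D" if "C \<in> ?C ` six" "D \<in> ?C ` six" "C \<subseteq> D" for C D
      using that closure_orbit_six_subset by blast
  qed
  have "inj_on ?C six"
    by (rule inj_onI) (simp add: closure_orbit_six_subset)
  then have card: "card (?C ` six) = 6" by (simp add: card_image card_six)
  have rigid: "rigid s \<longleftrightarrow> (\<exists>t\<in>six. isomorphic s t)" for s
  proof
    assume s: "rigid s"
    then have "s \<in> NJS" by (simp add: rigid_def)
    then obtain J where "J \<in> six" "s \<in> ?C J" unfolding NJS_eq_Union_closures by blast
    then show "\<exists>t\<in>six. isomorphic s t"
      using isomorphic_of_rigid_in_closure[OF s] six_subset_NJS by blast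
  next
    assume "\<exists>t\<in>six. isomorphic s t"
    then obtain t where t: "t \<in> six" "isomorphic s t" by blast
    then show "rigid s"
      using rigid_six[OF t(1)] orbit_eq[OF t(2)] NJS_isomorphic[OF t(2)] by (simp add: rigid_def)
  qed
  show ?thesis
  proof (intro conjI allI)
    show "irreducible_components (subtopology zariski (NJS :: (3, 2) sconsts set)) =
           {zariski closure_of orbit J18, zariski closure_of orbit J19,
            zariski closure_of orbit J23, zariski closure_of orbit J25,
            zariski closure_of orbit J27, zariski closure_of orbit J29}"
      unfolding comps six_def image_insert image_empty ..
    show "card (irreducible_components (subtopology zariski (NJS :: (3, 2) sconsts set))) = 6"
      unfolding comps by (rule card)
    show "rigid s \<longleftrightarrow> (\<exists>t \<in> {J18, J19, J23, J25, J27, J29}. isomorphic s t)" for s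
      using rigid[of s] unfolding six_def .
  qed
qed

end
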